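(* Let $d\ge 1$ and let $\mathcal{A} = \begin{pmatrix} A & B \\ C & D\end{pmatrix}\in \mathrm{Sp}(4d,\mathbb{R})$ with blocks $A,B,C,D\in\mathbb{R}^{2d\times 2d}$, and assume that $B$ is invertible. Consider the symmetric matrix $P = B^{-1}A = \begin{pmatrix} P_{11} & P_{12} \\ P_{21} & P_{22}\end{pmatrix}$ with $d\times d$ blocks $P_{jk}$. (i) If $P$ is not block-diagonal, i.e., $P_{12} = P_{21}^t \neq 0$, then $\mathrm{W}_{\mathcal{A}}$ satisfies the following uncertainty principle: for all $f,g\in L^2(\mathbb{R}^d)$, if $\mathrm{W}_{\mathcal{A}}(f,g)$ is supported on a set of finite measure, then $f\equiv 0$ or $g\equiv 0$. (ii) If $P$ is block-diagonal, i.e., $P_{12} = P_{21}^t = 0$, then there exist non-zero functions $f,g\in L^2(\mathbb{R}^d)$ such that the support of $\mathrm{W}_{\mathcal{A}}(f,g)$ is compact.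
   Context: Symplectic group: for $n\ge1$, $\mathrm{Sp}(2n,\mathbb{R})=\{\mathcal{A}\in\mathbb{R}^{2n\times 2n}:\mathcal{A}^t\mathcal{J}\mathcal{A}=\mathcal{J}\}$ with $\mathcal{J}=\begin{pmatrix}0&I_n\\-I_n&0\end{pmatrix}$. Metaplectic operators: for $x,\omega\in\mathbb{R}^n$ let $T_xf(t)=f(t-x)$, $M_\omega f(t)=e^{2\pi i\omega\cdot t}f(t)$ and $\rho(x,\omega)=T_{x/2}M_\omega T_{x/2}$ on $L^2(\mathbb{R}^n)$. For every $\mathcal{A}\in\mathrm{Sp}(2n,\mathbb{R})$ there is a unitary operator $\mu(\mathcal{A})$ on $L^2(\mathbb{R}^n)$, unique up to a constant phase factor in $\mathbb{T}=\{z\in\mathbb{C}:|z|=1\}$, with $\rho(\mathcal{A}\lambda)=\mu(\mathcal{A})\rho(\lambda)\mu(\mathcal{A})^{-1}$ for all $\lambda\in\mathbb{R}^{2n}$. The choice of phase is irrelevant for the statement. With suitable phases, $\mu\begin{pmatrix}L&0\\0&L^{-t}\end{pmatrix}f(x)=|\det L|^{-1/2}f(L^{-1}x)$, $\mu\begin{pmatrix}I&0\\Q&I\end{pmatrix}f(x)=e^{\pi i x\cdot Qx}f(x)$ for $Q=Q^t$, and $\mu(\mathcal{J})f=\hat f$ with $\hat f(\omega)=\int f(x)e^{-2\pi i x\cdot\omega}\,dx$. Metaplectic Wigner distribution: for $\mathcal{A}\in\mathrm{Sp}(4d,\mathbb{R})$ (so $n=2d$) and $f,g\in L^2(\mathbb{R}^d)$,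 $\mathrm{W}_{\mathcal{A}}(f,g)=\mu(\mathcal{A})(f\otimes\overline{g})\in L^2(\mathbb{R}^{2d})$, where $(f\otimes\overline g)(x,y)=f(x)\overline{g(y)}$. A function is "supported on a set $S$" if it vanishes almost everywhere outside $S$; compact support means it vanishes almost everywhere outside some compact set. Measure means Lebesgue measure; $f\equiv0$ means $f=0$ almost everywhere. *)

theory Defs
  imports "HOL-Analysis.Analysis"
begin

section \<open>Block matrices and the symplectic group\<close>

text \<open>
  A vector of \<open>\<real>\<^sup>2\<^sup>n\<close> is an element of \<open>real ^ ('n + 'n)\<close>: the coordinates \<open>Inl i\<close> form its
  first half and the coordinates \<open>Inr i\<close> its second half. In particular \<open>\<real>\<^sup>4\<^sup>d\<close> is
  \<open>real ^ (('d + 'd) + ('d + 'd))\<close>.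
\<close>

definition vfst :: "real ^ ('n::finite + 'n) \<Rightarrow> real ^ 'n" where
  "vfst z = (\<chi> i. z $ Inl i)"

definition vsnd :: "real ^ ('n::finite + 'n) \<Rightarrow> real ^ 'n" where
  "vsnd z = (\<chi> i. z $ Inr i)"

definition block_mat ::
  "real ^ 'n::finite ^ 'n \<Rightarrow> real ^ 'n ^ 'n \<Rightarrow> real ^ 'n ^ 'n \<Rightarrow> real ^ 'n ^ 'n
    \<Rightarrow> real ^ ('n + 'n) ^ ('n + 'n)" where
  "block_mat A B C D = (\<chi> i j.
     (case i of
        Inl k \<Rightarrow> (case j of Inl l \<Rightarrow> A $ k $ l | Inr l \<Rightarrow> B $ k $ l)
      | Inr k \<Rightarrow> (case j of Inl l \<Rightarrow> C $ k $ l | Inr l \<Rightarrow> D $ k $ l)))"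

definition sympl_J :: "real ^ ('n::finite + 'n) ^ ('n + 'n)" where
  "sympl_J = block_mat 0 (mat 1) (- mat 1) 0"

definition Sp :: "(real ^ ('n::finite + 'n) ^ ('n + 'n)) set" where
  "Sp = {M. transpose M ** sympl_J ** M = sympl_J}"

section \<open>The Hilbert space of square-integrable functions\<close>

text \<open>
  Elements of \<open>L\<^sup>2\<close> are handled through representatives; \<open>aeq\<close> is the identification of
  representatives, and operators on \<open>L\<^sup>2\<close> are maps on functions of which only the values on \<open>L2\<close>,
  up to \<open>aeq\<close>, matter.
\<close>

definition L2 :: "(real ^ 'n::finite \<Rightarrow> complex) set" where
  "L2 = {f. f \<in> borel_measurable lebesgue \<and> integrable lebesgue (\<lambda>x. (cmod (f x))\<^sup>2)}"

definition aeq :: "(real ^ 'n::finite \<Rightarrow> complex) \<Rightarrow> (real ^ 'n \<Rightarrow> complex) \<Rightarrow> bool" where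
  "aeq f g \<longleftrightarrow> (AE x in lebesgue. f x = g x)"

definition L2_inner :: "(real ^ 'n::finite \<Rightarrow> complex) \<Rightarrow> (real ^ 'n \<Rightarrow> complex) \<Rightarrow> complex" where
  "L2_inner f g = (LINT x|lebesgue. f x * cnj (g x))"

definition unitary_L2 :: "((real ^ 'n::finite \<Rightarrow> complex) \<Rightarrow> (real ^ 'n \<Rightarrow> complex)) \<Rightarrow> bool" where
  "unitary_L2 U \<longleftrightarrow>
     (\<forall>f\<in>L2. U f \<in> L2) \<and>
     (\<forall>f\<in>L2. \<forall>g\<in>L2. aeq f g \<longrightarrow> aeq (U f) (U g)) \<and>
     (\<forall>f\<in>L2. \<forall>g\<in>L2. \<forall>a b. aeq (U (\<lambda>x. a * f x + b * g x)) (\<lambda>x. a * U f x + b * U g x)) \<and>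
     (\<forall>f\<in>L2. \<forall>g\<in>L2. L2_inner (U f) (U g) = L2_inner f g) \<and>
     (\<forall>h\<in>L2. \<exists>f\<in>L2. aeq (U f) h)"

section \<open>Metaplectic operators\<close>

definition translation :: "real ^ 'n::finite \<Rightarrow> (real ^ 'n \<Rightarrow> complex) \<Rightarrow> (real ^ 'n \<Rightarrow> complex)" where
  "translation x f = (\<lambda>t. f (t - x))"

definition modulation :: "real ^ 'n::finite \<Rightarrow> (real ^ 'n \<Rightarrow> complex) \<Rightarrow> (real ^ 'n \<Rightarrow> complex)" where
  "modulation \<omega> f = (\<lambda>t. exp (2 * complex_of_real pi * \<i> * complex_of_real (\<omega> \<bullet> t)) * f t)"

definition rho :: "real ^ ('n::finite + 'n) \<Rightarrow> (real ^ 'n \<Rightarrow> complex) \<Rightarrow> (real ^ 'n \<Rightarrow> complex)" where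
  "rho z = translation ((1/2) *\<^sub>R vfst z) \<circ> modulation (vsnd z) \<circ> translation ((1/2) *\<^sub>R vfst z)"

text \<open>
  \<open>metaplectic \<A> U\<close>: the operator \<open>U\<close> is one of the possible choices, which differ by a phase,
  of the metaplectic operator of \<open>\<A>\<close>. The relation \<open>\<rho>(\<A>z) = U \<rho>(z) U\<^sup>-\<^sup>1\<close> is evaluated at the
  elements \<open>U f\<close>, which exhaust \<open>L\<^sup>2\<close>, because on representatives \<open>U\<close> is invertible only up to
  \<open>aeq\<close>.
\<close>

definition metaplectic ::
  "real ^ ('n::finite + 'n) ^ ('n + 'n) \<Rightarrow> ((real ^ 'n \<Rightarrow> complex) \<Rightarrow> (real ^ 'n \<Rightarrow> complex)) \<Rightarrow> bool" where
  "metaplectic \<A> U \<longleftrightarrow>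
     unitary_L2 U \<and> (\<forall>z. \<forall>f\<in>L2. aeq (rho (\<A> *v z) (U f)) (U (rho z f)))"

section \<open>Metaplectic Wigner distributions\<close>

definition tensor_cnj ::
  "(real ^ 'd::finite \<Rightarrow> complex) \<Rightarrow> (real ^ 'd \<Rightarrow> complex) \<Rightarrow> (real ^ ('d + 'd) \<Rightarrow> complex)" where
  "tensor_cnj f g = (\<lambda>z. f (vfst z) * cnj (g (vsnd z)))"

text \<open>\<open>Wigner U\<close> is \<open>W\<^sub>\<A>\<close> when \<open>U\<close> is a metaplectic operator of \<open>\<A>\<close>.\<close>

definition Wigner ::
  "((real ^ ('d::finite + 'd) \<Rightarrow> complex) \<Rightarrow> (real ^ ('d + 'd) \<Rightarrow> complex))
    \<Rightarrow> (real ^ 'd \<Rightarrow> complex) \<Rightarrow> (real ^ 'd \<Rightarrow> complex) \<Rightarrow> (real ^ ('d + 'd) \<Rightarrow> complex)" where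
  "Wigner U f g = U (tensor_cnj f g)"

definition supported_on :: "(real ^ 'n::finite \<Rightarrow> complex) \<Rightarrow> (real ^ 'n) set \<Rightarrow> bool" where
  "supported_on F S \<longleftrightarrow> (AE x in lebesgue. x \<notin> S \<longrightarrow> F x = 0)"

section \<open>Symmetry of the matrix \<open>B\<^sup>-\<^sup>1 A\<close>\<close>

lemma sum_UNIV_Plus:
  fixes h :: "('a::finite + 'b::finite) \<Rightarrow> real"
  shows "(\<Sum>k\<in>UNIV. h k) = (\<Sum>k\<in>UNIV. h (Inl k)) + (\<Sum>k\<in>UNIV. h (Inr k))"
  by (simp add: UNIV_Plus_UNIV[symmetric] sum.Plus del: UNIV_Plus_UNIV)

lemma block_mat_mult:
  "block_mat A B C D ** block_mat A' B' C' D' =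
   block_mat (A ** A' + B ** C') (A ** B' + B ** D') (C ** A' + D ** C') (C ** B' + D ** D')"
  by (auto simp: vec_eq_iff block_mat_def matrix_matrix_mult_def sum_UNIV_Plus split: sum.split)

lemma transpose_block_mat:
  "transpose (block_mat A B C D) =
   block_mat (transpose A) (transpose C) (transpose B) (transpose D)"
  by (auto simp: vec_eq_iff block_mat_def transpose_def split: sum.split)

lemma block_mat_eq_iff:
  "block_mat A B C D = block_mat A' B' C' D' \<longleftrightarrow> A = A' \<and> B = B' \<and> C = C' \<and> D = D'"
  by (auto simp: vec_eq_iff block_mat_def split_sum_all)

lemma symmetric_inv_B_A:
  fixes A B C D :: "real ^ 'n::finite ^ 'n"
  assumes "block_mat A B C D \<in> Sp" and "invertible B"
  shows "transpose (matrix_inv B ** A) = matrix_inv B ** A"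
proof -
  define M where "M = block_mat A B C D"
  define N where "N = block_mat (transpose D) (- transpose B) (- transpose C) (transpose A)"
  have one: "block_mat (mat 1) 0 0 (mat 1) = (mat 1 :: real ^ ('n + 'n) ^ ('n + 'n))"
    by (auto simp: vec_eq_iff block_mat_def mat_def split: sum.split)
  have neg: "X ** (- Y) = - (X ** Y)" "(- X) ** Y = - (X ** Y)" for X Y :: "real ^ 'n ^ 'n"
    by (auto simp: vec_eq_iff matrix_matrix_mult_def sum_negf)
  have "transpose M ** sympl_J ** M = sympl_J"
    using assms(1) by (simp add: Sp_def M_def)
  then have eqs: "transpose A ** C - transpose C ** A = 0" "transpose A ** D - transpose C ** B = mat 1"
      "transpose B ** C - transpose D ** A = - mat 1" "transpose B ** D - transpose D ** B = 0"
    by (simp_all add: M_def sympl_J_def transpose_block_mat block_mat_mult block_mat_eq_iff neg)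
  have "N ** M = mat 1"
    using eqs unfolding one[symmetric] N_def M_def block_mat_mult block_mat_eq_iff
    by (simp add: neg algebra_simps)
  then have "M ** N = mat 1"
    by (simp add: matrix_left_right_inverse)
  then have AB: "A ** transpose B = B ** transpose A"
    unfolding one[symmetric] N_def M_def block_mat_mult block_mat_eq_iff by (simp add: neg)
  let ?B = "matrix_inv B"
  have B: "B ** ?B = mat 1" "?B ** B = mat 1"
    using someI_ex[OF \<open>invertible B\<close>[unfolded invertible_def]] by (simp_all add: matrix_inv_def)
  then have Bt: "transpose B ** transpose ?B = mat 1"
    by (metis matrix_transpose_mul transpose_mat)
  have "?B ** A = ?B ** (A ** transpose B) ** transpose ?B"
    by (metis Bt matrix_mul_assoc matrix_mul_rid)
  also have "\<dots> = transpose A ** transpose ?B"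
    by (metis AB B(2) matrix_mul_assoc matrix_mul_lid)
  finally show ?thesis
    by (simp add: matrix_transpose_mul)
qed

end

theory Submission
  imports Defs "HOL-Probability.Characteristic_Functions"
begin

text \<open>
  The covariance relation determines \<open>\<mu>\<close> on a chirped Gaussian up to a scalar, and this yields
  the integral formula for \<open>\<mu>\<^sup>-\<^sup>1\<close>: up to chirps and the linear map \<open>B\<close>, the Wigner distribution of
  \<open>(f, g)\<close> is the Fourier transform of \<open>f(s) g(t) e\<^sup>2\<^sup>\<pi>\<^sup>i\<^sup>s\<^sup>\<sqdot>\<^sup>M\<^sup>t\<close> with \<open>M = P\<^sub>1\<^sub>2\<close>. If \<open>M = 0\<close>, it is the
  tensor product of two Fourier transforms, which may be indicators of cubes.

  If \<open>M \<noteq> 0\<close>, a linear substitution turns \<open>M\<close> into an orthogonal projection \<open>E\<close>. On almost every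
  fibre over the kernel of \<open>E\<close> the function is a short-time Fourier transform in the variables of
  the range of \<open>E\<close>, with a support of finite measure. Its translates by small multiples of one vector
  of that range span a space of short-time Fourier transforms with the same window, of
  arbitrarily large dimension \<open>N\<close> and supported in one set \<open>T\<close> of bounded measure. By Bessel's inequality
  an orthonormal basis of it satisfies \<open>\<Sum>\<^sub>k |\<Theta>\<^sub>k|\<^sup>2 \<le> 1\<close> pointwise, so \<open>N \<le> |T|\<close>, a contradiction
  (the argument of Amrein and Berthier).
\<close>

section \<open>Gaussians and their Fourier transforms\<close>

text \<open>The operator is known only through the covariance relation, so a formula has to be
  extracted from inner products. The chirp with matrix -\<open>P\<close> is chosen because
  phase-space shifts along the graph of -\<open>P\<close> leave it fixed, and the symplectic matrix
  sends this graph to the pure modulations; inner products of shifted copies then become Fourier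
  integrals on the image side. The formula is one for the inverse operator because absolute
  convergence is available on that side: a square-integrable Wigner distribution of finite support
  is integrable, while f and g are merely square integrable. The rank of \<open>M\<close> is
  arbitrary. Its range is therefore represented by the projection \<open>E\<close> and a measure
  \<open>lam E\<close> on the whole space, and each Fourier theorem is carried over from the whole
  space by tensoring with a Gaussian in the complementary variables. In the counting argument N
  exceeds the measure of the support by more than 1, and the shift is so small that each translate
  adds at most 1/N; the union of the translates then has measure below N.\<close>

lemma integrable_mult_bounded:
  fixes f g :: "'a \<Rightarrow> complex"
  assumes f: "integrable M f" and g[measurable]: "g \<in> borel_measurable M"
    and b: "\<And>x. cmod (g x) \<le> C"
  shows "integrable M (\<lambda>x. f x * g x)"
proof (rule Bochner_Integration.integrable_bound)
  show "integrable M (\<lambda>x. C * norm (f x))" using f by auto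
  show "(\<lambda>x. f x * g x) \<in> borel_measurable M" using f by auto
  show "AE x in M. norm (f x * g x) \<le> norm (C * norm (f x))"
  proof (rule AE_I2)
    fix x
    have "0 \<le> C" using norm_ge_zero b order_trans by blast
    then show "norm (f x * g x) \<le> norm (C * norm (f x))"
      using mult_right_mono[OF b[of x] norm_ge_zero[of "f x"]]
      by (simp add: norm_mult mult.commute)
  qed
qed

lemma cnj_measurable[measurable]: "cnj \<in> borel_measurable borel"
  by (intro borel_measurable_continuous_onI continuous_intros)

definition expi :: "real \<Rightarrow> complex" where
  "expi r = cis (2 * pi * r)"

lemma expi_measurable[measurable]: "expi \<in> borel_measurable borel"
  unfolding expi_def by (intro borel_measurable_continuous_onI continuous_intros)

lemma norm_expi[simp]: "cmod (expi r) = 1"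
  by (simp add: expi_def)

lemma expi_nonzero[simp]: "expi r \<noteq> 0"
  by (simp add: expi_def)

lemma expi_0[simp]: "expi 0 = 1"
  by (simp add: expi_def)

lemma expi_add: "expi (a + b) = expi a * expi b"
  by (simp add: expi_def cis_mult distrib_left)

lemma expi_diff: "expi (a - b) = expi a * expi (- b)"
  using expi_add[of a "- b"] by simp

lemma cnj_expi: "cnj (expi r) = expi (- r)"
  by (simp add: expi_def cis_cnj)

lemma expi_minus_mult[simp]: "expi (- r) * expi r = 1" "expi r * expi (- r) = 1"
  by (simp_all flip: expi_add)

text \<open>With the character \<open>expi\<close> this normalisation is self-dual: the transform is
  the same Gaussian and the integral is 1, so no constants occur in the Fourier formulas.\<close>

definition gam :: "'a::euclidean_space \<Rightarrow> real" where
  "gam x = exp (- pi * (norm x)\<^sup>2)"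

lemma gam_measurable[measurable]: "gam \<in> borel_measurable borel"
  unfolding gam_def by measurable

lemma gam_pos[simp]: "0 < gam x" and gam_nonneg[simp]: "0 \<le> gam x" and gam_nonzero[simp]: "gam x \<noteq> 0"
  by (simp_all add: gam_def)

lemma gam_le_1[simp]: "gam x \<le> 1"
  by (simp add: gam_def)

lemma gam_0[simp]: "gam 0 = 1"
  by (simp add: gam_def)

lemma gam_minus[simp]: "gam (- x) = gam x"
  by (simp add: gam_def)

section \<open>Affine substitutions in Lebesgue measure\<close>

lemma lborel_distr_affine:
  fixes t :: "'a::euclidean_space"
  assumes "c \<noteq> 0"
  shows "distr lborel borel (\<lambda>x. t + c *\<^sub>R x) = density lborel (\<lambda>_. 1 / \<bar>c\<bar> ^ DIM('a))"
proof -
  have c: "ennreal (\<bar>c\<bar> ^ DIM('a)) * ennreal (1 / \<bar>c\<bar> ^ DIM('a)) = 1"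
    using assms by (simp flip: ennreal_mult)
  show ?thesis
    by (subst (2) lborel_affine[OF assms, of t])
       (simp add: density_density_eq c density_1)
qed

lemma nn_integral_lborel_affine:
  fixes t :: "'a::euclidean_space"
  assumes [measurable]: "f \<in> borel_measurable borel" and "c \<noteq> 0"
  shows "(\<integral>\<^sup>+x. f (t + c *\<^sub>R x) \<partial>lborel) = ennreal (1 / \<bar>c\<bar> ^ DIM('a)) * (\<integral>\<^sup>+x. f x \<partial>lborel)"
proof -
  have "(\<integral>\<^sup>+x. f (t + c *\<^sub>R x) \<partial>lborel) = (\<integral>\<^sup>+x. f x \<partial>distr lborel borel (\<lambda>x. t + c *\<^sub>R x))"
    by (subst nn_integral_distr) auto
  then show ?thesis
    by (simp add: lborel_distr_affine[OF \<open>c \<noteq> 0\<close>] nn_integral_density nn_integral_cmult)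
qed

lemma integral_lborel_affine:
  fixes t :: "'a::euclidean_space" and f :: "'a \<Rightarrow> 'b::{banach, second_countable_topology}"
  assumes [measurable]: "f \<in> borel_measurable borel" and c: "c \<noteq> 0"
  shows "(\<integral>x. f (t + c *\<^sub>R x) \<partial>lborel) = (1 / \<bar>c\<bar> ^ DIM('a)) *\<^sub>R (\<integral>x. f x \<partial>lborel)"
    and "integrable lborel (\<lambda>x. f (t + c *\<^sub>R x)) \<longleftrightarrow> integrable lborel f"
proof -
  have "(\<integral>x. f (t + c *\<^sub>R x) \<partial>lborel) = (\<integral>x. f x \<partial>distr lborel borel (\<lambda>x. t + c *\<^sub>R x))"
    by (subst integral_distr) auto
  then show "(\<integral>x. f (t + c *\<^sub>R x) \<partial>lborel) = (1 / \<bar>c\<bar> ^ DIM('a)) *\<^sub>R (\<integral>x. f x \<partial>lborel)"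
    by (simp add: lborel_distr_affine[OF c] integral_density)
  have "integrable lborel (\<lambda>x. f (t + c *\<^sub>R x)) \<longleftrightarrow> integrable (distr lborel borel (\<lambda>x. t + c *\<^sub>R x)) f"
    by (subst integrable_distr_eq) auto
  also have "\<dots> \<longleftrightarrow> integrable lborel (\<lambda>x. (1 / \<bar>c\<bar> ^ DIM('a)) *\<^sub>R f x)"
    by (simp add: lborel_distr_affine[OF c] integrable_density)
  also have "\<dots> \<longleftrightarrow> integrable lborel f"
    using c integrable_scaleR_right[of "\<bar>c\<bar> ^ DIM('a)" lborel "\<lambda>x. (1 / \<bar>c\<bar> ^ DIM('a)) *\<^sub>R f x"]
    by auto
  finally show "integrable lborel (\<lambda>x. f (t + c *\<^sub>R x)) \<longleftrightarrow> integrable lborel f" .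
qed

text \<open>The characteristic function of the standard normal law, rescaled.\<close>

lemma gauss_fourier_real:
  fixes s :: real
  shows "integrable lborel (gam :: real \<Rightarrow> real)"
    and "(\<integral>x. of_real (gam x) * expi (s * x) \<partial>lborel) = of_real (gam s)"
proof -
  \<comment> \<open>At this scale \<open>std_normal_density (c * x)\<close> is
    \<open>gam x / c\<close>, since (c x)^2 / 2 = \<pi> x^2; the frequency \<open>c * s\<close>
    turns the characteristic function into \<open>gam s\<close> for the same reason.\<close>
  define c where "c = sqrt (2 * pi)"
  have c: "c > 0" "c\<^sup>2 = 2 * pi" by (auto simp: c_def)
  have eq: "std_normal_density (0 + c * x) = gam x / c" for x
    using c by (simp add: std_normal_density_def gam_def power_mult_distrib c_def)
  have "integrable lborel (\<lambda>x. std_normal_density (0 + c * x))"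
    using c by (intro lborel_integrable_real_affine) auto
  then have "integrable lborel (\<lambda>x::real. c * (gam x / c))"
    unfolding eq by (intro integrable_mult_right) auto
  then show 1: "integrable lborel (gam :: real \<Rightarrow> real)"
    using c by simp
  have "of_real (gam s) = complex_of_real (exp (- ((c * s)\<^sup>2) / 2))"
    using c by (simp add: gam_def power_mult_distrib)
  also have "\<dots> = char std_normal_distribution (c * s)"
    by (simp add: char_std_normal_distribution)
  also have "\<dots> = (\<integral>x. std_normal_density x *\<^sub>R iexp ((c * s) * x) \<partial>lborel)"
    unfolding char_def by (subst integral_density) auto
  also have "\<dots> = \<bar>c\<bar> *\<^sub>R (\<integral>x. std_normal_density (0 + c * x) *\<^sub>R iexp ((c * s) * (0 + c * x)) \<partial>lborel)"
    using c by (intro lborel_integral_real_affine) auto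
  also have "\<dots> = (\<integral>x. \<bar>c\<bar> *\<^sub>R (std_normal_density (0 + c * x) *\<^sub>R iexp ((c * s) * (0 + c * x))) \<partial>lborel)"
    by (rule integral_scaleR_right[symmetric])
  also have "\<dots> = (\<integral>x. of_real (gam x) * expi (s * x) \<partial>lborel)"
  proof (rule Bochner_Integration.integral_cong[OF refl])
    fix x
    have "(c * s) * (c * x) = 2 * pi * (s * x)"
      using c(2) by (simp add: power2_eq_square algebra_simps)
    then have "iexp ((c * s) * (0 + c * x)) = expi (s * x)"
      unfolding expi_def cis_conv_exp by (simp only: add_0)
    then show "\<bar>c\<bar> *\<^sub>R (std_normal_density (0 + c * x) *\<^sub>R iexp ((c * s) * (0 + c * x)))
       = of_real (gam x) * expi (s * x)"
      using c unfolding eq by (simp add: scaleR_conv_of_real)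
  qed
  finally show "(\<integral>x. of_real (gam x) * expi (s * x) \<partial>lborel) = of_real (gam s)" by simp
qed

lemma gam_prod: "gam (x::'a::euclidean_space) = (\<Prod>b\<in>Basis. gam (x \<bullet> b))"
proof -
  have "(norm x)\<^sup>2 = (\<Sum>b\<in>Basis. (x \<bullet> b)\<^sup>2)"
    by (subst norm_eq_sqrt_inner, subst euclidean_inner) (simp add: sum_nonneg power2_eq_square)
  then show ?thesis
    by (simp add: gam_def exp_sum[symmetric] sum_distrib_left sum_negf)
qed

lemma expi_sum: "finite A \<Longrightarrow> expi (\<Sum>b\<in>A. f b) = (\<Prod>b\<in>A. expi (f b))"
  by (induction A rule: finite_induct) (auto simp: expi_add)

text \<open>Lebesgue measure is the image of the product of its one-dimensional copies, and the
  integrand factorises over \<open>Basis\<close>. Integrability is the case s = 0 of the same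
  factorisation.\<close>

lemma gauss_fourier:
  fixes s :: "'a::euclidean_space"
  shows "(\<integral>x. of_real (gam x) * expi (s \<bullet> x) \<partial>lborel) = of_real (gam s)"
    and "integrable lborel (gam :: 'a \<Rightarrow> real)"
proof -
  interpret product_sigma_finite "\<lambda>_::'a. lborel :: real measure" ..
  let ?h = "\<lambda>f::'a \<Rightarrow> real. \<Sum>b\<in>Basis. f b *\<^sub>R b"
  let ?F = "\<lambda>s x. complex_of_real (gam x) * expi (s \<bullet> x)"
  have i: "integrable lborel (\<lambda>x. ?F (s \<bullet> b) x)" for s b :: 'a
    by (rule integrable_mult_bounded[where C=1]) (auto simp: gauss_fourier_real)
  have F: "?F s (?h f) = (\<Prod>b\<in>Basis. ?F (s \<bullet> b) (f b))" for f and s :: 'a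
  proof -
    have "(\<Sum>b'\<in>Basis. f b' *\<^sub>R b') \<bullet> b = f b" if "b \<in> Basis" for b
      using that by (simp add: inner_sum_left inner_Basis if_distrib cong: if_cong)
    then show ?thesis
      using euclidean_inner[of s "?h f"] by (simp add: gam_prod[of "?h f"] prod.distrib expi_sum cong: prod.cong)
  qed
  have [measurable]: "?h \<in> measurable (Pi\<^sub>M Basis (\<lambda>_. lborel)) borel" by simp
  have "(\<integral>x. ?F s x \<partial>lborel) = (\<integral>f. ?F s (?h f) \<partial>(\<Pi>\<^sub>M b\<in>Basis. lborel))" for s :: 'a
    by (subst lborel_eq, subst integral_distr) auto
  also have "\<And>s::'a. (\<integral>f. ?F s (?h f) \<partial>(\<Pi>\<^sub>M b\<in>Basis. lborel)) = (\<Prod>b\<in>Basis. (\<integral>x. ?F (s \<bullet> b) x \<partial>lborel))"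
    unfolding F by (rule product_integral_prod) (use i in auto)
  also have "\<And>s::'a. \<dots> s = of_real (gam s)"
    by (simp add: gauss_fourier_real flip: of_real_prod gam_prod)
  finally show "(\<integral>x. ?F s x \<partial>lborel) = of_real (gam s)" .
  have "integrable (\<Pi>\<^sub>M b\<in>Basis. lborel) (\<lambda>f. ?F 0 (?h f))"
    unfolding F by (rule product_integrable_prod) (use i[of 0 0] in auto)
  then have "integrable (distr (\<Pi>\<^sub>M b\<in>Basis. lborel) borel ?h) (\<lambda>x. complex_of_real (gam x))"
    by (subst integrable_distr_eq) auto
  then show "integrable lborel (gam :: 'a \<Rightarrow> real)"
    by (subst lborel_eq) (simp only: complex_of_real_integrable_eq)
qed

text \<open>The transform of the Gaussian damping factor of width \<open>r\<close> is a kernel of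
  mass one that concentrates at the origin as \<open>r\<close> grows: the summability kernel of the
  inversion theorem.\<close>

lemma gauss_fourier_scaled:
  fixes y :: "'a::euclidean_space"
  assumes "r > 0"
  shows "(\<integral>s. of_real (gam (s /\<^sub>R r)) * expi (s \<bullet> y) \<partial>lborel) = of_real (r ^ DIM('a) * gam (r *\<^sub>R y))"
    and "integrable lborel (\<lambda>s::'a. gam (s /\<^sub>R r))" 
    and "(\<integral>x. r ^ DIM('a) * gam (r *\<^sub>R (x - y)) \<partial>lborel) = 1"
    and "integrable lborel (\<lambda>x. r ^ DIM('a) * gam (r *\<^sub>R (x - y)))"
proof -
  have 1: "(\<integral>s. complex_of_real (gam (0 + (1/r) *\<^sub>R s)) * expi ((r *\<^sub>R y) \<bullet> (0 + (1/r) *\<^sub>R s)) \<partial>lborel)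
       = (1 / \<bar>1/r\<bar> ^ DIM('a)) *\<^sub>R (\<integral>s. complex_of_real (gam s) * expi ((r *\<^sub>R y) \<bullet> s) \<partial>lborel)"
    using assms by (intro integral_lborel_affine) auto
  show "(\<integral>s. of_real (gam (s /\<^sub>R r)) * expi (s \<bullet> y) \<partial>lborel) = of_real (r ^ DIM('a) * gam (r *\<^sub>R y))"
    using 1 gauss_fourier(1)[where s="r *\<^sub>R y"] assms by (simp add: inverse_eq_divide power_one_over inner_commute scaleR_conv_of_real)
  have "integrable lborel (\<lambda>s::'a. gam (0 + (1/r) *\<^sub>R s))"
    using assms by (subst integral_lborel_affine) (auto simp: gauss_fourier)
  then show "integrable lborel (\<lambda>s::'a. gam (s /\<^sub>R r))" by (simp add: inverse_eq_divide)
  have eq: "r *\<^sub>R (x - y) = (- (r *\<^sub>R y)) + r *\<^sub>R x" for x by (simp add: algebra_simps)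
  have "complex_of_real (\<integral>x. gam (x::'a) \<partial>lborel) = 1"
    by (subst integral_complex_of_real[symmetric]) (use gauss_fourier(1)[where s="0::'a"] in simp)
  then have one: "(\<integral>x. gam (x::'a) \<partial>lborel) = 1"
    by (simp only: of_real_eq_1_iff)
  show "(\<integral>x. r ^ DIM('a) * gam (r *\<^sub>R (x - y)) \<partial>lborel) = 1"
    unfolding eq using assms one integral_lborel_affine(1)[of gam r "- (r *\<^sub>R y)"] by simp
  show "integrable lborel (\<lambda>x. r ^ DIM('a) * gam (r *\<^sub>R (x - y)))"
    unfolding eq using assms gauss_fourier(2)
      by (intro integrable_mult_right) (subst integral_lborel_affine(2), auto)
qed

section \<open>Fourier inversion and Bessel's inequality\<close>

lemma norm_fourier_le:
  fixes h :: "'a::euclidean_space \<Rightarrow> complex"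
  assumes "integrable M h"
  shows "cmod (\<integral>x. h x * expi (l x) \<partial>M) \<le> (\<integral>x. cmod (h x) \<partial>M)"
  using integral_norm_bound[of M "\<lambda>x. h x * expi (l x)"] by (simp add: norm_mult)

lemma norm_integral_le_nn_integral:
  fixes f :: "'a \<Rightarrow> complex"
  shows "ennreal (cmod (\<integral>x. f x \<partial>M)) \<le> (\<integral>\<^sup>+x. ennreal (cmod (f x)) \<partial>M)"
  by (cases "integrable M f") (auto intro: integral_norm_bound_ennreal simp: not_integrable_integral_eq)

text \<open>The Gaussian factor makes the double integral absolutely convergent; exchanging the
  integrals leaves the transform of the Gaussian, hence a convolution of \<open>h\<close> with the
  kernel of mass one.\<close>

lemma fourier_gauss_weighted:
  fixes h :: "'a::euclidean_space \<Rightarrow> complex"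
  assumes h: "integrable lborel h" and r: "r > 0"
  shows "(\<integral>s. (\<integral>x. h x * expi (s \<bullet> x) \<partial>lborel) * expi (- (s \<bullet> y)) * of_real (gam (s /\<^sub>R r)) \<partial>lborel)
    = (\<integral>x. h x * of_real (r ^ DIM('a) * gam (r *\<^sub>R (x - y))) \<partial>lborel)" (is "?L = ?R")
proof -
  have [measurable]: "h \<in> borel_measurable borel" using h by auto
  let ?f = "\<lambda>s x. complex_of_real (gam (s /\<^sub>R r)) * h x * (expi (s \<bullet> x) * expi (- (s \<bullet> y)))"
  have "integrable (lborel \<Otimes>\<^sub>M lborel) (\<lambda>p::'a\<times>'a. complex_of_real (gam (fst p /\<^sub>R r)) * h (snd p))"
  proof (rule lborel_pair.Fubini_integrable)
    show "integrable lborel (\<lambda>s::'a. \<integral>x. cmod (complex_of_real (gam (fst (s, x) /\<^sub>R r)) * h (snd (s, x))) \<partial>lborel)"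
      using gauss_fourier_scaled(2)[OF r, where ?'a='a] h by (simp add: norm_mult)
    show "AE s::'a in lborel. integrable lborel (\<lambda>x. complex_of_real (gam (fst (s, x) /\<^sub>R r)) * h (snd (s, x)))"
      using h by simp
  qed measurable
  then have i: "integrable (lborel \<Otimes>\<^sub>M lborel) (\<lambda>(s, x). ?f s x)"
    unfolding split_beta by (rule integrable_mult_bounded[where C=1]) (auto simp: norm_mult)
  have "?L = (\<integral>s. (\<integral>x. ?f s x \<partial>lborel) \<partial>lborel)"
    by (simp add: mult_ac flip: integral_mult_right_zero)
  also have "\<dots> = (\<integral>x. (\<integral>s. ?f s x \<partial>lborel) \<partial>lborel)"
    by (rule lborel_pair.Fubini_integral[OF i, symmetric])
  also have "\<dots> = (\<integral>x. h x * (\<integral>s. of_real (gam (s /\<^sub>R r)) * expi (s \<bullet> (x - y)) \<partial>lborel) \<partial>lborel)"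
    by (simp add: mult_ac inner_diff_right expi_diff flip: integral_mult_right_zero)
  also have "\<dots> = ?R"
    by (simp add: gauss_fourier_scaled(1)[OF r])
  finally show ?thesis .
qed

text \<open>Fubini moves the smoothing from \<open>h\<close>, which is only integrable, to the
  indicator of the box. The smoothed indicator is bounded by 1 and converges off the boundary of the
  box, a null set, so dominated convergence with majorant |h| applies.\<close>

lemma gauss_approx_indicator_box:
  fixes h :: "'a::euclidean_space \<Rightarrow> complex" and l u :: 'a
  assumes h: "integrable lborel h"
  defines "r \<equiv> \<lambda>m::nat. real (Suc m)"
  shows "(\<lambda>m. \<integral>y. indicator (box l u) y *\<^sub>R
            (\<integral>x. h x * of_real (r m ^ DIM('a) * gam (r m *\<^sub>R (x - y))) \<partial>lborel) \<partial>lborel)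
         \<longlonglongrightarrow> (\<integral>x. indicator (box l u) x *\<^sub>R h x \<partial>lborel)"
proof -
  have [measurable]: "h \<in> borel_measurable borel" using h by auto
  have r: "r m > 0" for m by (simp add: r_def)
  let ?B = "box l u"
  \<comment> \<open>The smoothed indicator in the variable z = r (x - y): in this form the Gaussian
    does not depend on \<open>m\<close> and can serve as a majorant.\<close>
  define w where "w = (\<lambda>m x. \<integral>z. indicator ?B (x - z /\<^sub>R r m) * gam z \<partial>lborel)"
  have gi: "integrable lborel (\<lambda>z. gam (z::'a))" by (rule gauss_fourier(2))
  have g1: "(\<integral>z. gam (z::'a) \<partial>lborel) = 1"
    using gauss_fourier_scaled(3)[of 1 "0::'a"] by simp
  have ig: "integrable lborel (\<lambda>z. indicator ?B (x - z /\<^sub>R r m) * gam z)" for x m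
    by (rule Bochner_Integration.integrable_bound[OF gi]) (auto simp: indicator_def)
  have w_eq: "w m x = (\<integral>y. indicator ?B y * (r m ^ DIM('a) * gam (r m *\<^sub>R (x - y))) \<partial>lborel)" for m x
  proof -
    \<comment> \<open>The substitution z to r x - r z, whose Jacobian r^d is the normalising factor
      of the kernel.\<close>
    have "(\<integral>z. indicator ?B (x - (r m *\<^sub>R x + (- r m) *\<^sub>R z) /\<^sub>R r m) * gam (r m *\<^sub>R x + (- r m) *\<^sub>R z) \<partial>lborel)
       = (1 / \<bar>- r m\<bar> ^ DIM('a)) *\<^sub>R w m x"
      unfolding w_def using r[of m] by (intro integral_lborel_affine(1)) auto
    moreover have "x - (r m *\<^sub>R x + (- r m) *\<^sub>R z) /\<^sub>R r m = z" for z
      using r[of m] by (simp add: algebra_simps)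
    moreover have "r m *\<^sub>R x + (- r m) *\<^sub>R z = r m *\<^sub>R (x - z)" for z
      by (simp add: algebra_simps)
    ultimately have "(\<integral>z. indicator ?B z * gam (r m *\<^sub>R (x - z)) \<partial>lborel) = (1 / r m ^ DIM('a)) * w m x"
      using r[of m] by simp
    then have "w m x = r m ^ DIM('a) * (\<integral>z. indicator ?B z * gam (r m *\<^sub>R (x - z)) \<partial>lborel)"
      using r[of m] by simp
    then show ?thesis
      by (simp only: mult.left_commute flip: integral_mult_right_zero)
  qed
  have w_bd: "\<bar>w m x\<bar> \<le> 1" for m x
  proof -
    have "\<bar>w m x\<bar> \<le> (\<integral>z. \<bar>indicator ?B (x - z /\<^sub>R r m) * gam z\<bar> \<partial>lborel)"
      unfolding w_def by (rule integral_abs_bound)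
    also have "\<dots> \<le> (\<integral>z. gam (z::'a) \<partial>lborel)"
      using ig gi by (intro integral_mono integrable_abs) (auto simp: indicator_def)
    finally show ?thesis using g1 by simp
  qed
  have lim: "(\<lambda>m. w m x) \<longlonglongrightarrow> indicator ?B x" if x: "x \<in> ?B \<or> x \<notin> cbox l u" for x
  proof -
    have "(\<lambda>m. \<integral>z. indicator ?B (x - z /\<^sub>R r m) * gam z \<partial>lborel) \<longlonglongrightarrow> (\<integral>z. indicator ?B x * gam (z::'a) \<partial>lborel)"
    proof (rule integral_dominated_convergence[where w=gam])
      show "AE z in lborel. (\<lambda>m. indicator ?B (x - z /\<^sub>R r m) * gam z) \<longlonglongrightarrow> indicator ?B x * gam z"
      proof (rule AE_I2)
        fix z :: 'a
        have "(\<lambda>m. inverse (real (Suc m))) \<longlonglongrightarrow> 0" by (rule LIMSEQ_inverse_real_of_nat)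
        then have "(\<lambda>m. x - inverse (real (Suc m)) *\<^sub>R z) \<longlonglongrightarrow> x - 0 *\<^sub>R z"
          by (intro tendsto_intros)
        then have l: "(\<lambda>m. x - z /\<^sub>R r m) \<longlonglongrightarrow> x" by (simp add: r_def)
        \<comment> \<open>Off the boundary the indicator is constant near \<open>x\<close>, so the
          sequence is eventually constant.\<close>
        have "\<forall>\<^sub>F m in sequentially. indicator ?B (x - z /\<^sub>R r m) * gam z = indicator ?B x * gam z"
        proof (cases "x \<in> ?B")
          case True
          from topological_tendstoD[OF l open_box True] show ?thesis
            by eventually_elim (use True in auto)
        next
          case False
          then have "x \<in> - cbox l u" using x by auto
          from topological_tendstoD[OF l _ this] have "\<forall>\<^sub>F m in sequentially. x - z /\<^sub>R r m \<in> - cbox l u"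
            by (auto simp: closed_cbox open_Compl)
          then show ?thesis
            by eventually_elim (use False box_subset_cbox[of l u] in \<open>auto simp: indicator_def\<close>)
        qed
        then show "(\<lambda>m. indicator ?B (x - z /\<^sub>R r m) * gam z) \<longlonglongrightarrow> indicator ?B x * gam z"
          by (rule tendsto_eventually)
      qed
    qed (auto simp: gi indicator_def)
    then show ?thesis by (simp add: w_def g1)
  qed
  have ae: "AE x in lborel. x \<in> ?B \<or> x \<notin> cbox l u"
  proof -
    have "negligible (cbox l u - box l u)" by (rule negligible_frontier_interval)
    then have "cbox l u - box l u \<in> null_sets lebesgue" by (simp add: negligible_iff_null_sets)
    then have "cbox l u - box l u \<in> null_sets lborel" by (auto simp: null_sets_completion_iff)
    from AE_not_in[OF this] show ?thesis by auto
  qed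
  have main: "(\<lambda>m. \<integral>x. h x * of_real (w m x) \<partial>lborel) \<longlonglongrightarrow> (\<integral>x. h x * of_real (indicator ?B x) \<partial>lborel)"
  proof (rule integral_dominated_convergence[where w="\<lambda>x. cmod (h x)"])
    show "AE x in lborel. (\<lambda>m. h x * of_real (w m x)) \<longlonglongrightarrow> h x * of_real (indicator ?B x)"
      using ae by eventually_elim (intro tendsto_intros lim)
    show "AE x in lborel. cmod (h x * of_real (w m x)) \<le> cmod (h x)" for m
      using w_bd by (auto simp: norm_mult mult_left_le)
    show "(\<lambda>x. h x * of_real (w m x)) \<in> borel_measurable lborel" for m
      unfolding w_def by measurable
  qed (use h in auto)
  have eq: "(\<integral>y. indicator ?B y *\<^sub>R (\<integral>x. h x * of_real (r m ^ DIM('a) * gam (r m *\<^sub>R (x - y))) \<partial>lborel) \<partial>lborel)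
      = (\<integral>x. h x * of_real (w m x) \<partial>lborel)" for m
  proof -
    let ?f = "\<lambda>y x. h x * of_real (indicator ?B y * (r m ^ DIM('a) * gam (r m *\<^sub>R (x - y))))"
    have i: "integrable (lborel \<Otimes>\<^sub>M lborel) (\<lambda>(y, x). ?f y x)"
    proof (rule lborel_pair.Fubini_integrable)
      have "integrable (lborel \<Otimes>\<^sub>M lborel) (\<lambda>p::'a\<times>'a. (indicator ?B (fst p) :: real) * norm (h (snd p)))"
      proof (rule lborel_pair.Fubini_integrable)
        have "integrable lborel (\<lambda>x. indicator ?B x :: real)"
          by (auto intro!: integrable_real_indicator emeasure_bounded_finite)
        then show "integrable lborel (\<lambda>x::'a. \<integral>y. norm ((indicator ?B (fst (x, y)) :: real) * norm (h (snd (x, y)))) \<partial>lborel)"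
          by (simp add: norm_mult abs_mult)
      qed (use h in auto)
      then have "integrable (lborel \<Otimes>\<^sub>M lborel) (\<lambda>p::'a\<times>'a. r m ^ DIM('a) * ((indicator ?B (fst p) :: real) * norm (h (snd p))))"
        by auto
      then have "integrable (lborel \<Otimes>\<^sub>M lborel) (\<lambda>(y, x). ?f y x)"
      proof (rule Bochner_Integration.integrable_bound)
        show "AE p in lborel \<Otimes>\<^sub>M lborel. norm (case p of (y, x) \<Rightarrow> ?f y x)
          \<le> norm (r m ^ DIM('a) * ((indicator ?B (fst p) :: real) * norm (h (snd p))))"
        proof (rule AE_I2)
          fix p :: "'a \<times> 'a"
          show "norm (case p of (y, x) \<Rightarrow> ?f y x)
            \<le> norm (r m ^ DIM('a) * ((indicator ?B (fst p) :: real) * norm (h (snd p))))"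
            using r[of m] mult_left_mono[OF gam_le_1[of "r m *\<^sub>R (snd p - fst p)"], of "cmod (h (snd p)) * r m ^ DIM('a)"]
            by (cases p) (auto simp: norm_mult abs_mult indicator_def norm_power mult_ac)
        qed
      qed measurable
      from lborel_pair.integrable_fst'[OF integrable_norm[OF this]]
           lborel_pair.AE_integrable_fst'[OF this]
      show "integrable lborel (\<lambda>y. \<integral>x. norm (case (y, x) of (y, x) \<Rightarrow> ?f y x) \<partial>lborel)"
        "AE y in lborel. integrable lborel (\<lambda>x. case (y, x) of (y, x) \<Rightarrow> ?f y x)" by auto
    qed measurable
    have "(\<integral>y. indicator ?B y *\<^sub>R (\<integral>x. h x * of_real (r m ^ DIM('a) * gam (r m *\<^sub>R (x - y))) \<partial>lborel) \<partial>lborel)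
      = (\<integral>y. (\<integral>x. ?f y x \<partial>lborel) \<partial>lborel)"
      by (intro Bochner_Integration.integral_cong refl) (auto simp: indicator_def)
    also have "\<dots> = (\<integral>x. (\<integral>y. ?f y x \<partial>lborel) \<partial>lborel)"
      by (rule lborel_pair.Fubini_integral[OF i, symmetric])
    also have "\<dots> = (\<integral>x. h x * of_real (w m x) \<partial>lborel)"
      unfolding w_eq integral_mult_right_zero integral_complex_of_real ..
    finally show ?thesis .
  qed
  show ?thesis unfolding eq using main by (simp add: mult.commute scaleR_conv_of_real)
qed

text \<open>Open boxes form an intersection-stable generator of the Borel sets, so the vanishing
  spreads to all Borel sets by Dynkin's induction. The function is only locally integrable (it will
  be the difference of an integrable and a bounded one), which is why the induction runs inside each
  of the fixed boxes \<open>?A n\<close>.\<close>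

lemma AE_eq_0_if_box_integrals_0:
  fixes h :: "'a::euclidean_space \<Rightarrow> complex"
  assumes [measurable]: "h \<in> borel_measurable borel"
    and i: "\<And>l u. set_integrable lborel (box l u) h"
    and z: "\<And>l u. (\<integral>x. indicator (box l u) x *\<^sub>R h x \<partial>lborel) = 0"
  shows "AE x in lborel. h x = 0"
proof -
  let ?A = "\<lambda>n::nat. box (- (real n *\<^sub>R One)) (real n *\<^sub>R One) :: 'a set"
  have "AE x in lborel. indicator (?A n) x *\<^sub>R h x = 0" for n
  proof (rule sigma_finite_measure.density_unique_banach[OF sigma_finite_lborel])
    let ?g = "\<lambda>x. indicator (?A n) x *\<^sub>R h x"
    show gi: "integrable lborel ?g"
      using i[of "- (real n *\<^sub>R One)" "real n *\<^sub>R One"] by (simp add: set_integrable_def)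
    fix A :: "'a set" assume "A \<in> sets lborel"
    then have "A \<in> sigma_sets UNIV (range (\<lambda>(a, b). box a b))" by (simp add: borel_eq_box)
    then have "(\<integral>x. indicator A x *\<^sub>R ?g x \<partial>lborel) = 0"
    proof (rule sigma_sets_induct_disjoint[rotated 2])
      show "Int_stable (range (\<lambda>(a, b). box a b::'a set))" by (auto simp: Int_stable_def box_Int_box)
      fix A :: "'a set" assume "A \<in> range (\<lambda>(a, b). box a b)"
      then obtain a b where A: "A = box a b" by auto
      have "indicator A x *\<^sub>R ?g x = indicator (A \<inter> ?A n) x *\<^sub>R h x" for x
        by (auto simp: indicator_def)
      then show "(\<integral>x. indicator A x *\<^sub>R ?g x \<partial>lborel) = 0"
        using z unfolding A by (simp only: box_Int_box)
    next
      fix A :: "'a set" assume "A \<in> sigma_sets UNIV (range (\<lambda>(a, b). box a b))"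
        and A0: "(\<integral>x. indicator A x *\<^sub>R ?g x \<partial>lborel) = 0"
      then have [measurable]: "A \<in> sets borel" by (simp add: borel_eq_box)
      have "indicator (UNIV - A) x *\<^sub>R ?g x = ?g x - indicator A x *\<^sub>R ?g x" for x
        by (auto simp: indicator_def)
      moreover have "integrable lborel (\<lambda>x. indicator A x *\<^sub>R ?g x)"
        by (rule integrable_mult_indicator[OF _ gi]) auto
      ultimately show "(\<integral>x. indicator (UNIV - A) x *\<^sub>R ?g x \<partial>lborel) = 0"
        using gi A0 z by simp
    next
      fix A :: "nat \<Rightarrow> 'a set"
      assume d: "disjoint_family A" and "range A \<subseteq> sigma_sets UNIV (range (\<lambda>(a, b). box a b))"
        and A0: "\<And>i. (\<integral>x. indicator (A i) x *\<^sub>R ?g x \<partial>lborel) = 0"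
      then have [measurable]: "A i \<in> sets borel" for i by (auto simp: borel_eq_box)
      have "set_integrable lborel (\<Union>i. A i) ?g"
        unfolding set_integrable_def by (rule integrable_mult_indicator[OF _ gi]) auto
      from lebesgue_integral_countable_add[OF _ _ this] d
      show "(\<integral>x. indicator (\<Union>i. A i) x *\<^sub>R ?g x \<partial>lborel) = 0"
        using A0 by (auto simp: set_lebesgue_integral_def disjoint_family_on_def)
    qed auto
    then show "set_lebesgue_integral lborel A ?g = set_lebesgue_integral lborel A (\<lambda>x. 0)"
      by (simp add: set_lebesgue_integral_def)
  qed auto
  then have "AE x in lborel. \<forall>n. indicator (?A n) x *\<^sub>R h x = 0"
    by (simp only: AE_all_countable) blast
  then show ?thesis
  proof eventually_elim
    case (elim x)
    have "x \<in> (\<Union>n. ?A n)" using UN_box_eq_UNIV by auto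
    then obtain n where "x \<in> ?A n" by auto
    then show ?case using elim[rule_format, of n] by simp
  qed
qed

text \<open>The damped inversion integrals \<open>q m\<close> link the two sides: they converge
  pointwise to \<open>k\<close>, and their box integrals converge to those of \<open>h\<close>
  because they are convolutions with the summability kernel. Equal box integrals force equality
  almost everywhere.\<close>

theorem fourier_inversion:
  fixes h :: "'a::euclidean_space \<Rightarrow> complex"
  assumes h: "integrable lborel h"
    and hh: "integrable lborel (\<lambda>s. \<integral>x. h x * expi (s \<bullet> x) \<partial>lborel)"
  shows "AE y in lborel. h y = (\<integral>s. (\<integral>x. h x * expi (s \<bullet> x) \<partial>lborel) * expi (- (s \<bullet> y)) \<partial>lborel)"
proof -
  have [measurable]: "h \<in> borel_measurable borel" using h by auto
  define H where "H = (\<lambda>s. \<integral>x. h x * expi (s \<bullet> x) \<partial>lborel)"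
  have Hi: "integrable lborel H" using hh by (simp add: H_def)
  then have [measurable]: "H \<in> borel_measurable borel" by auto
  define k where "k = (\<lambda>y. \<integral>s. H s * expi (- (s \<bullet> y)) \<partial>lborel)"
  have [measurable]: "k \<in> borel_measurable borel" unfolding k_def by measurable
  define q where "q = (\<lambda>m y. \<integral>s. H s * expi (- (s \<bullet> y)) * of_real (gam (s /\<^sub>R real (Suc m))) \<partial>lborel)"
  have [measurable]: "q m \<in> borel_measurable borel" for m unfolding q_def by measurable
  have ib: "integrable lborel (\<lambda>y. indicator (box l u) y :: real)" for l u :: 'a
    by (auto intro!: integrable_real_indicator emeasure_bounded_finite)
  define C where "C = (\<integral>s. cmod (H s) \<partial>lborel)"
  have kC: "cmod (k y) \<le> C" for y
    unfolding k_def C_def by (rule norm_fourier_le[OF Hi])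
  have qC: "cmod (q m y) \<le> C" for m y
  proof -
    have "cmod (q m y) \<le> (\<integral>s. cmod (H s * expi (- (s \<bullet> y)) * of_real (gam (s /\<^sub>R real (Suc m)))) \<partial>lborel)"
      unfolding q_def by (rule integral_norm_bound)
    also have "\<dots> \<le> C"
      unfolding C_def 
      by (rule integral_mono_AE') (use Hi in \<open>auto simp: norm_mult mult_left_le\<close>)
    finally show ?thesis .
  qed
  have qk: "(\<lambda>m. q m y) \<longlonglongrightarrow> k y" for y
    unfolding q_def k_def
  proof (rule integral_dominated_convergence[where w="\<lambda>s. cmod (H s)"])
    show "AE s in lborel. (\<lambda>m. H s * expi (- (s \<bullet> y)) * of_real (gam (s /\<^sub>R real (Suc m)))) \<longlonglongrightarrow> H s * expi (- (s \<bullet> y))"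
    proof (rule AE_I2)
      fix s :: 'a
      have "(\<lambda>m. inverse (real (Suc m))) \<longlonglongrightarrow> 0" by (rule LIMSEQ_inverse_real_of_nat)
      then have "(\<lambda>m. H s * expi (- (s \<bullet> y)) * of_real (exp (- pi * (norm (inverse (real (Suc m)) *\<^sub>R s))\<^sup>2)))
         \<longlonglongrightarrow> H s * expi (- (s \<bullet> y)) * of_real (exp (- pi * (norm (0 *\<^sub>R s))\<^sup>2))"
        by (intro tendsto_intros)
      then show "(\<lambda>m. H s * expi (- (s \<bullet> y)) * of_real (gam (s /\<^sub>R real (Suc m)))) \<longlonglongrightarrow> H s * expi (- (s \<bullet> y))"
        unfolding gam_def by simp
    qed
  qed (use Hi in \<open>auto simp: norm_mult mult_left_le\<close>)
  have z: "(\<integral>y. indicator (box l u) y *\<^sub>R (h y - k y) \<partial>lborel) = 0" for l u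
  proof -
    have "(\<lambda>m. \<integral>y. indicator (box l u) y *\<^sub>R q m y \<partial>lborel) \<longlonglongrightarrow> (\<integral>y. indicator (box l u) y *\<^sub>R k y \<partial>lborel)"
    proof (rule integral_dominated_convergence[where w="\<lambda>y. C * indicator (box l u) y"])
      show "AE y in lborel. (\<lambda>m. indicator (box l u) y *\<^sub>R q m y) \<longlonglongrightarrow> indicator (box l u) y *\<^sub>R k y"
        by (intro AE_I2 tendsto_intros qk)
      show "AE y in lborel. cmod (indicator (box l u) y *\<^sub>R q m y) \<le> C * indicator (box l u) y" for m
        using qC by (auto simp: indicator_def)
    qed (use ib in auto)
    moreover have "q m y = (\<integral>x. h x * of_real (real (Suc m) ^ DIM('a) * gam (real (Suc m) *\<^sub>R (x - y))) \<partial>lborel)" for m y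
      unfolding q_def H_def by (rule fourier_gauss_weighted[OF h]) simp
    ultimately have "(\<integral>y. indicator (box l u) y *\<^sub>R k y \<partial>lborel) = (\<integral>y. indicator (box l u) y *\<^sub>R h y \<partial>lborel)"
      using gauss_approx_indicator_box[OF h, of l u] by (simp only: LIMSEQ_unique)
    moreover have "integrable lborel (\<lambda>y. indicator (box l u) y *\<^sub>R h y)"
      using h by (intro integrable_mult_indicator) auto
    moreover have "integrable lborel (\<lambda>y. indicator (box l u) y *\<^sub>R k y)"
      by (rule Bochner_Integration.integrable_bound[OF integrable_mult_right[OF ib[of l u], of C]])
         (use kC norm_ge_zero order_trans in \<open>auto simp: indicator_def intro: order_trans[OF _ abs_ge_self]\<close>)
    ultimately show ?thesis by (simp add: scaleR_diff_right)
  qed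
  have "AE y in lborel. h y - k y = 0"
  proof (rule AE_eq_0_if_box_integrals_0[OF _ _ z])
    fix l u :: 'a
    have 1: "integrable lborel (\<lambda>y. indicator (box l u) y *\<^sub>R h y)"
      using h by (intro integrable_mult_indicator) auto
    have 2: "integrable lborel (\<lambda>y. indicator (box l u) y *\<^sub>R k y)"
      by (rule Bochner_Integration.integrable_bound[OF integrable_mult_right[OF ib[of l u], of C]])
         (use kC norm_ge_zero order_trans in \<open>auto simp: indicator_def intro: order_trans[OF _ abs_ge_self]\<close>)
    show "set_integrable lborel (box l u) (\<lambda>y. h y - k y)"
      using Bochner_Integration.integrable_diff[OF 1 2] by (simp add: set_integrable_def scaleR_diff_right)
  qed measurable
  then show ?thesis unfolding k_def H_def by auto
qed

text \<open>One half of Plancherel's theorem.\<close>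

theorem fourier_bessel:
  fixes h :: "'a::euclidean_space \<Rightarrow> complex"
  assumes h: "integrable lborel h"
  shows "(\<integral>\<^sup>+s. ennreal ((cmod (\<integral>x. h x * expi (s \<bullet> x) \<partial>lborel))\<^sup>2) \<partial>lborel) \<le> (\<integral>\<^sup>+x. ennreal ((cmod (h x))\<^sup>2) \<partial>lborel)"
proof (cases "integrable lborel (\<lambda>x. (cmod (h x))\<^sup>2)")
  case False
  have "h \<in> borel_measurable borel" using h by auto
  with False have "(\<integral>\<^sup>+x. ennreal ((cmod (h x))\<^sup>2) \<partial>lborel) = \<infinity>"
    by (auto simp: integrable_iff_bounded simp flip: top.not_eq_extremum)
  then show ?thesis by simp
next
  case h2: True
  have [measurable]: "h \<in> borel_measurable borel" using h by auto
  define H where "H = (\<lambda>s. \<integral>x. h x * expi (s \<bullet> x) \<partial>lborel)"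
  have [measurable]: "H \<in> borel_measurable borel" unfolding H_def by measurable
  define C where "C = (\<integral>s. cmod (h s) \<partial>lborel)"
  have HC: "cmod (H y) \<le> C" for y
    unfolding H_def C_def by (rule norm_fourier_le[OF h])
  define I where "I = (\<integral>x. (cmod (h x))\<^sup>2 \<partial>lborel)"
  have I: "(\<integral>\<^sup>+x. ennreal ((cmod (h x))\<^sup>2) \<partial>lborel) = ennreal I"
    unfolding I_def by (rule nn_integral_eq_integral[OF h2]) simp
  \<comment> \<open>With damping, the square integral is a quadratic form in \<open>h\<close> with
    kernel \<open>?k\<close>; a Schur test bounds it by the squared norm, uniformly in
    \<open>r\<close>.\<close>
  have bd: "(\<integral>\<^sup>+s. ennreal ((cmod (H s))\<^sup>2 * gam (s /\<^sub>R r)) \<partial>lborel) \<le> ennreal I" if r: "r > 0" for r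
  proof -
    let ?k = "\<lambda>x y. r ^ DIM('a) * gam (r *\<^sub>R (x - y) :: 'a)"
    have ki: "integrable lborel (\<lambda>x. ?k x y)" "(\<integral>x. ?k x y \<partial>lborel) = 1" for y
      using gauss_fourier_scaled(3,4)[OF r] by auto
    have ksym: "?k x y = ?k y x" for x y
      using gam_minus[of "r *\<^sub>R (x - y)"] by (simp add: algebra_simps)
    have kn: "(\<integral>\<^sup>+x. ennreal (?k x y) \<partial>lborel) = 1" "(\<integral>\<^sup>+x. ennreal (?k y x) \<partial>lborel) = 1" for y
      using nn_integral_eq_integral[OF ki(1)[of y]] ki(2)[of y] r ksym by auto
    have [measurable]: "(\<lambda>p. ?k (fst p) (snd p)) \<in> borel_measurable (borel \<Otimes>\<^sub>M borel)" by measurable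
    have gi: "integrable lborel (\<lambda>s. (cmod (H s))\<^sup>2 * gam (s /\<^sub>R r))"
    proof (rule Bochner_Integration.integrable_bound)
      show "integrable lborel (\<lambda>s::'a. C\<^sup>2 * gam (s /\<^sub>R r))"
        using gauss_fourier_scaled(2)[OF r] by auto
      show "AE s in lborel. norm ((cmod (H s))\<^sup>2 * gam (s /\<^sub>R r)) \<le> norm (C\<^sup>2 * gam (s /\<^sub>R r))"
        using HC by (auto intro!: AE_I2 mult_right_mono power_mono simp: abs_mult)
    qed measurable
    have "complex_of_real (\<integral>s. (cmod (H s))\<^sup>2 * gam (s /\<^sub>R r) \<partial>lborel)
       = (\<integral>s. H s * of_real (gam (s /\<^sub>R r)) * cnj (H s) \<partial>lborel)"
      by (subst integral_complex_of_real[symmetric])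
         (auto intro!: Bochner_Integration.integral_cong simp: algebra_simps simp flip: complex_norm_square)
    also have "\<dots> = (\<integral>s. (\<integral>y. H s * of_real (gam (s /\<^sub>R r)) * (cnj (h y) * expi (- (s \<bullet> y))) \<partial>lborel) \<partial>lborel)"
    proof -
      have "cnj (H s) = (\<integral>y. cnj (h y) * expi (- (s \<bullet> y)) \<partial>lborel)" for s
        using Bochner_Integration.integral_cnj[of lborel "\<lambda>x. h x * expi (s \<bullet> x)"] by (simp add: H_def cnj_expi)
      then show ?thesis by (simp only: integral_mult_right_zero)
    qed
    also have "\<dots> = (\<integral>y. (\<integral>s. H s * of_real (gam (s /\<^sub>R r)) * (cnj (h y) * expi (- (s \<bullet> y))) \<partial>lborel) \<partial>lborel)"
    proof (rule lborel_pair.Fubini_integral[symmetric])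
      have "integrable (lborel \<Otimes>\<^sub>M lborel) (\<lambda>p::'a\<times>'a. complex_of_real (gam (fst p /\<^sub>R r)) * cnj (h (snd p)))"
      proof (rule lborel_pair.Fubini_integrable)
        show "integrable lborel (\<lambda>s::'a. \<integral>x. cmod (complex_of_real (gam (fst (s, x) /\<^sub>R r)) * cnj (h (snd (s, x)))) \<partial>lborel)"
          using gauss_fourier_scaled(2)[OF r, where ?'a='a] h by (simp add: norm_mult)
        show "AE s::'a in lborel. integrable lborel (\<lambda>x. complex_of_real (gam (fst (s, x) /\<^sub>R r)) * cnj (h (snd (s, x))))"
          using h by simp
      qed measurable
      then have "integrable (lborel \<Otimes>\<^sub>M lborel) (\<lambda>p::'a\<times>'a. complex_of_real (gam (fst p /\<^sub>R r)) * cnj (h (snd p)) * (H (fst p) * expi (- (fst p \<bullet> snd p))))"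
        by (rule integrable_mult_bounded[where C=C]) (use HC in \<open>auto simp: norm_mult\<close>)
      then show "integrable (lborel \<Otimes>\<^sub>M lborel) (\<lambda>(s, y). H s * of_real (gam (s /\<^sub>R r)) * (cnj (h y) * expi (- (s \<bullet> y))))"
        by (simp add: split_beta' mult_ac)
    qed
    also have "\<dots> = (\<integral>y. cnj (h y) * (\<integral>x. h x * of_real (?k x y) \<partial>lborel) \<partial>lborel)"
    proof -
      have w: "(\<integral>x. h x * of_real (?k x y) \<partial>lborel) = (\<integral>s. H s * expi (- (s \<bullet> y)) * of_real (gam (s /\<^sub>R r)) \<partial>lborel)" for y
        unfolding H_def by (rule fourier_gauss_weighted[OF h r, symmetric])
      show ?thesis unfolding w by (simp add: mult_ac flip: integral_mult_right_zero)
    qed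
    finally have eq: "complex_of_real (\<integral>s. (cmod (H s))\<^sup>2 * gam (s /\<^sub>R r) \<partial>lborel)
       = (\<integral>y. cnj (h y) * (\<integral>x. h x * of_real (?k x y) \<partial>lborel) \<partial>lborel)" .
    have "0 \<le> (\<integral>s. (cmod (H s))\<^sup>2 * gam (s /\<^sub>R r) \<partial>lborel)"
      by (intro integral_nonneg_AE) simp
    then have "ennreal (\<integral>s. (cmod (H s))\<^sup>2 * gam (s /\<^sub>R r) \<partial>lborel)
       = ennreal (cmod (\<integral>y. cnj (h y) * (\<integral>x. h x * of_real (?k x y) \<partial>lborel) \<partial>lborel))"
      unfolding eq[symmetric] norm_of_real by simp
    also have "\<dots> \<le> (\<integral>\<^sup>+y. ennreal (cmod (cnj (h y) * (\<integral>x. h x * of_real (?k x y) \<partial>lborel))) \<partial>lborel)"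
      by (rule norm_integral_le_nn_integral)
    also have "\<dots> \<le> (\<integral>\<^sup>+y. (\<integral>\<^sup>+x. ennreal (cmod (h x) * cmod (h y) * ?k x y) \<partial>lborel) \<partial>lborel)"
    proof (rule nn_integral_mono)
      fix y
      have "ennreal (cmod (cnj (h y) * (\<integral>x. h x * of_real (?k x y) \<partial>lborel)))
        = ennreal (cmod (\<integral>x. cnj (h y) * (h x * of_real (?k x y)) \<partial>lborel))" by simp
      also have "\<dots> \<le> (\<integral>\<^sup>+x. ennreal (cmod (cnj (h y) * (h x * of_real (?k x y)))) \<partial>lborel)"
        by (rule norm_integral_le_nn_integral)
      also have "\<dots> = (\<integral>\<^sup>+x. ennreal (cmod (h x) * cmod (h y) * ?k x y) \<partial>lborel)"
        using r by (simp add: norm_mult norm_power mult_ac abs_mult)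
      finally show "ennreal (cmod (cnj (h y) * (\<integral>x. h x * of_real (?k x y) \<partial>lborel))) \<le> \<dots>" .
    qed
    \<comment> \<open>|h(x) h(y)| is at most (|h(x)|^2 + |h(y)|^2) / 2, and the kernel has mass one
      in either variable, so each summand contributes half of the squared norm.\<close>
    also have "\<dots> \<le> (\<integral>\<^sup>+y. (\<integral>\<^sup>+x. ennreal ((cmod (h x))\<^sup>2 / 2) * ennreal (?k x y) + ennreal ((cmod (h y))\<^sup>2 / 2) * ennreal (?k x y) \<partial>lborel) \<partial>lborel)"
    proof (intro nn_integral_mono)
      fix x y
      have "cmod (h x) * cmod (h y) \<le> (cmod (h x))\<^sup>2 / 2 + (cmod (h y))\<^sup>2 / 2"
        using sum_squares_bound[of "cmod (h x)" "cmod (h y)"] by simp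
      then have "cmod (h x) * cmod (h y) * ?k x y \<le> ((cmod (h x))\<^sup>2 / 2 + (cmod (h y))\<^sup>2 / 2) * ?k x y"
        using r by (intro mult_right_mono) auto
      then show "ennreal (cmod (h x) * cmod (h y) * ?k x y)
          \<le> ennreal ((cmod (h x))\<^sup>2 / 2) * ennreal (?k x y) + ennreal ((cmod (h y))\<^sup>2 / 2) * ennreal (?k x y)"
        using r by (simp add: distrib_right flip: ennreal_mult ennreal_plus)
    qed
    also have "\<dots> = (\<integral>\<^sup>+y. (\<integral>\<^sup>+x. ennreal ((cmod (h x))\<^sup>2 / 2) * ennreal (?k x y) \<partial>lborel) \<partial>lborel)
       + (\<integral>\<^sup>+y. (\<integral>\<^sup>+x. ennreal ((cmod (h y))\<^sup>2 / 2) * ennreal (?k x y) \<partial>lborel) \<partial>lborel)"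
      by (subst nn_integral_add[symmetric]) (auto intro!: nn_integral_cong nn_integral_add)
    also have "(\<integral>\<^sup>+y. (\<integral>\<^sup>+x. ennreal ((cmod (h x))\<^sup>2 / 2) * ennreal (?k x y) \<partial>lborel) \<partial>lborel)
        = (\<integral>\<^sup>+x. (\<integral>\<^sup>+y. ennreal ((cmod (h x))\<^sup>2 / 2) * ennreal (?k x y) \<partial>lborel) \<partial>lborel)"
      by (rule lborel_pair.Fubini') measurable
    finally have "ennreal (\<integral>s. (cmod (H s))\<^sup>2 * gam (s /\<^sub>R r) \<partial>lborel)
       \<le> (\<integral>\<^sup>+x. ennreal ((cmod (h x))\<^sup>2 / 2) \<partial>lborel) + (\<integral>\<^sup>+x. ennreal ((cmod (h x))\<^sup>2 / 2) \<partial>lborel)"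
      by (simp add: nn_integral_cmult kn)
    also have "\<dots> = ennreal I"
      by (subst nn_integral_add[symmetric]) (auto simp flip: I ennreal_plus)
    finally show ?thesis
      using nn_integral_eq_integral[OF gi] by simp
  qed
  have "(\<integral>\<^sup>+s. ennreal ((cmod (H s))\<^sup>2) \<partial>lborel)
      = (\<integral>\<^sup>+s. liminf (\<lambda>m. ennreal ((cmod (H s))\<^sup>2 * gam (s /\<^sub>R real (Suc m)))) \<partial>lborel)"
  proof (rule nn_integral_cong)
    fix s :: 'a
    have "(\<lambda>m. inverse (real (Suc m))) \<longlonglongrightarrow> 0" by (rule LIMSEQ_inverse_real_of_nat)
    then have "(\<lambda>m. ennreal ((cmod (H s))\<^sup>2 * (exp (- pi * (norm (inverse (real (Suc m)) *\<^sub>R s))\<^sup>2))))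
         \<longlonglongrightarrow> ennreal ((cmod (H s))\<^sup>2 * (exp (- pi * (norm (0 *\<^sub>R s))\<^sup>2)))"
      by (intro tendsto_intros)
    then have "(\<lambda>m. ennreal ((cmod (H s))\<^sup>2 * gam (s /\<^sub>R real (Suc m)))) \<longlonglongrightarrow> ennreal ((cmod (H s))\<^sup>2)"
      unfolding gam_def by simp
    then show "ennreal ((cmod (H s))\<^sup>2) = liminf (\<lambda>m. ennreal ((cmod (H s))\<^sup>2 * gam (s /\<^sub>R real (Suc m))))"
      by (intro lim_imp_Liminf[symmetric]) auto
  qed
  \<comment> \<open>Fatou's lemma removes the damping.\<close>
  also have "\<dots> \<le> liminf (\<lambda>m. \<integral>\<^sup>+s. ennreal ((cmod (H s))\<^sup>2 * gam (s /\<^sub>R real (Suc m))) \<partial>lborel)"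
    by (rule nn_integral_liminf) measurable
  also have "\<dots> \<le> ennreal I"
    by (rule Liminf_le) (auto intro!: always_eventually bd)
  finally show ?thesis unfolding H_def I .
qed

section \<open>Fourier analysis on the range of an orthogonal projection\<close>

text \<open>The projection stands for its range. A subspace whose dimension depends on a matrix is
  not a type, so analysis on it is done with functions on the whole space and with the measure
  \<open>lam\<close>.\<close>

definition orth_proj :: "('a::euclidean_space \<Rightarrow> 'a) \<Rightarrow> bool" where
  "orth_proj E \<longleftrightarrow> linear E \<and> (\<forall>x. E (E x) = E x) \<and> (\<forall>x y. E x \<bullet> y = x \<bullet> E y)"

definition cproj :: "('a::euclidean_space \<Rightarrow> 'a) \<Rightarrow> 'a \<Rightarrow> 'a" where
  "cproj E x = x - E x"

lemma orth_projD:
  assumes "orth_proj E"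
  shows "linear E" "E (E x) = E x" "E x \<bullet> y = x \<bullet> E y" "E \<in> borel_measurable borel"
    "E (x + y) = E x + E y" "E (x - y) = E x - E y" "E (- x) = - E x" "E (c *\<^sub>R x) = c *\<^sub>R E x"
    "E (x - E x) = 0" "E 0 = 0"
  using assms linear_add[of E] linear_diff[of E] linear_0[of E] linear_neg[of E] linear_cmul[of E]
  by (auto simp: orth_proj_def intro!: borel_measurable_continuous_onI linear_continuous_on linear_conv_bounded_linear[THEN iffD1])

lemma orth_proj_cproj: "orth_proj E \<Longrightarrow> orth_proj (cproj E)"
  unfolding orth_proj_def cproj_def
  by (auto simp: linear_diff inner_diff_left inner_diff_right intro!: linearI)
     (auto simp: linear_add linear_cmul algebra_simps)

lemma cproj_measurable: "orth_proj E \<Longrightarrow> cproj E \<in> borel_measurable borel"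
  by (rule orth_projD(4)[OF orth_proj_cproj])

lemma cproj_simps:
  assumes "orth_proj E"
  shows "cproj (cproj E) = E" "E (cproj E x) = 0" "cproj E (E x) = 0" "E x + cproj E x = x"
    "x - cproj E x = E x" "x - E x = cproj E x"
  using orth_projD[OF assms] by (auto simp: cproj_def)

lemma gam_orth:
  assumes "orth_proj E"
  shows "gam (E x + cproj E y) = gam (E x) * gam (cproj E y)"
proof -
  have "E x \<bullet> cproj E y = 0"
    using orth_projD(3)[OF assms, of x "cproj E y"] by (simp add: cproj_simps[OF assms])
  then have "(norm (E x + cproj E y))\<^sup>2 = (norm (E x))\<^sup>2 + (norm (cproj E y))\<^sup>2"
    by (simp add: power2_norm_eq_inner inner_add_left inner_add_right inner_commute)
  then show ?thesis by (simp add: gam_def distrib_left exp_add[symmetric])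
qed

lemma gam_split:
  assumes "orth_proj E"
  shows "gam x = gam (E x) * gam (cproj E x)"
  using gam_orth[OF assms, of x x] by (simp add: cproj_simps[OF assms])

text \<open>Lebesgue measure on the range of \<open>E\<close>: the Gaussian weight integrates to one over each fibre.\<close>

definition lam :: "('a::euclidean_space \<Rightarrow> 'a) \<Rightarrow> 'a measure" where
  "lam E = distr (density lborel (\<lambda>x. ennreal (gam (cproj E x)))) borel E"

lemma sets_lam[simp, measurable_cong]: "sets (lam E) = sets borel" and space_lam[simp]: "space (lam E) = UNIV"
  by (simp_all add: lam_def)

context
  fixes E :: "'a::euclidean_space \<Rightarrow> 'a"
  assumes E: "orth_proj E"
  notes [measurable] = orth_projD(4)[OF E] cproj_measurable[OF E]
begin

lemma nn_integral_lam:
  assumes [measurable]: "f \<in> borel_measurable borel"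
  shows "(\<integral>\<^sup>+x. f x \<partial>lam E) = (\<integral>\<^sup>+x. f (E x) * ennreal (gam (cproj E x)) \<partial>lborel)"
  by (simp add: lam_def nn_integral_distr nn_integral_density mult.commute)

lemma integral_lam:
  fixes f :: "'a \<Rightarrow> complex"
  assumes [measurable]: "f \<in> borel_measurable borel"
  shows "(\<integral>x. f x \<partial>lam E) = (\<integral>x. f (E x) * of_real (gam (cproj E x)) \<partial>lborel)"
    and "integrable (lam E) f \<longleftrightarrow> integrable lborel (\<lambda>x. f (E x) * of_real (gam (cproj E x)))"
  by (simp_all add: lam_def integral_distr integrable_distr_eq integral_density integrable_density
      scaleR_conv_of_real mult.commute)

lemma AE_lam_iff:
  assumes [measurable]: "Measurable.pred borel P"
  shows "(AE x in lam E. P x) \<longleftrightarrow> (AE x in lborel. P (E x))"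
  unfolding lam_def by (subst AE_distr_iff) (measurable, simp add: AE_density)

text \<open>The measure is carried by the range of \<open>E\<close>, although its type is the whole
  space; later arguments obtain their points with E x = x from here.\<close>

lemma AE_lam_fixed: "AE x in lam E. E x = x"
  by (subst AE_lam_iff) (simp_all add: orth_projD[OF E])

text \<open>Where |E x| \<le> R the weight \<open>gam (cproj E x)\<close> is at most e^(\<pi> R^2)
  times \<open>gam x\<close>, which is integrable.\<close>

lemma emeasure_lam_cball: "emeasure (lam E) (cball 0 R) < \<infinity>"
proof -
  have "emeasure (lam E) (cball 0 R) = (\<integral>\<^sup>+x. indicator (cball 0 R) x \<partial>lam E)" by simp
  also have "\<dots> = (\<integral>\<^sup>+x. indicator (cball 0 R) (E x) * ennreal (gam (cproj E x)) \<partial>lborel)"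
    by (intro nn_integral_lam borel_measurable_indicator) auto
  also have "\<dots> \<le> (\<integral>\<^sup>+x. ennreal (exp (pi * R\<^sup>2) * gam (x::'a)) \<partial>lborel)"
  proof (rule nn_integral_mono)
    fix x
    show "indicator (cball 0 R) (E x) * ennreal (gam (cproj E x)) \<le> ennreal (exp (pi * R\<^sup>2) * gam x)"
    proof (cases "norm (E x) \<le> R")
      case True
      then have "1 \<le> exp (pi * R\<^sup>2) * gam (E x)"
        by (simp add: gam_def power_mono flip: exp_add)
      then have "gam (cproj E x) \<le> exp (pi * R\<^sup>2) * gam x"
        using mult_right_mono[of 1 "exp (pi * R\<^sup>2) * gam (E x)" "gam (cproj E x)"] gam_split[OF E, of x]
        by (simp add: mult.assoc)
      then show ?thesis by (auto simp: indicator_def)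
    qed (simp add: indicator_def)
  qed
  also have "\<dots> < \<infinity>"
    using integrable_mult_right[OF gauss_fourier(2)[where ?'a='a], of "exp (pi * R\<^sup>2)"]
    by (subst nn_integral_eq_integral) auto
  finally show ?thesis .
qed

lemma sigma_finite_lam: "sigma_finite_measure (lam E)"
proof
  show "\<exists>A. countable A \<and> A \<subseteq> sets (lam E) \<and> \<Union>A = space (lam E) \<and> (\<forall>a\<in>A. emeasure (lam E) a \<noteq> \<infinity>)"
  proof (intro exI conjI ballI)
    show "countable (range (\<lambda>n::nat. cball (0::'a) (real n)))" by auto
    show "\<Union>(range (\<lambda>n::nat. cball (0::'a) (real n))) = space (lam E)"
      by (auto simp: real_arch_simple)
    show "emeasure (lam E) a \<noteq> \<infinity>" if "a \<in> range (\<lambda>n::nat. cball (0::'a) (real n))" for a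
      using that emeasure_lam_cball by (auto simp: less_top)
  qed auto
qed

text \<open>A translation along the range leaves the complementary component, hence the weight,
  alone; a reflection changes its sign, and the Gaussian is even.\<close>

lemma lam_affine:
  assumes a: "E a = a" and c: "c = 1 \<or> c = -1"
  shows "distr (lam E) borel (\<lambda>x. a + c *\<^sub>R x) = lam E"
proof (rule measure_eqI)
  fix A assume "A \<in> sets (distr (lam E) borel (\<lambda>x. a + c *\<^sub>R x))"
  then have [measurable]: "A \<in> sets borel" by simp
  have "emeasure (distr (lam E) borel (\<lambda>x. a + c *\<^sub>R x)) A = (\<integral>\<^sup>+x. indicator A x \<partial>distr (lam E) borel (\<lambda>x. a + c *\<^sub>R x))"
    by simp
  also have "\<dots> = (\<integral>\<^sup>+x. indicator A (a + c *\<^sub>R x) \<partial>lam E)"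
    by (rule nn_integral_distr) measurable
  also have "\<dots> = (\<integral>\<^sup>+x. indicator A (a + c *\<^sub>R E x) * ennreal (gam (cproj E x)) \<partial>lborel)"
    by (rule nn_integral_lam) measurable
  also have "\<dots> = (\<integral>\<^sup>+x. indicator A (E (a + c *\<^sub>R x)) * ennreal (gam (cproj E (a + c *\<^sub>R x))) \<partial>lborel)"
    using c a gam_minus[of "cproj E x" for x]
    by (auto simp: orth_projD[OF E] cproj_def intro!: nn_integral_cong)
  also have "\<dots> = (\<integral>\<^sup>+x. indicator A (E x) * ennreal (gam (cproj E x)) \<partial>lborel)"
    using c nn_integral_lborel_affine[of "\<lambda>x. indicator A (E x) * ennreal (gam (cproj E x))" c a] by auto
  also have "\<dots> = (\<integral>\<^sup>+x. indicator A x \<partial>lam E)"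
    by (rule nn_integral_lam[symmetric]) measurable
  finally show "emeasure (distr (lam E) borel (\<lambda>x. a + c *\<^sub>R x)) A = emeasure (lam E) A"
    by simp
qed simp

lemma nn_integral_lam_affine:
  assumes [measurable]: "f \<in> borel_measurable borel" and a: "E a = a"
  shows "(\<integral>\<^sup>+x. f (a + x) \<partial>lam E) = (\<integral>\<^sup>+x. f x \<partial>lam E)"
    and "(\<integral>\<^sup>+x. f (x - a) \<partial>lam E) = (\<integral>\<^sup>+x. f x \<partial>lam E)"
    and "(\<integral>\<^sup>+x. f (a - x) \<partial>lam E) = (\<integral>\<^sup>+x. f x \<partial>lam E)"
proof -
  have 1: "(\<integral>\<^sup>+x. f (b + c *\<^sub>R x) \<partial>lam E) = (\<integral>\<^sup>+x. f x \<partial>lam E)" if "E b = b" "c = 1 \<or> c = -1" for b c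
    by (subst lam_affine[OF that, symmetric], subst nn_integral_distr) auto
  from 1[of a 1] 1[of "- a" 1] 1[of a "-1"] a orth_projD(7)[OF E, of a]
  show "(\<integral>\<^sup>+x. f (a + x) \<partial>lam E) = (\<integral>\<^sup>+x. f x \<partial>lam E)"
    "(\<integral>\<^sup>+x. f (x - a) \<partial>lam E) = (\<integral>\<^sup>+x. f x \<partial>lam E)"
    "(\<integral>\<^sup>+x. f (a - x) \<partial>lam E) = (\<integral>\<^sup>+x. f x \<partial>lam E)"
    by auto
qed

lemma integral_lam_translate:
  fixes f :: "'a \<Rightarrow> complex"
  assumes [measurable]: "f \<in> borel_measurable borel" and a: "E a = a"
  shows "(\<integral>x. f (x - a) \<partial>lam E) = (\<integral>x. f x \<partial>lam E)"
    and "integrable (lam E) (\<lambda>x. f (x - a)) \<longleftrightarrow> integrable (lam E) f"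
proof -
  have b: "E (- a) = - a" using a orth_projD(7)[OF E, of a] by simp
  show "(\<integral>x. f (x - a) \<partial>lam E) = (\<integral>x. f x \<partial>lam E)"
    by (subst (2) lam_affine[OF b, of 1, symmetric], simp, subst integral_distr) auto
  show "integrable (lam E) (\<lambda>x. f (x - a)) \<longleftrightarrow> integrable (lam E) f"
    by (subst (2) lam_affine[OF b, of 1, symmetric], simp, subst integrable_distr_eq) auto
qed

end

text \<open>For fixed first variable the shear is a translation in the second, so translation
  invariance and Tonelli suffice and no determinant enters.\<close>

lemma nn_integral_shear:
  fixes K :: "'a::euclidean_space \<times> 'a \<Rightarrow> ennreal" and L :: "'a \<Rightarrow> 'a"
  assumes [measurable]: "K \<in> borel_measurable (borel \<Otimes>\<^sub>M borel)" "L \<in> borel_measurable borel"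
  shows "(\<integral>\<^sup>+x. \<integral>\<^sup>+y. K (x, y + L x) \<partial>lborel \<partial>lborel) = (\<integral>\<^sup>+x. \<integral>\<^sup>+y. K (x, y) \<partial>lborel \<partial>lborel)"
    and "(\<integral>\<^sup>+x. \<integral>\<^sup>+y. K (x + L y, y) \<partial>lborel \<partial>lborel) = (\<integral>\<^sup>+x. \<integral>\<^sup>+y. K (x, y) \<partial>lborel \<partial>lborel)"
proof -
  have t: "(\<integral>\<^sup>+y. f (y + c) \<partial>lborel) = (\<integral>\<^sup>+y. f y \<partial>lborel)" if "f \<in> borel_measurable borel" for f and c :: 'a
    using nn_integral_lborel_affine[OF that, of 1 c] by (simp add: add.commute)
  show "(\<integral>\<^sup>+x. \<integral>\<^sup>+y. K (x, y + L x) \<partial>lborel \<partial>lborel) = (\<integral>\<^sup>+x. \<integral>\<^sup>+y. K (x, y) \<partial>lborel \<partial>lborel)"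
    by (intro nn_integral_cong t) measurable
  have "(\<integral>\<^sup>+x. \<integral>\<^sup>+y. K (x + L y, y) \<partial>lborel \<partial>lborel) = (\<integral>\<^sup>+y. \<integral>\<^sup>+x. K (x + L y, y) \<partial>lborel \<partial>lborel)"
    by (rule lborel_pair.Fubini'[symmetric]) measurable
  also have "\<dots> = (\<integral>\<^sup>+y. \<integral>\<^sup>+x. K (x, y) \<partial>lborel \<partial>lborel)"
    by (intro nn_integral_cong t) measurable
  also have "\<dots> = (\<integral>\<^sup>+x. \<integral>\<^sup>+y. K (x, y) \<partial>lborel \<partial>lborel)"
    by (rule lborel_pair.Fubini') measurable
  finally show "(\<integral>\<^sup>+x. \<integral>\<^sup>+y. K (x + L y, y) \<partial>lborel \<partial>lborel) = (\<integral>\<^sup>+x. \<integral>\<^sup>+y. K (x, y) \<partial>lborel \<partial>lborel)" .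
qed

context
  fixes E :: "'a::euclidean_space \<Rightarrow> 'a"
  assumes E: "orth_proj E"
  notes [measurable] = orth_projD(4)[OF E] cproj_measurable[OF E]
begin

interpretation pE: pair_sigma_finite "lam E" "lam (cproj E)"
  by (intro pair_sigma_finite.intro sigma_finite_lam orth_proj_cproj E)

text \<open>The rotation \<open>(x, y) \<mapsto> (E x - (1 - E) y, E y + (1 - E) x)\<close> is a product of three shears,
  hence preserves Lebesgue measure.\<close>

lemma nn_integral_lam_split:
  assumes [measurable]: "f \<in> borel_measurable borel"
  shows "(\<integral>\<^sup>+u. \<integral>\<^sup>+v. f (u + v) \<partial>lam (cproj E) \<partial>lam E) = (\<integral>\<^sup>+x. f x \<partial>lborel)"
proof -
  let ?C = "cproj E"
  note Es = orth_projD[OF E] and Cs = orth_projD[OF orth_proj_cproj[OF E]]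
  note s = cproj_simps[OF E]
  have "(\<integral>\<^sup>+u. \<integral>\<^sup>+v. f (u + v) \<partial>lam ?C \<partial>lam E)
     = (\<integral>\<^sup>+x. (\<integral>\<^sup>+y. f (E x + ?C y) * ennreal (gam (E y)) \<partial>lborel) * ennreal (gam (?C x)) \<partial>lborel)"
    using nn_integral_lam[OF orth_proj_cproj[OF E]]
    by (subst nn_integral_lam[OF E]) (simp_all add: s)
  \<comment> \<open>The two weights combine into one Gaussian because the components are orthogonal;
    the sign of \<open>y\<close> is free since the Gaussian is even.\<close>
  also have "\<dots> = (\<integral>\<^sup>+x. \<integral>\<^sup>+y. f (E x + ?C y) * ennreal (gam (E (- y) + ?C x)) \<partial>lborel \<partial>lborel)"
  proof -
    have "gam (E (- y) + ?C x) = gam (E y) * gam (?C x)" for x y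
      using gam_orth[OF E, of "- y" x] by (simp add: Es(7))
    then show ?thesis
      by (subst nn_integral_multc[symmetric]) (auto simp: ennreal_mult mult_ac)
  qed
  \<comment> \<open>The reflection of \<open>y\<close> produces the sign pattern of a
    rotation.\<close>
  also have "\<dots> = (\<integral>\<^sup>+x. \<integral>\<^sup>+y. f (E x - ?C y) * ennreal (gam (E y + ?C x)) \<partial>lborel \<partial>lborel)"
  proof (rule nn_integral_cong)
    fix x
    show "(\<integral>\<^sup>+y. f (E x + ?C y) * ennreal (gam (E (- y) + ?C x)) \<partial>lborel)
      = (\<integral>\<^sup>+y. f (E x - ?C y) * ennreal (gam (E y + ?C x)) \<partial>lborel)"
      using nn_integral_lborel_affine[of "\<lambda>y. f (E x - ?C y) * ennreal (gam (E y + ?C x))" "-1" 0]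
      by (simp add: Cs Es)
  qed
  \<comment> \<open>From here each shear is peeled off in two moves: the projection identities write
    the integrand through a sheared point, then \<open>nn_integral_shear\<close> replaces that point
    by a free variable.\<close>
  also have "\<dots> = (\<integral>\<^sup>+x. \<integral>\<^sup>+y. f (x - ?C (y + ?C x)) * ennreal (gam (E (y + ?C x) + ?C x)) \<partial>lborel \<partial>lborel)"
    by (intro nn_integral_cong arg_cong2[where f="(*)"] arg_cong[where f=f] arg_cong[where f=ennreal] arg_cong[where f=gam])
       (simp_all add: cproj_def Es algebra_simps)
  also have "\<dots> = (\<integral>\<^sup>+x. \<integral>\<^sup>+y. f (x - ?C y) * ennreal (gam (E y + ?C x)) \<partial>lborel \<partial>lborel)"
    using nn_integral_shear(1)[of "\<lambda>(x, y). f (x - ?C y) * ennreal (gam (E y + ?C x))" ?C] by simp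
  also have "\<dots> = (\<integral>\<^sup>+x. \<integral>\<^sup>+y. f (x + - ?C y) * ennreal (gam (y + ?C (x + - ?C y))) \<partial>lborel \<partial>lborel)"
    by (intro nn_integral_cong arg_cong2[where f="(*)"] arg_cong[where f=f] arg_cong[where f=ennreal] arg_cong[where f=gam])
       (simp_all add: cproj_def Es algebra_simps)
  also have "\<dots> = (\<integral>\<^sup>+x. \<integral>\<^sup>+y. f x * ennreal (gam (y + ?C x)) \<partial>lborel \<partial>lborel)"
    using nn_integral_shear(2)[of "\<lambda>(x, y). f x * ennreal (gam (y + ?C x))" "\<lambda>y. - ?C y"] by simp
  also have "\<dots> = (\<integral>\<^sup>+x. \<integral>\<^sup>+y. f x * ennreal (gam (y::'a)) \<partial>lborel \<partial>lborel)"
    using nn_integral_shear(1)[of "\<lambda>(x, y). f x * ennreal (gam y)" ?C] by simp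
  \<comment> \<open>The first variable has taken over all of \<open>f\<close>; the second carries
    only the Gaussian, of mass one.\<close>
  also have "(\<integral>\<^sup>+y. ennreal (gam (y::'a)) \<partial>lborel) = 1"
    using nn_integral_eq_integral[OF gauss_fourier(2)[where ?'a='a]] gauss_fourier_scaled(3)[of 1 "0::'a"] by simp
  then have "(\<integral>\<^sup>+x. \<integral>\<^sup>+y. f x * ennreal (gam (y::'a)) \<partial>lborel \<partial>lborel) = (\<integral>\<^sup>+x. f x \<partial>lborel)"
    by (simp add: nn_integral_cmult)
  finally show ?thesis .
qed

lemma lborel_lam_split: "distr (lam E \<Otimes>\<^sub>M lam (cproj E)) borel (\<lambda>(u, v). u + v) = lborel"
proof (rule measure_eqI)
  fix A assume "A \<in> sets (distr (lam E \<Otimes>\<^sub>M lam (cproj E)) borel (\<lambda>(u, v). u + v))"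
  then have [measurable]: "A \<in> sets borel" by simp
  have "emeasure (distr (lam E \<Otimes>\<^sub>M lam (cproj E)) borel (\<lambda>(u, v). u + v)) A
     = (\<integral>\<^sup>+x. indicator A x \<partial>distr (lam E \<Otimes>\<^sub>M lam (cproj E)) borel (\<lambda>(u, v). u + v))" by simp
  also have "\<dots> = (\<integral>\<^sup>+p. indicator A (fst p + snd p) \<partial>(lam E \<Otimes>\<^sub>M lam (cproj E)))"
    by (subst nn_integral_distr) (auto simp: split_beta)
  also have "\<dots> = (\<integral>\<^sup>+u. \<integral>\<^sup>+v. indicator A (u + v) \<partial>lam (cproj E) \<partial>lam E)"
    by (subst pE.M2.nn_integral_fst[symmetric]) auto
  also have "\<dots> = (\<integral>\<^sup>+x. indicator A x \<partial>lborel)"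
    by (rule nn_integral_lam_split) measurable
  finally show "emeasure (distr (lam E \<Otimes>\<^sub>M lam (cproj E)) borel (\<lambda>(u, v). u + v)) A = emeasure lborel A" by simp
qed simp

text \<open>For almost every pair of the product measure, u lies in the range and v in the kernel of
  \<open>E\<close>, so both can be read off from u + v; Fubini then separates the integral.\<close>

lemma lam_factor:
  fixes f g :: "'a \<Rightarrow> complex"
  assumes f: "integrable (lam E) f" and g: "integrable (lam (cproj E)) g"
  shows "integrable lborel (\<lambda>x. f (E x) * g (cproj E x))"
    and "(\<integral>x. f (E x) * g (cproj E x) \<partial>lborel) = (\<integral>x. f x \<partial>lam E) * (\<integral>x. g x \<partial>lam (cproj E))"
proof -
  let ?C = "cproj E"
  note Es = orth_projD[OF E] and Cs = orth_projD[OF orth_proj_cproj[OF E]]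
  note s = cproj_simps[OF E]
  have [measurable]: "f \<in> borel_measurable borel" "g \<in> borel_measurable borel"
    using borel_measurable_integrable[OF f] borel_measurable_integrable[OF g] by auto
  have "integrable (lam E \<Otimes>\<^sub>M lam ?C) (\<lambda>p. f (fst p) * g (snd p))"
    by (rule pE.Fubini_integrable) (use f g in \<open>auto simp: norm_mult\<close>)
  then have i1: "integrable (lam E \<Otimes>\<^sub>M lam ?C) (\<lambda>(u, v). f u * g v)" by (simp add: split_beta')
  have ae: "AE p in lam E \<Otimes>\<^sub>M lam ?C. (case p of (u, v) \<Rightarrow> f (E (u + v)) * g (?C (u + v))) = (case p of (u, v) \<Rightarrow> f u * g v)"
  proof (rule pE.AE_pair_measure)
    show "AE u in lam E. AE v in lam ?C. (case (u, v) of (u, v) \<Rightarrow> f (E (u + v)) * g (?C (u + v))) = (case (u, v) of (u, v) \<Rightarrow> f u * g v)"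
      using AE_lam_fixed[OF E]
    proof eventually_elim
      case (elim u)
      show ?case using AE_lam_fixed[OF orth_proj_cproj[OF E]]
      proof eventually_elim
        case (elim v)
        have "E v = 0" using elim s(2)[of v] by simp
        moreover have "?C u = 0" using \<open>E u = u\<close> by (simp add: cproj_def)
        ultimately show ?case using elim \<open>E u = u\<close> by (simp add: Es Cs)
      qed
    qed
  qed measurable
  have i2: "integrable (lam E \<Otimes>\<^sub>M lam ?C) (\<lambda>(u, v). f (E (u + v)) * g (?C (u + v)))"
    by (subst integrable_cong_AE[OF _ _ ae]) (use i1 in measurable)
  show "integrable lborel (\<lambda>x. f (E x) * g (?C x))"
    by (subst lborel_lam_split[symmetric], subst integrable_distr_eq) (use i2 in \<open>auto simp: split_beta'\<close>)
  have "(\<integral>x. f (E x) * g (?C x) \<partial>lborel) = (\<integral>(u, v). f (E (u + v)) * g (?C (u + v)) \<partial>(lam E \<Otimes>\<^sub>M lam ?C))"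
    by (subst lborel_lam_split[symmetric], subst integral_distr) (auto simp: split_beta')
  also have "\<dots> = (\<integral>(u, v). f u * g v \<partial>(lam E \<Otimes>\<^sub>M lam ?C))"
    by (rule integral_cong_AE[OF _ _ ae]) measurable
  also have "\<dots> = (\<integral>u. \<integral>v. f u * g v \<partial>lam ?C \<partial>lam E)"
    using pE.integral_fst'[OF i1] by simp
  finally show "(\<integral>x. f (E x) * g (?C x) \<partial>lborel) = (\<integral>x. f x \<partial>lam E) * (\<integral>x. g x \<partial>lam ?C)"
    by simp
qed

lemma nn_lam_factor:
  assumes [measurable]: "f \<in> borel_measurable borel" "g \<in> borel_measurable borel"
  shows "(\<integral>\<^sup>+x. f (E x) * g (cproj E x) \<partial>lborel) = (\<integral>\<^sup>+x. f x \<partial>lam E) * (\<integral>\<^sup>+x. g x \<partial>lam (cproj E))"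
proof -
  let ?C = "cproj E"
  note Es = orth_projD[OF E] and Cs = orth_projD[OF orth_proj_cproj[OF E]]
  note s = cproj_simps[OF E]
  have "(\<integral>\<^sup>+x. f (E x) * g (?C x) \<partial>lborel) = (\<integral>\<^sup>+u. \<integral>\<^sup>+v. f (E (u + v)) * g (?C (u + v)) \<partial>lam ?C \<partial>lam E)"
    by (rule nn_integral_lam_split[symmetric]) measurable
  also have "\<dots> = (\<integral>\<^sup>+u. \<integral>\<^sup>+v. f u * g v \<partial>lam ?C \<partial>lam E)"
  proof (rule nn_integral_cong_AE)
    show "AE u in lam E. (\<integral>\<^sup>+v. f (E (u + v)) * g (?C (u + v)) \<partial>lam ?C) = (\<integral>\<^sup>+v. f u * g v \<partial>lam ?C)"
      using AE_lam_fixed[OF E]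
    proof eventually_elim
      case (elim u)
      show ?case
      proof (rule nn_integral_cong_AE)
        show "AE v in lam ?C. f (E (u + v)) * g (?C (u + v)) = f u * g v"
          using AE_lam_fixed[OF orth_proj_cproj[OF E]]
        proof eventually_elim
          case (elim v)
          have "E v = 0" using elim s(2)[of v] by simp
          moreover have "?C u = 0" using \<open>E u = u\<close> by (simp add: cproj_def)
          ultimately show ?case using elim \<open>E u = u\<close> by (simp add: Es Cs)
        qed
      qed
    qed
  qed
  also have "\<dots> = (\<integral>\<^sup>+u. f u * (\<integral>\<^sup>+v. g v \<partial>lam ?C) \<partial>lam E)"
    by (intro nn_integral_cong nn_integral_cmult) measurable
  also have "\<dots> = (\<integral>\<^sup>+x. f x \<partial>lam E) * (\<integral>\<^sup>+x. g x \<partial>lam ?C)"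
    by (rule nn_integral_multc) measurable
  finally show ?thesis .
qed

text \<open>The weight inside \<open>lam E\<close> is exactly the complementary factor of the
  Gaussian, which turns the integral into the one over the whole space at the frequency
  \<open>E s\<close>.\<close>

lemma gam_lam:
  shows "integrable (lam E) (\<lambda>x. complex_of_real (gam x))"
    and "(\<integral>x. of_real (gam x) * expi (s \<bullet> x) \<partial>lam E) = of_real (gam (E s))"
proof -
  have eq: "gam (E x) * gam (cproj E x) = gam x" for x
    by (rule gam_split[OF E, symmetric])
  show "integrable (lam E) (\<lambda>x. complex_of_real (gam x))"
    by (subst integral_lam(2)[OF E]) (use gauss_fourier(2) eq in \<open>auto simp flip: of_real_mult\<close>)
  have "(\<integral>x. of_real (gam x) * expi (s \<bullet> x) \<partial>lam E)
     = (\<integral>x. of_real (gam (E x) * gam (cproj E x)) * expi (E s \<bullet> x) \<partial>lborel)"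
    by (subst integral_lam(1)[OF E]) (auto simp: orth_projD[OF E] mult_ac)
  then show "(\<integral>x. of_real (gam x) * expi (s \<bullet> x) \<partial>lam E) = of_real (gam (E s))"
    unfolding eq by (simp add: gauss_fourier)
qed

lemma fourier_lam_E:
  fixes h :: "'a \<Rightarrow> complex"
  assumes [measurable]: "h \<in> borel_measurable borel"
  shows "(\<integral>x. h x * expi (E s \<bullet> x) \<partial>lam E) = (\<integral>x. h x * expi (s \<bullet> x) \<partial>lam E)"
  by (subst (1 2) integral_lam(1)[OF E]) (auto simp: orth_projD[OF E])

end

text \<open>Tensoring a function on the range with the self-dual Gaussian on the complement gives a
  function on the whole space whose transform is again such a tensor product. Through this device
  inversion and Bessel's inequality pass from the whole space to the range.\<close>

lemma fourier_lam_extend: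
  fixes h :: "'a::euclidean_space \<Rightarrow> complex"
  assumes E: "orth_proj E" and h: "integrable (lam E) h"
  shows "(\<integral>x. h (E x) * of_real (gam (cproj E x)) * expi (s \<bullet> x) \<partial>lborel)
      = (\<integral>x. h x * expi (E s \<bullet> x) \<partial>lam E) * of_real (gam (cproj E s))"
    and "integrable lborel (\<lambda>x. h (E x) * of_real (gam (cproj E x)))"
proof -
  have [measurable]: "h \<in> borel_measurable borel" using borel_measurable_integrable[OF h] by simp
  note C = orth_proj_cproj[OF E]
  have i1: "integrable (lam E) (\<lambda>x. h x * expi (s \<bullet> x))"
    by (rule integrable_mult_bounded[OF h, where C=1]) auto
  have i2: "integrable (lam (cproj E)) (\<lambda>x. of_real (gam x) * expi (s \<bullet> x))"
    by (rule integrable_mult_bounded[OF gam_lam(1)[OF C], where C=1]) auto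
  have e: "expi (s \<bullet> x) = expi (s \<bullet> E x) * expi (s \<bullet> cproj E x)" for x
    by (simp add: cproj_def inner_diff_right flip: expi_add)
  show "(\<integral>x. h (E x) * of_real (gam (cproj E x)) * expi (s \<bullet> x) \<partial>lborel)
      = (\<integral>x. h x * expi (E s \<bullet> x) \<partial>lam E) * of_real (gam (cproj E s))"
  proof -
    have "(\<integral>x. h (E x) * of_real (gam (cproj E x)) * expi (s \<bullet> x) \<partial>lborel)
      = (\<integral>x. (h (E x) * expi (s \<bullet> E x)) * (of_real (gam (cproj E x)) * expi (s \<bullet> cproj E x)) \<partial>lborel)"
      by (rule Bochner_Integration.integral_cong[OF refl]) (subst e, simp add: mult_ac)
    then show ?thesis
      using lam_factor(2)[OF E i1 i2] by (simp add: gam_lam(2)[OF C] fourier_lam_E[OF E])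
  qed
  show "integrable lborel (\<lambda>x. h (E x) * of_real (gam (cproj E x)))"
    by (rule lam_factor(1)[OF E h gam_lam(1)[OF C]])
qed

text \<open>Inversion on the whole space for the tensor product with a Gaussian: the Gaussian factor
  reappears on the other side and, being nowhere zero, cancels.\<close>

theorem fourier_inversion_lam:
  fixes h :: "'a::euclidean_space \<Rightarrow> complex"
  assumes E: "orth_proj E" and h: "integrable (lam E) h"
    and hh: "integrable (lam E) (\<lambda>s. \<integral>x. h x * expi (s \<bullet> x) \<partial>lam E)"
  shows "AE y in lam E. h y = (\<integral>s. (\<integral>x. h x * expi (s \<bullet> x) \<partial>lam E) * expi (- (s \<bullet> y)) \<partial>lam E)"
proof -
  note C = orth_proj_cproj[OF E]
  have [measurable]: "h \<in> borel_measurable borel" using borel_measurable_integrable[OF h] by simp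
  interpret sigma_finite_measure "lam E" by (rule sigma_finite_lam[OF E])
  define H where "H = (\<lambda>s. \<integral>x. h x * expi (s \<bullet> x) \<partial>lam E)"
  have Hi: "integrable (lam E) H" using hh by (simp add: H_def)
  then have [measurable]: "H \<in> borel_measurable borel" using borel_measurable_integrable by fastforce
  note [measurable] = orth_projD(4)[OF E] cproj_measurable[OF E]
  have F: "(\<integral>x. h (E x) * of_real (gam (cproj E x)) * expi (s \<bullet> x) \<partial>lborel) = H (E s) * of_real (gam (cproj E s))" for s
    unfolding H_def by (rule fourier_lam_extend(1)[OF E h])
  have "AE y in lborel. h (E y) * of_real (gam (cproj E y)) =
     (\<integral>s. H (E s) * of_real (gam (cproj E s)) * expi (- (s \<bullet> y)) \<partial>lborel)"
    using fourier_inversion[OF fourier_lam_extend(2)[OF E h]] lam_factor(1)[OF E Hi gam_lam(1)[OF C]]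
    unfolding F by blast
  moreover have "(\<integral>s. H (E s) * of_real (gam (cproj E s)) * expi (- (s \<bullet> y)) \<partial>lborel)
     = (\<integral>s. H s * expi (- (s \<bullet> E y)) \<partial>lam E) * of_real (gam (cproj E y))" for y
    using fourier_lam_extend(1)[OF E Hi, of "- y"]
      orth_projD(7)[OF E, of y] orth_projD(7)[OF C, of y]
    by (simp add: inner_commute)
  ultimately have "AE y in lborel. h (E y) = (\<integral>s. H s * expi (- (s \<bullet> E y)) \<partial>lam E)"
    by simp
  then have "AE y in lam E. h y = (\<integral>s. H s * expi (- (s \<bullet> y)) \<partial>lam E)"
  proof (subst AE_lam_iff[OF E])
    have [measurable]: "(\<lambda>y. \<integral>s. H s * expi (- (s \<bullet> y)) \<partial>lam E) \<in> borel_measurable borel"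
      by measurable
    show "Measurable.pred borel (\<lambda>y. h y = (\<integral>s. H s * expi (- (s \<bullet> y)) \<partial>lam E))"
      by measurable
  qed simp
  then show ?thesis by (simp only: H_def)
qed

corollary fourier_injective_lam:
  fixes h :: "'a::euclidean_space \<Rightarrow> complex"
  assumes E: "orth_proj E" and h: "integrable (lam E) h"
    and z: "AE s in lam E. (\<integral>x. h x * expi (s \<bullet> x) \<partial>lam E) = 0"
  shows "AE y in lam E. h y = 0"
proof -
  have [measurable]: "h \<in> borel_measurable borel" using borel_measurable_integrable[OF h] by simp
  interpret sigma_finite_measure "lam E" by (rule sigma_finite_lam[OF E])
  have "integrable (lam E) (\<lambda>s. \<integral>x. h x * expi (s \<bullet> x) \<partial>lam E)"
    by (subst integrable_cong_AE[where g="\<lambda>_. 0"]) (use z in auto)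
  from fourier_inversion_lam[OF E h this]
  show ?thesis
  proof eventually_elim
    case (elim y)
    have "(\<integral>s. (\<integral>x. h x * expi (s \<bullet> x) \<partial>lam E) * expi (- (s \<bullet> y)) \<partial>lam E) = (\<integral>s. 0 \<partial>lam E)"
      by (rule integral_cong_AE) (use z in auto)
    with elim show ?case by simp
  qed
qed

text \<open>In the whole-space inequality for the tensor product, both sides carry the squared norm
  \<open>\<kappa>\<close> of the Gaussian over the complement, which is positive and finite and
  cancels.\<close>

theorem fourier_bessel_lam:
  fixes h :: "'a::euclidean_space \<Rightarrow> complex"
  assumes E: "orth_proj E" and h: "integrable (lam E) h"
  shows "(\<integral>\<^sup>+s. ennreal ((cmod (\<integral>x. h x * expi (s \<bullet> x) \<partial>lam E))\<^sup>2) \<partial>lam E) \<le> (\<integral>\<^sup>+x. ennreal ((cmod (h x))\<^sup>2) \<partial>lam E)"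
proof -
  note C = orth_proj_cproj[OF E]
  have [measurable]: "h \<in> borel_measurable borel" using borel_measurable_integrable[OF h] by simp
  interpret sigma_finite_measure "lam E" by (rule sigma_finite_lam[OF E])
  define H where "H = (\<lambda>s. \<integral>x. h x * expi (s \<bullet> x) \<partial>lam E)"
  have [measurable]: "H \<in> borel_measurable borel" unfolding H_def by measurable
  note [measurable] = orth_projD(4)[OF E] cproj_measurable[OF E]
  define \<kappa> where "\<kappa> = (\<integral>\<^sup>+x. ennreal ((gam (x::'a))\<^sup>2) \<partial>lam (cproj E))"
  have k0: "\<kappa> \<noteq> 0"
  proof
    assume "\<kappa> = 0"
    then have "AE x in lam (cproj E). ennreal ((gam x)\<^sup>2) = 0"
      unfolding \<kappa>_def by (subst (asm) nn_integral_0_iff_AE) auto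
    then have "AE x in lborel. ennreal ((gam (cproj E x))\<^sup>2) = 0"
      by (subst (asm) AE_lam_iff[OF C]) auto
    then have "AE x in lborel::'a measure. False" by simp
    then have "ae_filter (lborel::'a measure) = bot" by (simp only: eventually_False)
    then show False by (simp add: ae_filter_eq_bot_iff)
  qed
  have k1: "\<kappa> \<noteq> \<infinity>"
  proof -
    have "\<kappa> \<le> (\<integral>\<^sup>+x. ennreal (cmod (of_real (gam (x::'a)))) \<partial>lam (cproj E))"
      unfolding \<kappa>_def by (intro nn_integral_mono ennreal_leI) (simp add: power2_eq_square mult_left_le)
    also have "\<dots> < \<infinity>" using gam_lam(1)[OF C] by (simp only: integrable_iff_bounded)
    finally show ?thesis by simp
  qed
  have F: "(\<integral>x. h (E x) * of_real (gam (cproj E x)) * expi (s \<bullet> x) \<partial>lborel) = H (E s) * of_real (gam (cproj E s))" for s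
    unfolding H_def by (rule fourier_lam_extend(1)[OF E h])
  have sq: "ennreal ((cmod (a * of_real (gam (cproj E x))))\<^sup>2) = ennreal ((cmod a)\<^sup>2) * ennreal ((gam (cproj E x))\<^sup>2)" for a x
    by (simp add: norm_mult power_mult_distrib ennreal_mult)
  have "(\<integral>\<^sup>+s. ennreal ((cmod (H s))\<^sup>2) \<partial>lam E) * \<kappa>
     \<le> (\<integral>\<^sup>+x. ennreal ((cmod (h x))\<^sup>2) \<partial>lam E) * \<kappa>"
    using fourier_bessel[OF fourier_lam_extend(2)[OF E h]]
    unfolding F sq \<kappa>_def
    by (subst (asm) (1 2) nn_lam_factor[OF E]) auto
  then have "(\<integral>\<^sup>+s. ennreal ((cmod (H s))\<^sup>2) \<partial>lam E) \<le> (\<integral>\<^sup>+x. ennreal ((cmod (h x))\<^sup>2) \<partial>lam E)"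
    using k0 k1 by (simp add: ennreal_mult_le_mult_iff mult.commute[of _ \<kappa>])
  then show ?thesis by (simp only: H_def)
qed

text \<open>A level set of the character is a countable union of hyperplanes, null because
  \<open>a\<close> is nonzero; values off the unit circle are never taken.\<close>

lemma AE_lam_expi_neq:
  assumes E: "orth_proj E" and a: "E a = a" "a \<noteq> 0"
  shows "AE s in lam E. expi (a \<bullet> s) \<noteq> z"
proof (cases "\<exists>\<theta>. z = expi \<theta>")
  case False
  then show ?thesis by (intro AE_I2) metis
next
  case True
  then obtain \<theta> where z: "z = expi \<theta>" by auto
  note [measurable] = orth_projD(4)[OF E]
  have "AE s in lborel. a \<bullet> s \<noteq> \<theta> + real_of_int k" for k :: int
  proof -
    have "negligible {s. a \<bullet> s = \<theta> + real_of_int k}"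
      using a(2) by (intro negligible_hyperplane) auto
    then have "{s. a \<bullet> s = \<theta> + real_of_int k} \<in> null_sets lebesgue" by (simp add: negligible_iff_null_sets)
    then have "{s. a \<bullet> s = \<theta> + real_of_int k} \<in> null_sets lborel" 
      by (subst (asm) null_sets_completion_iff) auto
    from AE_not_in[OF this] show ?thesis by auto
  qed
  then have ae: "AE s in lborel. \<forall>k::int. a \<bullet> s \<noteq> \<theta> + real_of_int k"
    by (simp only: AE_all_countable) blast
  have "AE s in lborel. expi (a \<bullet> E s) \<noteq> z"
    using ae
  proof eventually_elim
    case (elim s)
    have "a \<bullet> E s = a \<bullet> s" using orth_projD(3)[OF E, of a s] a by simp
    moreover have "expi (a \<bullet> s) \<noteq> expi \<theta>"
    proof
      assume "expi (a \<bullet> s) = expi \<theta>"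
      then have "cis (2 * pi * (a \<bullet> s - \<theta>)) = 1"
        by (simp add: expi_def right_diff_distrib flip: cis_divide)
      then have "cos (2 * pi * (a \<bullet> s - \<theta>)) = 1" by (simp add: complex_eq_iff)
      then obtain k :: int where "2 * pi * (a \<bullet> s - \<theta>) = of_int k * 2 * pi"
        by (auto simp: cos_one_2pi_int)
      then have "a \<bullet> s = \<theta> + real_of_int k" by simp
      with elim show False by blast
    qed
    ultimately show ?case by (simp add: z)
  qed
  then show ?thesis by (subst AE_lam_iff[OF E]) measurable
qed

section \<open>Orthonormal systems and translates of sets of finite measure\<close>

text \<open>Square integrability for an arbitrary measure, as both \<open>lborel\<close> and the
  measures \<open>lam E\<close> occur; for Borel functions and \<open>lborel\<close> it agrees with
  membership in \<open>L2\<close>.\<close>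

definition sqi :: "'a measure \<Rightarrow> ('a \<Rightarrow> complex) \<Rightarrow> bool" where
  "sqi M f \<longleftrightarrow> f \<in> borel_measurable M \<and> integrable M (\<lambda>x. (cmod (f x))\<^sup>2)"

lemma sqi_measurable: "sqi M f \<Longrightarrow> f \<in> borel_measurable M"
  by (simp add: sqi_def)

lemma sqi_mult_integrable:
  assumes f: "sqi M f" and g: "sqi M g"
  shows "integrable M (\<lambda>x. f x * g x)"
proof (rule Bochner_Integration.integrable_bound)
  show "integrable M (\<lambda>x. (cmod (f x))\<^sup>2 + (cmod (g x))\<^sup>2)"
    using f g by (auto simp: sqi_def)
  show "(\<lambda>x. f x * g x) \<in> borel_measurable M"
    using f g by (auto simp: sqi_def)
  show "AE x in M. norm (f x * g x) \<le> norm ((cmod (f x))\<^sup>2 + (cmod (g x))\<^sup>2)"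
  proof (rule AE_I2)
    fix x
    show "norm (f x * g x) \<le> norm ((cmod (f x))\<^sup>2 + (cmod (g x))\<^sup>2)"
      using sum_squares_bound[of "cmod (f x)" "cmod (g x)"]
        mult_nonneg_nonneg[OF norm_ge_zero[of "f x"] norm_ge_zero[of "g x"]]
      unfolding norm_mult real_norm_def by linarith
  qed
qed

lemma sqi_bounded_mult:
  assumes f: "sqi M f" and g[measurable]: "g \<in> borel_measurable M" and b: "\<And>x. cmod (g x) \<le> C"
  shows "sqi M (\<lambda>x. g x * f x)"
  unfolding sqi_def
proof
  show "(\<lambda>x. g x * f x) \<in> borel_measurable M" using f by (auto simp: sqi_def)
  show "integrable M (\<lambda>x. (cmod (g x * f x))\<^sup>2)"
  proof (rule Bochner_Integration.integrable_bound)
    show "integrable M (\<lambda>x. C\<^sup>2 * (cmod (f x))\<^sup>2)" using f by (auto simp: sqi_def)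
    show "(\<lambda>x. (cmod (g x * f x))\<^sup>2) \<in> borel_measurable M" using f by (auto simp: sqi_def)
    show "AE x in M. norm ((cmod (g x * f x))\<^sup>2) \<le> norm (C\<^sup>2 * (cmod (f x))\<^sup>2)"
      using b by (auto intro!: AE_I2 mult_right_mono power_mono simp: norm_mult power_mult_distrib)
  qed
qed

lemma sqi_cnj: "sqi M f \<Longrightarrow> sqi M (\<lambda>x. cnj (f x))"
  by (auto simp: sqi_def)

lemma sqi_add:
  assumes f: "sqi M f" and g: "sqi M g"
  shows "sqi M (\<lambda>x. f x + g x)"
  unfolding sqi_def
proof
  have [measurable]: "f \<in> borel_measurable M" "g \<in> borel_measurable M" using f g by (auto simp: sqi_def)
  show "(\<lambda>x. f x + g x) \<in> borel_measurable M" by measurable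
  show "integrable M (\<lambda>x. (cmod (f x + g x))\<^sup>2)"
  proof (rule Bochner_Integration.integrable_bound)
    show "integrable M (\<lambda>x. 2 * (cmod (f x))\<^sup>2 + 2 * (cmod (g x))\<^sup>2)"
      using f g by (auto simp: sqi_def)
    show "AE x in M. norm ((cmod (f x + g x))\<^sup>2) \<le> norm (2 * (cmod (f x))\<^sup>2 + 2 * (cmod (g x))\<^sup>2)"
    proof (rule AE_I2)
      fix x
      have "(cmod (f x + g x))\<^sup>2 \<le> (cmod (f x) + cmod (g x))\<^sup>2"
        by (intro power_mono norm_triangle_ineq) auto
      also have "\<dots> \<le> 2 * (cmod (f x))\<^sup>2 + 2 * (cmod (g x))\<^sup>2"
        using sum_squares_bound[of "cmod (f x)" "cmod (g x)"] by (simp add: power2_sum)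
      finally show "norm ((cmod (f x + g x))\<^sup>2) \<le> norm (2 * (cmod (f x))\<^sup>2 + 2 * (cmod (g x))\<^sup>2)" by simp
    qed
  qed measurable
qed

lemma sqi_cmult: "sqi M f \<Longrightarrow> sqi M (\<lambda>x. c * f x)"
  using sqi_bounded_mult[of M f "\<lambda>_. c" "cmod c"] by simp

lemma sqi_sum: "finite A \<Longrightarrow> (\<And>k. k \<in> A \<Longrightarrow> sqi M (f k)) \<Longrightarrow> sqi M (\<lambda>x. \<Sum>k\<in>A. f k x)"
  by (induction A rule: finite_induct) (auto intro!: sqi_add, simp add: sqi_def)

text \<open>The pairing is bilinear, so the orthonormal system effectively in use is that of the
  conjugates of \<open>u k\<close>: the projection of \<open>w\<close> is the conjugate of
  \<open>S\<close>, and the claim is that the squared norm of the remainder is nonnegative.\<close>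

lemma bessel_orthonormal:
  fixes u :: "nat \<Rightarrow> 'a \<Rightarrow> complex"
  assumes u: "\<And>k. k < N \<Longrightarrow> sqi M (u k)" and w: "sqi M w"
    and on: "\<And>j k. j < N \<Longrightarrow> k < N \<Longrightarrow> (\<integral>x. u j x * cnj (u k x) \<partial>M) = (if j = k then 1 else 0)"
  shows "(\<Sum>k<N. (cmod (\<integral>x. u k x * w x \<partial>M))\<^sup>2) \<le> (\<integral>x. (cmod (w x))\<^sup>2 \<partial>M)"
proof -
  define c where "c = (\<lambda>k. \<integral>x. u k x * w x \<partial>M)"
  define S where "S = (\<lambda>x. \<Sum>k<N. cnj (c k) * u k x)"
  have sS: "sqi M S"
    unfolding S_def by (intro sqi_sum sqi_cmult u) auto
  have uw: "integrable M (\<lambda>x. u k x * w x)" if "k < N" for k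
    using sqi_mult_integrable[OF u[OF that] w] .
  have uu: "integrable M (\<lambda>x. u j x * cnj (u k x))" if "j < N" "k < N" for j k
    using sqi_mult_integrable[OF u[OF that(1)] sqi_cnj[OF u[OF that(2)]]] .
  have 1: "(\<integral>x. S x * w x \<partial>M) = of_real (\<Sum>k<N. (cmod (c k))\<^sup>2)"
  proof -
    have "(\<integral>x. S x * w x \<partial>M) = (\<integral>x. (\<Sum>k<N. cnj (c k) * (u k x * w x)) \<partial>M)"
      by (simp add: S_def sum_distrib_right mult.assoc)
    also have "\<dots> = (\<Sum>k<N. cnj (c k) * c k)"
      using uw by (subst Bochner_Integration.integral_sum) (auto simp: c_def)
    finally show ?thesis by (simp add: complex_norm_square mult.commute del: of_real_power)
  qed
  have 2: "(\<integral>x. S x * cnj (S x) \<partial>M) = of_real (\<Sum>k<N. (cmod (c k))\<^sup>2)"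
  proof -
    have "(\<integral>x. S x * cnj (S x) \<partial>M) = (\<integral>x. (\<Sum>j<N. \<Sum>k<N. cnj (c j) * c k * (u j x * cnj (u k x))) \<partial>M)"
    proof (rule Bochner_Integration.integral_cong[OF refl])
      fix x
      show "S x * cnj (S x) = (\<Sum>j<N. \<Sum>k<N. cnj (c j) * c k * (u j x * cnj (u k x)))"
        unfolding S_def cnj_sum sum_product by (intro sum.cong refl) simp
    qed
    also have "\<dots> = (\<Sum>j<N. \<Sum>k<N. cnj (c j) * c k * (\<integral>x. u j x * cnj (u k x) \<partial>M))"
      using uu by (subst Bochner_Integration.integral_sum) (auto intro!: sum.cong)
    also have "\<dots> = (\<Sum>j<N. \<Sum>k<N. if j = k then cnj (c j) * c k else 0)"
      by (intro sum.cong refl) (auto simp: on)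
    also have "\<dots> = (\<Sum>j<N. cnj (c j) * c j)"
      by (simp add: sum.delta)
    finally show ?thesis by (simp add: complex_norm_square mult.commute del: of_real_power)
  qed
  have sw: "integrable M (\<lambda>x. S x * w x)" and ss: "integrable M (\<lambda>x. S x * cnj (S x))"
    and ww: "integrable M (\<lambda>x. w x * cnj (w x))"
    using sS w by (auto intro!: sqi_mult_integrable sqi_cnj)
  have "complex_of_real (\<integral>x. (cmod (w x - cnj (S x)))\<^sup>2 \<partial>M)
     = (\<integral>x. w x * cnj (w x) - S x * w x - cnj (S x * w x) + S x * cnj (S x) \<partial>M)"
    by (subst integral_complex_of_real[symmetric])
       (auto intro!: Bochner_Integration.integral_cong simp: complex_norm_square algebra_simps simp del: of_real_power)
  also have "\<dots> = (\<integral>x. w x * cnj (w x) \<partial>M) - (\<integral>x. S x * w x \<partial>M) - cnj (\<integral>x. S x * w x \<partial>M) + (\<integral>x. S x * cnj (S x) \<partial>M)"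
    using sw ss ww integrable_cnj[OF sw]
    by (simp del: complex_cnj_mult)
  also have "(\<integral>x. w x * cnj (w x) \<partial>M) = complex_of_real (\<integral>x. (cmod (w x))\<^sup>2 \<partial>M)"
    by (subst integral_complex_of_real[symmetric])
       (auto intro!: Bochner_Integration.integral_cong simp: complex_norm_square simp del: of_real_power)
  finally have "complex_of_real (\<integral>x. (cmod (w x - cnj (S x)))\<^sup>2 \<partial>M)
     = complex_of_real ((\<integral>x. (cmod (w x))\<^sup>2 \<partial>M) - (\<Sum>k<N. (cmod (c k))\<^sup>2))"
    unfolding 1 2 by simp
  then have "(\<integral>x. (cmod (w x - cnj (S x)))\<^sup>2 \<partial>M) = (\<integral>x. (cmod (w x))\<^sup>2 \<partial>M) - (\<Sum>k<N. (cmod (c k))\<^sup>2)"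
    by (simp only: of_real_eq_iff)
  moreover have "0 \<le> (\<integral>x. (cmod (w x - cnj (S x)))\<^sup>2 \<partial>M)"
    by (rule integral_nonneg_AE) simp
  ultimately show ?thesis by (simp add: c_def)
qed

text \<open>The form is abstract so that the induction uses its laws alone. The degree bound is the
  point of the construction: it limits how many translates the k-th polynomial will call
  for.\<close>

lemma gram_schmidt_poly:
  fixes ip :: "complex poly \<Rightarrow> complex poly \<Rightarrow> complex"
  assumes add: "\<And>p q r. ip (p + q) r = ip p r + ip q r"
    and scale: "\<And>c p r. ip (smult c p) r = c * ip p r"
    and herm: "\<And>p q. ip q p = cnj (ip p q)"
    and pos: "\<And>p. p \<noteq> 0 \<Longrightarrow> 0 < Re (ip p p)"
  shows "\<exists>p. (\<forall>k<N. degree (p k) \<le> k) \<and> (\<forall>j<N. \<forall>k<N. ip (p j) (p k) = (if j = k then 1 else 0))"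
proof (induction N)
  case 0
  then show ?case by auto
next
  case (Suc N)
  then obtain p where deg: "\<And>k. k < N \<Longrightarrow> degree (p k) \<le> k"
    and on: "\<And>j k. j < N \<Longrightarrow> k < N \<Longrightarrow> ip (p j) (p k) = (if j = k then 1 else 0)" by blast
  have ip0: "ip 0 r = 0" for r using scale[of 0 0 r] by simp
  have ipneg: "ip (- p) r = - ip p r" for p r using scale[of "-1" p r] by simp
  have ipsum: "ip (\<Sum>k\<in>A. f k) r = (\<Sum>k\<in>A. ip (f k) r)" if "finite A" for A :: "nat set" and f r
    using that by (induction A rule: finite_induct) (auto simp: ip0 add)
  \<comment> \<open>The earlier polynomials have degree below N, so the coefficient of X^N survives
    the orthogonalisation; hence \<open>r\<close> is nonzero and can be normalised.\<close>
  define m where "m = (monom 1 N :: complex poly)"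
  define r where "r = m + (\<Sum>k<N. smult (- ip m (p k)) (p k))"
  have orth: "ip r (p j) = 0" if "j < N" for j
  proof -
    have "ip r (p j) = ip m (p j) + (\<Sum>k<N. - ip m (p k) * (if k = j then 1 else 0))"
      unfolding r_def using that by (auto simp: add ipsum ipneg scale on intro!: sum.cong)
    also have "\<dots> = 0" using that by (simp add: if_distrib cong: if_cong)
    finally show ?thesis .
  qed
  have "coeff r N = 1"
  proof -
    have "coeff (p k) N = 0" if "k < N" for k
      using deg[OF that] that by (intro coeff_eq_0) auto
    then show ?thesis by (simp add: r_def m_def coeff_sum)
  qed
  then have "r \<noteq> 0" by auto
  have degp: "degree (p k) \<le> N" if "k < N" for k
    using deg[OF that] that by linarith
  have degr: "degree r \<le> N"
    unfolding r_def m_def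
    by (intro degree_add_le degree_sum_le) (auto simp: degree_monom_le degp)
  define c where "c = Re (ip r r)"
  have c: "c > 0" "ip r r = of_real c"
    using pos[OF \<open>r \<noteq> 0\<close>] herm[of r r] by (auto simp: c_def complex_eq_iff)
  define q where "q = smult (of_real (1 / sqrt c)) r"
  have scale': "ip p' (smult d r') = cnj d * ip p' r'" for d p' r'
  proof -
    have "ip p' (smult d r') = cnj (ip (smult d r') p')" by (rule herm)
    also have "\<dots> = cnj d * cnj (ip r' p')" by (simp add: scale)
    also have "cnj (ip r' p') = ip p' r'" by (rule herm[symmetric])
    finally show ?thesis .
  qed
  have qq: "ip q q = 1"
  proof -
    have "ip q q = of_real (1 / sqrt c) * (of_real (1 / sqrt c) * of_real c)"
      unfolding q_def by (simp only: scale scale' c complex_cnj_complex_of_real)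
    also have "\<dots> = of_real (1 / sqrt c * (1 / sqrt c * c))" by (simp only: of_real_mult)
    also have "1 / sqrt c * (1 / sqrt c * c) = 1" using c(1) by (simp add: field_simps)
    finally show ?thesis by simp
  qed
  have qp: "ip q (p j) = 0" "ip (p j) q = 0" if "j < N" for j
    using orth[OF that] herm[of q "p j"] by (auto simp: q_def scale)
  show ?case
  proof (intro exI[of _ "p(N := q)"] conjI allI impI)
    fix k assume "k < Suc N"
    then show "degree ((p(N := q)) k) \<le> k"
      using deg degr degree_smult_le[of _ r] by (auto simp: q_def less_Suc_eq)
  next
    fix j k assume "j < Suc N" "k < Suc N"
    then show "ip ((p(N := q)) j) ((p(N := q)) k) = (if j = k then 1 else 0)"
      using on qq qp by (auto simp: less_Suc_eq)
  qed
qed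

section \<open>Translates of a set of finite measure\<close>

lemma shift_sets[measurable]:
  fixes T :: "('a::euclidean_space \<times> 'a) set"
  assumes [measurable]: "T \<in> sets (borel \<Otimes>\<^sub>M borel)"
  shows "{p. (fst p - a, snd p) \<in> T} \<in> sets (borel \<Otimes>\<^sub>M borel)"
proof -
  have "(\<lambda>p. (fst p - a, snd p)) -` T \<inter> space (borel \<Otimes>\<^sub>M borel) \<in> sets (borel \<Otimes>\<^sub>M (borel::'a measure))"
    by (rule measurable_sets) measurable
  then show ?thesis by (simp add: vimage_def space_pair_measure)
qed

context
  fixes E :: "'a::euclidean_space \<Rightarrow> 'a"
  assumes E: "orth_proj E"
  notes [measurable] = orth_projD(4)[OF E] cproj_measurable[OF E]
begin

interpretation sE: sigma_finite_measure "lam E"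
  by (rule sigma_finite_lam[OF E])

interpretation pE: pair_sigma_finite "lam E" "lam E"
  by (intro pair_sigma_finite.intro sigma_finite_lam E)

lemma emeasure_shift:
  assumes a: "E a = a" and [measurable]: "T \<in> sets (borel \<Otimes>\<^sub>M borel)"
  shows "emeasure (lam E \<Otimes>\<^sub>M lam E) {p. (fst p - a, snd p) \<in> T} = emeasure (lam E \<Otimes>\<^sub>M lam E) T"
proof -
  have "emeasure (lam E \<Otimes>\<^sub>M lam E) {p. (fst p - a, snd p) \<in> T}
     = (\<integral>\<^sup>+p. indicator {p. (fst p - a, snd p) \<in> T} p \<partial>(lam E \<Otimes>\<^sub>M lam E))"
    by (rule nn_integral_indicator[symmetric]) measurable
  also have "\<dots> = (\<integral>\<^sup>+p. indicator T (fst p - a, snd p) \<partial>(lam E \<Otimes>\<^sub>M lam E))"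
    by (intro nn_integral_cong) (simp add: indicator_def)
  also have "\<dots> = (\<integral>\<^sup>+y. \<integral>\<^sup>+x. indicator T (x - a, y) \<partial>lam E \<partial>lam E)"
    by (subst pE.nn_integral_snd[symmetric]) auto
  also have "\<dots> = (\<integral>\<^sup>+y. \<integral>\<^sup>+x. indicator T (x, y) \<partial>lam E \<partial>lam E)"
    by (intro nn_integral_cong nn_integral_lam_affine(2)[OF E _ a]) measurable
  also have "\<dots> = (\<integral>\<^sup>+p. indicator T p \<partial>(lam E \<Otimes>\<^sub>M lam E))"
    by (subst pE.nn_integral_snd[symmetric]) auto
  also have "\<dots> = emeasure (lam E \<Otimes>\<^sub>M lam E) T"
    by (subst nn_integral_indicator) auto
  finally show ?thesis .
qed

text \<open>A point outside the closed set \<open>K\<close> has a neighbourhood outside it, so along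
  the shrinking shifts it eventually leaves the difference set; the product of balls
  \<open>?B\<close> is a majorant of finite measure.\<close>

lemma emeasure_compact_shift_tendsto:
  fixes K :: "('a \<times> 'a) set"
  assumes K: "compact K"
  shows "(\<lambda>n. emeasure (lam E \<Otimes>\<^sub>M lam E) ({p. (fst p - a /\<^sub>R real (Suc n), snd p) \<in> K} - K)) \<longlonglongrightarrow> 0"
proof -
  have sb: "sets (borel \<Otimes>\<^sub>M borel) = sets (borel :: ('a \<times> 'a) measure)" by (rule arg_cong[OF borel_prod])
  have [measurable]: "K \<in> sets (borel \<Otimes>\<^sub>M borel)"
    unfolding sb using K by (simp add: borel_compact)
  let ?M = "lam E \<Otimes>\<^sub>M lam E"
  obtain R where R: "\<And>p. p \<in> K \<Longrightarrow> norm p \<le> R"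
    using compact_imp_bounded[OF K] by (auto simp: bounded_iff)
  let ?B = "cball (0::'a) (R + norm a) \<times> cball (0::'a) (R + norm a)"
  have [measurable]: "?B \<in> sets (borel \<Otimes>\<^sub>M borel)" by (intro pair_measureI) auto
  let ?S = "\<lambda>n. {p. (fst p - a /\<^sub>R real (Suc n), snd p) \<in> K} - K"
  have [measurable]: "?S n \<in> sets ?M" for n by measurable
  have sub: "?S n \<subseteq> ?B" for n
  proof
    fix p assume "p \<in> ?S n"
    then have "norm (fst p - a /\<^sub>R real (Suc n), snd p) \<le> R" using R by auto
    then have 1: "norm (fst p - a /\<^sub>R real (Suc n)) \<le> R" "norm (snd p) \<le> R"
      using norm_fst_le[of "fst p - a /\<^sub>R real (Suc n)" "snd p"] norm_snd_le[of "snd p" "fst p - a /\<^sub>R real (Suc n)"] by auto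
    have "norm (a /\<^sub>R real (Suc n)) \<le> norm a" by (simp add: field_simps mult_left_le)
    with 1 have "norm (fst p) \<le> R + norm a" "norm (snd p) \<le> R + norm a"
      using norm_triangle_sub[of "fst p" "a /\<^sub>R real (Suc n)"] norm_ge_zero[of a] by linarith+
    then show "p \<in> ?B" by (auto simp: mem_Times_iff)
  qed
  have fin: "emeasure ?M ?B < \<infinity>"
    by (subst sE.emeasure_pair_measure_Times) (auto simp: ennreal_mult_less_top emeasure_lam_cball[OF E, simplified])
  have "(\<lambda>n. \<integral>\<^sup>+p. indicator (?S n) p \<partial>?M) \<longlonglongrightarrow> (\<integral>\<^sup>+p. 0 \<partial>?M)"
  proof (rule nn_integral_dominated_convergence[where w="indicator ?B"])
    show "AE p in ?M. (\<lambda>n. indicator (?S n) p :: ennreal) \<longlonglongrightarrow> 0"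
    proof (rule AE_I2)
      fix p :: "'a \<times> 'a"
      have "(\<lambda>m. inverse (real (Suc m))) \<longlonglongrightarrow> 0" by (rule LIMSEQ_inverse_real_of_nat)
      then have "(\<lambda>m. (fst p - inverse (real (Suc m)) *\<^sub>R a, snd p)) \<longlonglongrightarrow> (fst p - 0 *\<^sub>R a, snd p)"
        by (intro tendsto_intros)
      then have l: "(\<lambda>m. (fst p - a /\<^sub>R real (Suc m), snd p)) \<longlonglongrightarrow> p" by simp
      have "\<forall>\<^sub>F n in sequentially. indicator (?S n) p = (0::ennreal)"
      proof (cases "p \<in> K")
        case False
        then have "p \<in> - K" by simp
        from topological_tendstoD[OF l _ this] K
        have "\<forall>\<^sub>F n in sequentially. (fst p - a /\<^sub>R real (Suc n), snd p) \<in> - K"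
          by (auto simp: compact_imp_closed open_Compl)
        then show ?thesis by eventually_elim auto
      qed auto
      then show "(\<lambda>n. indicator (?S n) p :: ennreal) \<longlonglongrightarrow> 0" by (rule tendsto_eventually)
    qed
    show "AE p in ?M. indicator (?S j) p \<le> (indicator ?B p :: ennreal)" for j
      using sub[of j] by (auto simp: indicator_def)
    show "(\<integral>\<^sup>+p. indicator ?B p \<partial>?M) < \<infinity>"
      using fin by (subst nn_integral_indicator) auto
  qed measurable
  then show ?thesis by simp
qed

text \<open>Continuity of translation by approximation from inside: outside a compact
  \<open>K\<close> of nearly full measure the shift costs at most the measure of T - K, and for
  \<open>K\<close> itself small multiples of \<open>a0\<close> cost little.\<close>

lemma small_shift:
  assumes T[measurable]: "T \<in> sets (borel \<Otimes>\<^sub>M borel)" and fin: "emeasure (lam E \<Otimes>\<^sub>M lam E) T < \<infinity>"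
    and a0: "E a0 = a0" "a0 \<noteq> 0" and e: "(e::real) > 0"
  shows "\<exists>a. E a = a \<and> a \<noteq> 0 \<and> emeasure (lam E \<Otimes>\<^sub>M lam E) ({p. (fst p - a, snd p) \<in> T} - T) \<le> ennreal e"
proof -
  let ?M = "lam E \<Otimes>\<^sub>M lam E"
  have sb: "sets (borel \<Otimes>\<^sub>M borel) = sets (borel :: ('a \<times> 'a) measure)" by (rule arg_cong[OF borel_prod])
  \<comment> \<open>Restriction to \<open>T\<close> makes the measure finite, and the image under
    the identity moves it from the product of two Borel algebras to the Borel algebra of the
    product, the form that \<open>inner_regular\<close> takes.\<close>
  define N where "N = distr (density ?M (indicator T)) borel (\<lambda>p. p)"
  have id[measurable]: "(\<lambda>p. p) \<in> measurable (density ?M (indicator T)) (borel :: ('a \<times> 'a) measure)"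
    by (simp add: measurable_def sets_pair_measure_cong[OF sets_lam sets_lam] space_pair_measure sb)
  have eN: "emeasure N A = emeasure ?M (A \<inter> T)" if A: "A \<in> sets borel" for A
  proof -
    have [measurable]: "A \<in> sets (borel \<Otimes>\<^sub>M borel)" using A sb by simp
    have "emeasure N A = emeasure (density ?M (indicator T)) A"
      unfolding N_def using A by (subst emeasure_distr[OF id]) (auto simp: space_pair_measure)
    also have "\<dots> = emeasure ?M (A \<inter> T)"
      by (subst emeasure_density) (auto simp: Int_commute simp flip: nn_integral_indicator indicator_inter_arith intro!: nn_integral_cong)
    finally show ?thesis .
  qed
  have T': "T \<in> sets borel" using T sb by simp
  have "emeasure N T = (SUP K \<in> {K. K \<subseteq> T \<and> compact K}. emeasure N K)"
    by (rule inner_regular) (use eN[of UNIV] fin T' in \<open>auto simp: N_def\<close>)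
  then have sup: "emeasure ?M T = (SUP K \<in> {K. K \<subseteq> T \<and> compact K}. emeasure N K)"
    using eN[OF T'] by simp
  have "\<exists>K\<in>{K. K \<subseteq> T \<and> compact K}. emeasure ?M T < emeasure N K + ennreal (e/2)"
  proof (rule ccontr)
    assume "\<not> ?thesis"
    then have le: "emeasure N K + ennreal (e/2) \<le> emeasure ?M T" if "K \<subseteq> T" "compact K" for K
      using that by (auto simp: not_less)
    have "(SUP K \<in> {K. K \<subseteq> T \<and> compact K}. emeasure N K) + ennreal (e/2) \<le> emeasure ?M T"
      by (subst ennreal_SUP_add_left[symmetric]) (auto intro!: SUP_least le)
    then have "emeasure ?M T + ennreal (e/2) \<le> emeasure ?M T"
      using sup by simp
    then show False using fin e by (cases "emeasure ?M T") (auto simp flip: ennreal_plus)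
  qed
  then obtain K where K: "K \<subseteq> T" "compact K" "emeasure ?M T < emeasure N K + ennreal (e/2)" by auto
  have KM[measurable]: "K \<in> sets (borel \<Otimes>\<^sub>M borel)" using K(2) sb by (simp add: borel_compact)
  have eK: "emeasure N K = emeasure ?M K"
    using eN[of K] K by (simp add: borel_compact Int_absorb2)
  have TK: "emeasure ?M (T - K) \<le> ennreal (e/2)"
  proof -
    have "emeasure ?M K \<le> emeasure ?M T" using K(1) by (intro emeasure_mono) measurable
    then have fK: "emeasure ?M K < \<infinity>" using fin by auto
    have "emeasure ?M (T - K) = emeasure ?M T - emeasure ?M K"
      using fK K(1) by (intro emeasure_Diff) auto
    also have "\<dots> \<le> ennreal (e/2)"
      using K(3) fK unfolding eK by (auto simp: ennreal_minus_le_iff add.commute less_imp_le)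
    finally show ?thesis .
  qed
  have "\<forall>\<^sub>F n in sequentially. emeasure ?M ({p. (fst p - a0 /\<^sub>R real (Suc n), snd p) \<in> K} - K) < ennreal (e/2)"
    using order_tendstoD(2)[OF emeasure_compact_shift_tendsto[OF K(2), of a0], of "ennreal (e/2)"] e by simp
  then obtain n where n: "emeasure ?M ({p. (fst p - a0 /\<^sub>R real (Suc n), snd p) \<in> K} - K) < ennreal (e/2)"
    by (auto simp: eventually_sequentially)
  define a where "a = a0 /\<^sub>R real (Suc n)"
  have a: "E a = a" "a \<noteq> 0" using a0 by (auto simp: a_def orth_projD[OF E])
  \<comment> \<open>A point of the shifted \<open>T\<close> outside \<open>T\<close> comes from the
    shifted T - K, or from the shifted \<open>K\<close>, and then it lies outside
    \<open>K\<close>.\<close>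
  have "emeasure ?M ({p. (fst p - a, snd p) \<in> T} - T)
     \<le> emeasure ?M ({p. (fst p - a, snd p) \<in> T - K} \<union> ({p. (fst p - a, snd p) \<in> K} - K))"
  proof (rule emeasure_mono)
    show "{p. (fst p - a, snd p) \<in> T - K} \<union> ({p. (fst p - a, snd p) \<in> K} - K) \<in> sets ?M"
      by (intro sets.Un) measurable
  qed (use K(1) in auto)
  also have "\<dots> \<le> emeasure ?M {p. (fst p - a, snd p) \<in> T - K} + emeasure ?M ({p. (fst p - a, snd p) \<in> K} - K)"
    by (rule emeasure_subadditive) measurable
  also have "emeasure ?M {p. (fst p - a, snd p) \<in> T - K} = emeasure ?M (T - K)"
    by (rule emeasure_shift[OF a(1)]) measurable
  also have "emeasure ?M (T - K) + emeasure ?M ({p. (fst p - a, snd p) \<in> K} - K) \<le> ennreal (e/2) + ennreal (e/2)"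
    using TK n by (intro add_mono) (auto simp: a_def)
  also have "\<dots> = ennreal e" using e by (simp flip: ennreal_plus)
  finally show ?thesis using a by blast
qed

text \<open>By translation invariance each further translate exceeds its predecessor by a copy of
  the first excess, so the union grows at most linearly.\<close>

lemma emeasure_shifts_le:
  assumes T[measurable]: "T \<in> sets (borel \<Otimes>\<^sub>M borel)" and a: "E a = a"
    and d: "emeasure (lam E \<Otimes>\<^sub>M lam E) ({p. (fst p - a, snd p) \<in> T} - T) \<le> d"
  shows "emeasure (lam E \<Otimes>\<^sub>M lam E) (\<Union>k\<le>n. {p. (fst p - real k *\<^sub>R a, snd p) \<in> T})
     \<le> emeasure (lam E \<Otimes>\<^sub>M lam E) T + of_nat n * d"
proof (induction n)
  case 0
  have "{p. (fst p - real 0 *\<^sub>R a, snd p) \<in> T} = T" by auto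
  then show ?case by simp
next
  case (Suc n)
  let ?M = "lam E \<Otimes>\<^sub>M lam E"
  let ?T = "\<lambda>k. {p. (fst p - real k *\<^sub>R a, snd p) \<in> T}"
  have [measurable]: "?T k \<in> sets ?M" for k by measurable
  have ka: "E (real n *\<^sub>R a) = real n *\<^sub>R a" using a by (simp add: orth_projD[OF E])
  have "emeasure ?M (\<Union>k\<le>Suc n. ?T k) \<le> emeasure ?M ((\<Union>k\<le>n. ?T k) \<union> (?T (Suc n) - ?T n))"
    by (intro emeasure_mono) (auto simp: atMost_Suc)
  also have "\<dots> \<le> emeasure ?M (\<Union>k\<le>n. ?T k) + emeasure ?M (?T (Suc n) - ?T n)"
    by (rule emeasure_subadditive) auto
  also have "?T (Suc n) - ?T n = {p. (fst p - real n *\<^sub>R a, snd p) \<in> {p. (fst p - a, snd p) \<in> T} - T}"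
    by (auto simp: algebra_simps)
  also have "emeasure ?M \<dots> = emeasure ?M ({p. (fst p - a, snd p) \<in> T} - T)"
    by (rule emeasure_shift[OF ka]) measurable
  also have "emeasure ?M (\<Union>k\<le>n. ?T k) + emeasure ?M ({p. (fst p - a, snd p) \<in> T} - T)
     \<le> (emeasure ?M T + of_nat n * d) + d"
    by (intro add_mono Suc d)
  also have "\<dots> = emeasure ?M T + of_nat (Suc n) * d"
    by (simp add: distrib_right add_ac)
  finally show ?case .
qed

end

section \<open>Short-time Fourier transforms of finite support\<close>

context
  fixes E :: "'a::euclidean_space \<Rightarrow> 'a"
  assumes E: "orth_proj E"
  notes [measurable] = orth_projD(4)[OF E] cproj_measurable[OF E]
begin

interpretation sE: sigma_finite_measure "lam E"
  by (rule sigma_finite_lam[OF E])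

interpretation pE: pair_sigma_finite "lam E" "lam E"
  by (intro pair_sigma_finite.intro sigma_finite_lam E)

text \<open>Gram-Schmidt for modulated copies of \<alpha>. The form is positive definite because a
  nonzero polynomial has finitely many roots and \<open>expi (a \<bullet> s)\<close> avoids them for
  almost every \<open>s\<close>. Powers of this character are used because they correspond to
  translations by multiples of \<open>a\<close>.\<close>

lemma orthonormal_trig_polys:
  assumes a: "E a = a" "a \<noteq> 0" and \<alpha>: "sqi (lam E) \<alpha>" "\<not> (AE s in lam E. \<alpha> s = 0)"
  shows "\<exists>p. (\<forall>k<N. degree (p k) \<le> k) \<and> (\<forall>j<N. \<forall>k<N.
    (\<integral>s. (poly (p j) (expi (a \<bullet> s)) * \<alpha> s) * cnj (poly (p k) (expi (a \<bullet> s)) * \<alpha> s) \<partial>lam E) = (if j = k then 1 else 0))"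
    and "sqi (lam E) (\<lambda>s. poly p (expi (a \<bullet> s)) * \<alpha> s)"
proof -
  define u where "u = (\<lambda>p s. poly p (expi (a \<bullet> s)) * \<alpha> s)"
  have [measurable]: "\<alpha> \<in> borel_measurable borel" using sqi_measurable[OF \<alpha>(1)] by simp
  have su: "sqi (lam E) (u p)" for p
    unfolding u_def
  proof (rule sqi_bounded_mult[OF \<alpha>(1)])
    have "poly p \<in> borel_measurable borel" by (intro borel_measurable_continuous_onI continuous_intros)
    then show "(\<lambda>s. poly p (expi (a \<bullet> s))) \<in> borel_measurable (lam E)" by measurable
    show "cmod (poly p (expi (a \<bullet> s))) \<le> (\<Sum>i\<le>degree p. cmod (coeff p i))" for s
      unfolding poly_altdef by (rule order_trans[OF norm_sum]) (simp add: norm_mult norm_power)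
  qed
  from su show "sqi (lam E) (\<lambda>s. poly p (expi (a \<bullet> s)) * \<alpha> s)" unfolding u_def .
  have int: "integrable (lam E) (\<lambda>s. u p s * cnj (u q s))" for p q
    by (intro sqi_mult_integrable sqi_cnj su)
  have "\<exists>p. (\<forall>k<N. degree (p k) \<le> k) \<and> (\<forall>j<N. \<forall>k<N. (\<integral>s. u (p j) s * cnj (u (p k) s) \<partial>lam E) = (if j = k then 1 else 0))"
  proof (rule gram_schmidt_poly[where ip="\<lambda>p q. \<integral>s. u p s * cnj (u q s) \<partial>lam E"])
    fix p q r :: "complex poly" and c
    have "u (p + q) s * cnj (u r s) = u p s * cnj (u r s) + u q s * cnj (u r s)" for s
      by (simp add: u_def distrib_right)
    then show "(\<integral>s. u (p + q) s * cnj (u r s) \<partial>lam E) = (\<integral>s. u p s * cnj (u r s) \<partial>lam E) + (\<integral>s. u q s * cnj (u r s) \<partial>lam E)"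
      using int by simp
    have "u (smult c p) s * cnj (u r s) = c * (u p s * cnj (u r s))" for s
      by (simp add: u_def)
    then have "(\<integral>s. u (smult c p) s * cnj (u r s) \<partial>lam E) = (\<integral>s. c * (u p s * cnj (u r s)) \<partial>lam E)"
      by (simp only:)
    then show "(\<integral>s. u (smult c p) s * cnj (u r s) \<partial>lam E) = c * (\<integral>s. u p s * cnj (u r s) \<partial>lam E)"
      by simp
    show "(\<integral>s. u q s * cnj (u p s) \<partial>lam E) = cnj (\<integral>s. u p s * cnj (u q s) \<partial>lam E)"
      by (subst Bochner_Integration.integral_cnj[symmetric]) (simp add: mult.commute)
  next
    fix p :: "complex poly" assume "p \<noteq> 0"
    have eq: "(\<integral>s. u p s * cnj (u p s) \<partial>lam E) = complex_of_real (\<integral>s. (cmod (u p s))\<^sup>2 \<partial>lam E)"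
      by (subst integral_complex_of_real[symmetric])
         (auto intro!: Bochner_Integration.integral_cong simp: complex_norm_square simp del: of_real_power)
    have i2: "integrable (lam E) (\<lambda>s. (cmod (u p s))\<^sup>2)" using su by (simp add: sqi_def)
    have "(\<integral>s. (cmod (u p s))\<^sup>2 \<partial>lam E) \<noteq> 0"
    proof
      assume "(\<integral>s. (cmod (u p s))\<^sup>2 \<partial>lam E) = 0"
      then have "AE s in lam E. u p s = 0"
        by (subst (asm) integral_nonneg_eq_0_iff_AE[OF i2]) auto
      moreover have "AE s in lam E. \<forall>z\<in>{z. poly p z = 0}. expi (a \<bullet> s) \<noteq> z"
        by (rule AE_finite_allI[OF poly_roots_finite[OF \<open>p \<noteq> 0\<close>]]) (rule AE_lam_expi_neq[OF E a])
      ultimately have "AE s in lam E. \<alpha> s = 0"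
        by eventually_elim (auto simp: u_def)
      with \<alpha>(2) show False by simp
    qed
    moreover have "0 \<le> (\<integral>s. (cmod (u p s))\<^sup>2 \<partial>lam E)" by (rule integral_nonneg_AE) simp
    ultimately show "0 < Re (\<integral>s. u p s * cnj (u p s) \<partial>lam E)"
      unfolding eq by (simp add: less_le)
  qed
  then show "\<exists>p. (\<forall>k<N. degree (p k) \<le> k) \<and> (\<forall>j<N. \<forall>k<N.
    (\<integral>s. (poly (p j) (expi (a \<bullet> s)) * \<alpha> s) * cnj (poly (p k) (expi (a \<bullet> s)) * \<alpha> s) \<partial>lam E) = (if j = k then 1 else 0))"
    unfolding u_def .
qed

text \<open>The relation between \<open>\<phi>\<close>, \<open>\<alpha>\<close> and \<open>\<beta>\<close> says that \<open>\<phi>\<close> is a short-time Fourier transform.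
  The translates \<open>\<phi> (x - k a, y)\<close> span short-time Fourier transforms with the same window; the argument
  of Amrein and Berthier bounds the number of orthonormal ones supported on a set of finite measure.\<close>

theorem stft_finite_support:
  fixes \<phi> :: "'a \<times> 'a \<Rightarrow> complex"
  assumes a0: "E a0 = a0" "a0 \<noteq> 0"
    and [measurable]: "\<phi> \<in> borel_measurable (borel \<Otimes>\<^sub>M borel)"
    and \<phi>1: "AE y in lam E. integrable (lam E) (\<lambda>x. \<phi> (x, y))"
    and \<phi>2: "(\<integral>\<^sup>+p. ennreal ((cmod (\<phi> p))\<^sup>2) \<partial>(lam E \<Otimes>\<^sub>M lam E)) < \<infinity>"
    and fin: "emeasure (lam E \<Otimes>\<^sub>M lam E) {p. \<phi> p \<noteq> 0} < \<infinity>"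
    and [measurable]: "\<alpha> \<in> borel_measurable borel" "\<beta> \<in> borel_measurable borel"
    and rel: "AE y in lam E. AE s in lam E. (\<integral>x. \<phi> (x, y) * expi (s \<bullet> x) \<partial>lam E) = \<alpha> s * \<beta> (y - s)"
  shows "AE p in lam E \<Otimes>\<^sub>M lam E. \<phi> p = 0"
proof (rule ccontr)
  assume nz: "\<not> (AE p in lam E \<Otimes>\<^sub>M lam E. \<phi> p = 0)"
  let ?L = "lam E" and ?M = "lam E \<Otimes>\<^sub>M lam E"
  define F where "F = (\<lambda>s y. \<integral>x. \<phi> (x, y) * expi (s \<bullet> x) \<partial>?L)"
  have rel: "AE y in ?L. AE s in ?L. F s y = \<alpha> s * \<beta> (y - s)"
    using rel by (simp add: F_def)
  \<comment> \<open>Squared norms of \<alpha> and of the window \<beta>; that they are finite and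
    nonzero is derived from the relation below.\<close>
  define A where "A = (\<integral>\<^sup>+s. ennreal ((cmod (\<alpha> s))\<^sup>2) \<partial>?L)"
  define B where "B = (\<integral>\<^sup>+s. ennreal ((cmod (\<beta> s))\<^sup>2) \<partial>?L)"
  have refl: "(\<integral>\<^sup>+s. ennreal ((cmod (\<beta> (y - s)))\<^sup>2) \<partial>?L) = B" if "E y = y" for y
    unfolding B_def using that by (intro nn_integral_lam_affine(3)[OF E, of "\<lambda>s. ennreal ((cmod (\<beta> s))\<^sup>2)"]) auto
  \<comment> \<open>Tonelli and translation invariance. Combined with the Fourier relation this
    plays the part of the orthogonality relation for short-time Fourier transforms.\<close>
  have conv: "(\<integral>\<^sup>+y. \<integral>\<^sup>+s. ennreal ((cmod (u s * \<beta> (y - s)))\<^sup>2) \<partial>?L \<partial>?L)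
     = (\<integral>\<^sup>+s. ennreal ((cmod (u s))\<^sup>2) \<partial>?L) * B" if [measurable]: "u \<in> borel_measurable borel" for u
  proof -
    have "(\<integral>\<^sup>+y. \<integral>\<^sup>+s. ennreal ((cmod (u s * \<beta> (y - s)))\<^sup>2) \<partial>?L \<partial>?L)
      = (\<integral>\<^sup>+s. \<integral>\<^sup>+y. ennreal ((cmod (u s * \<beta> (y - s)))\<^sup>2) \<partial>?L \<partial>?L)"
      by (rule pE.Fubini') measurable
    also have "\<dots> = (\<integral>\<^sup>+s. ennreal ((cmod (u s))\<^sup>2) * (\<integral>\<^sup>+y. ennreal ((cmod (\<beta> (y - s)))\<^sup>2) \<partial>?L) \<partial>?L)"
      by (subst nn_integral_cmult[symmetric]) (auto simp: norm_mult power_mult_distrib ennreal_mult)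
    also have "\<dots> = (\<integral>\<^sup>+s. ennreal ((cmod (u s))\<^sup>2) * B \<partial>?L)"
    proof (rule nn_integral_cong_AE)
      show "AE s in ?L. ennreal ((cmod (u s))\<^sup>2) * (\<integral>\<^sup>+y. ennreal ((cmod (\<beta> (y - s)))\<^sup>2) \<partial>?L) = ennreal ((cmod (u s))\<^sup>2) * B"
        using AE_lam_fixed[OF E]
      proof eventually_elim
        case (elim s)
        have "(\<integral>\<^sup>+y. ennreal ((cmod (\<beta> (y - s)))\<^sup>2) \<partial>?L) = B"
          unfolding B_def using elim by (intro nn_integral_lam_affine(2)[OF E, of "\<lambda>s. ennreal ((cmod (\<beta> s))\<^sup>2)"]) auto
        then show ?case by simp
      qed
    qed
    also have "\<dots> = (\<integral>\<^sup>+s. ennreal ((cmod (u s))\<^sup>2) \<partial>?L) * B"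
      by (rule nn_integral_multc) measurable
    finally show ?thesis .
  qed
  have AB: "A * B < \<infinity>"
  proof -
    have "A * B = (\<integral>\<^sup>+y. \<integral>\<^sup>+s. ennreal ((cmod (\<alpha> s * \<beta> (y - s)))\<^sup>2) \<partial>?L \<partial>?L)"
      unfolding A_def by (rule conv[symmetric]) measurable
    also have "\<dots> \<le> (\<integral>\<^sup>+y. \<integral>\<^sup>+x. ennreal ((cmod (\<phi> (x, y)))\<^sup>2) \<partial>?L \<partial>?L)"
    proof (rule nn_integral_mono_AE)
      show "AE y in ?L. (\<integral>\<^sup>+s. ennreal ((cmod (\<alpha> s * \<beta> (y - s)))\<^sup>2) \<partial>?L) \<le> (\<integral>\<^sup>+x. ennreal ((cmod (\<phi> (x, y)))\<^sup>2) \<partial>?L)"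
        using rel \<phi>1
      proof eventually_elim
        case (elim y)
        have "(\<integral>\<^sup>+s. ennreal ((cmod (\<alpha> s * \<beta> (y - s)))\<^sup>2) \<partial>?L) = (\<integral>\<^sup>+s. ennreal ((cmod (F s y))\<^sup>2) \<partial>?L)"
          by (rule nn_integral_cong_AE) (use elim(1) in eventually_elim, simp)
        also have "\<dots> \<le> (\<integral>\<^sup>+x. ennreal ((cmod (\<phi> (x, y)))\<^sup>2) \<partial>?L)"
          unfolding F_def by (rule fourier_bessel_lam[OF E elim(2)])
        finally show ?case .
      qed
    qed
    also have "\<dots> = (\<integral>\<^sup>+p. ennreal ((cmod (\<phi> p))\<^sup>2) \<partial>?M)"
      by (subst pE.nn_integral_snd[symmetric]) auto
    finally show ?thesis using \<phi>2 by (rule le_less_trans)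
  qed
  \<comment> \<open>If the product vanished, almost all partial transforms of \<phi> would be zero,
    and injectivity would make \<phi> zero.\<close>
  have AB0: "A * B \<noteq> 0"
  proof
    assume "A * B = 0"
    then have "(\<integral>\<^sup>+y. \<integral>\<^sup>+s. ennreal ((cmod (\<alpha> s * \<beta> (y - s)))\<^sup>2) \<partial>?L \<partial>?L) = 0"
      unfolding A_def using conv[of \<alpha>] by simp
    then have "AE y in ?L. (\<integral>\<^sup>+s. ennreal ((cmod (\<alpha> s * \<beta> (y - s)))\<^sup>2) \<partial>?L) = 0"
      by (subst (asm) nn_integral_0_iff_AE) auto
    with rel \<phi>1 have "AE y in ?L. AE x in ?L. \<phi> (x, y) = 0"
    proof eventually_elim
      case (elim y)
      then have "AE s in ?L. ennreal ((cmod (\<alpha> s * \<beta> (y - s)))\<^sup>2) = 0"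
        by (subst (asm) nn_integral_0_iff_AE) auto
      with elim(1) have "AE s in ?L. F s y = 0"
        by eventually_elim (auto simp: ennreal_eq_0_iff)
      then show ?case
        unfolding F_def by (rule fourier_injective_lam[OF E elim(2)])
    qed
    moreover have "{p \<in> space ?M. \<phi> (fst p, snd p) = 0} \<in> sets ?M" by measurable
    ultimately have "AE x in ?L. AE y in ?L. \<phi> (x, y) = 0"
      using pE.AE_commute[of "\<lambda>x y. \<phi> (x, y) = 0"] by blast
    then have "AE p in ?M. \<phi> p = 0"
    proof (intro pE.AE_pair_measure)
      show "{p \<in> space ?M. \<phi> p = 0} \<in> sets ?M" by measurable
    qed
    with nz show False by simp
  qed
  from AB0 have A0: "A \<noteq> 0" and B0: "B \<noteq> 0" by auto
  \<comment> \<open>A finite extended product of nonzero factors has finite factors.\<close>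
  from AB A0 B0 have A1: "A < \<infinity>" and B1: "B < \<infinity>"
    by (auto simp: ennreal_mult_less_top)
  have sa: "sqi ?L \<alpha>" using A1 by (auto simp: sqi_def A_def integrable_iff_bounded)
  have na: "\<not> (AE s in ?L. \<alpha> s = 0)"
  proof
    assume "AE s in ?L. \<alpha> s = 0"
    then have "A = 0" unfolding A_def by (subst nn_integral_0_iff_AE) auto
    with A0 show False by simp
  qed
  define T where "T = {p. \<phi> p \<noteq> 0}"
  have [measurable]: "T \<in> sets (borel \<Otimes>\<^sub>M borel)"
  proof -
    have "{p \<in> space (borel \<Otimes>\<^sub>M borel). \<phi> p \<noteq> 0} \<in> sets (borel \<Otimes>\<^sub>M borel)" by measurable
    then show ?thesis by (simp add: T_def space_pair_measure)
  qed
  obtain t where t: "emeasure ?M T = ennreal t" "t \<ge> 0"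
    using fin unfolding T_def[symmetric] by (cases "emeasure ?M T") auto
  \<comment> \<open>The translates up to N a add at most N (1/N) = 1 to the measure \<open>t\<close>
    of \<open>T\<close>, so for N > t + 1 their union is smaller than the number of orthonormal
    functions.\<close>
  obtain N :: nat where N: "real N > t + 1" using reals_Archimedean2 by blast
  have N0: "N > 0" using N t by (cases N) auto
  obtain a where a: "E a = a" "a \<noteq> 0" "emeasure ?M ({p. (fst p - a, snd p) \<in> T} - T) \<le> ennreal (1 / real N)"
    using small_shift[OF E _ _ a0, of T "1 / real N"] t N0 by auto
  define T' where "T' = (\<Union>k\<le>N. {p. (fst p - real k *\<^sub>R a, snd p) \<in> T})"
  have [measurable]: "T' \<in> sets (borel \<Otimes>\<^sub>M borel)" unfolding T'_def by measurable
  have T'N: "emeasure ?M T' < ennreal (real N)"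
  proof -
    have "emeasure ?M T' \<le> emeasure ?M T + of_nat N * ennreal (1 / real N)"
      unfolding T'_def by (rule emeasure_shifts_le[OF E _ a(1,3)]) measurable
    also have "\<dots> = ennreal (t + 1)"
      using t N0 by (simp add: ennreal_of_nat_eq_real_of_nat ennreal_plus flip: ennreal_mult)
    also have "\<dots> < ennreal (real N)" using N t by (intro ennreal_lessI) auto
    finally show ?thesis .
  qed
  obtain p where deg: "\<And>k. k < N \<Longrightarrow> degree (p k) \<le> k" and
    on: "\<And>j k. j < N \<Longrightarrow> k < N \<Longrightarrow> (\<integral>s. (poly (p j) (expi (a \<bullet> s)) * \<alpha> s) * cnj (poly (p k) (expi (a \<bullet> s)) * \<alpha> s) \<partial>?L) = (if j = k then 1 else 0)"
    using orthonormal_trig_polys(1)[OF a(1,2) sa na, of N] by blast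
  define u where "u = (\<lambda>k s. poly (p k) (expi (a \<bullet> s)) * \<alpha> s)"
  have on: "(\<integral>s. u j s * cnj (u k s) \<partial>?L) = (if j = k then 1 else 0)" if "j < N" "k < N" for j k
    unfolding u_def by (rule on[OF that])
  have su: "sqi ?L (u k)" for k
    unfolding u_def by (rule orthonormal_trig_polys(2)[OF a(1,2) sa na])
  have [measurable]: "u k \<in> borel_measurable borel" for k using sqi_measurable[OF su[of k]] by simp
  \<comment> \<open>A power of \<open>expi (a \<bullet> s)\<close> on the transform side is a
    translate of \<phi>, so the partial transform of \<open>\<Theta> k\<close> is
    \<open>u k s\<close> times the unchanged window factor. All degrees are below N, so the sum up
    to N contains every coefficient.\<close>
  define \<Theta> where "\<Theta> = (\<lambda>k x y. \<Sum>j\<le>N. coeff (p k) j * \<phi> (x - real j *\<^sub>R a, y))"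
  have [measurable]: "(\<lambda>q. \<Theta> k (fst q) (snd q)) \<in> borel_measurable (borel \<Otimes>\<^sub>M borel)" for k
    unfolding \<Theta>_def by measurable
  have norm_u: "(\<integral>\<^sup>+s. ennreal ((cmod (u k s))\<^sup>2) \<partial>?L) = 1" if "k < N" for k
  proof -
    have i: "integrable ?L (\<lambda>s. (cmod (u k s))\<^sup>2)" using su by (simp add: sqi_def)
    have "complex_of_real (\<integral>s. (cmod (u k s))\<^sup>2 \<partial>?L) = (\<integral>s. u k s * cnj (u k s) \<partial>?L)"
      by (subst integral_complex_of_real[symmetric])
         (auto intro!: Bochner_Integration.integral_cong simp: complex_norm_square simp del: of_real_power)
    also have "\<dots> = 1" using on[OF that that] by simp
    finally have "(\<integral>s. (cmod (u k s))\<^sup>2 \<partial>?L) = 1" by (simp only: of_real_eq_1_iff)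
    then show ?thesis using nn_integral_eq_integral[OF i] by simp
  qed
  have good: "AE y in ?L. (\<forall>k<N. integrable ?L (\<lambda>x. \<Theta> k x y) \<and>
      (AE s in ?L. (\<integral>x. \<Theta> k x y * expi (s \<bullet> x) \<partial>?L) = u k s * \<beta> (y - s))) \<and> sqi ?L (\<lambda>s. \<beta> (y - s)) \<and>
      (\<integral>\<^sup>+s. ennreal ((cmod (\<beta> (y - s)))\<^sup>2) \<partial>?L) = B"
    using rel \<phi>1 AE_lam_fixed[OF E]
  proof eventually_elim
    case (elim y)
    have B: "(\<integral>\<^sup>+s. ennreal ((cmod (\<beta> (y - s)))\<^sup>2) \<partial>?L) = B" by (rule refl[OF elim(3)])
    then have "sqi ?L (\<lambda>s. \<beta> (y - s))"
      using B1 by (auto simp: sqi_def integrable_iff_bounded)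
    moreover have "integrable ?L (\<lambda>x. \<Theta> k x y) \<and>
      (AE s in ?L. (\<integral>x. \<Theta> k x y * expi (s \<bullet> x) \<partial>?L) = u k s * \<beta> (y - s))" if "k < N" for k
    proof -
      have ja: "E (real j *\<^sub>R a) = real j *\<^sub>R a" for j :: nat using a by (simp add: orth_projD[OF E])
      have [measurable]: "(\<lambda>x. \<phi> (x, y)) \<in> borel_measurable borel" by measurable
      have ij: "integrable ?L (\<lambda>x. \<phi> (x - real j *\<^sub>R a, y))" for j :: nat
        using integral_lam_translate(2)[OF E _ ja[of j], of "\<lambda>x. \<phi> (x, y)"] elim(2) by simp
      have i1: "integrable ?L (\<lambda>x. \<Theta> k x y)"
        unfolding \<Theta>_def using ij by (intro Bochner_Integration.integrable_sum integrable_mult_right) auto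
      have ft: "(\<integral>x. \<Theta> k x y * expi (s \<bullet> x) \<partial>?L) = poly (p k) (expi (a \<bullet> s)) * F s y" for s
      proof -
        have ij': "integrable ?L (\<lambda>x. coeff (p k) j * (\<phi> (x - real j *\<^sub>R a, y) * expi (s \<bullet> x)))" for j :: nat
          by (intro integrable_mult_right integrable_mult_bounded[OF ij, where C=1]) auto
        have tr: "(\<integral>x. \<phi> (x - real j *\<^sub>R a, y) * expi (s \<bullet> x) \<partial>?L) = expi (a \<bullet> s) ^ j * F s y" for j :: nat
        proof -
          have e: "expi (s \<bullet> x) = expi (a \<bullet> s) ^ j * expi (s \<bullet> (x - real j *\<^sub>R a))" for x
          proof -
            have "expi (a \<bullet> s) ^ j = expi (real j * (a \<bullet> s))"
              unfolding expi_def Complex.DeMoivre by (simp add: mult_ac)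
            then show ?thesis by (simp add: inner_diff_right inner_commute flip: expi_add)
          qed
          have "(\<integral>x. \<phi> (x - real j *\<^sub>R a, y) * expi (s \<bullet> x) \<partial>?L)
            = (\<integral>x. expi (a \<bullet> s) ^ j * (\<phi> (x - real j *\<^sub>R a, y) * expi (s \<bullet> (x - real j *\<^sub>R a))) \<partial>?L)"
            by (rule Bochner_Integration.integral_cong[OF HOL.refl]) (subst e, simp)
          also have "\<dots> = expi (a \<bullet> s) ^ j * (\<integral>x. \<phi> (x - real j *\<^sub>R a, y) * expi (s \<bullet> (x - real j *\<^sub>R a)) \<partial>?L)"
            by simp
          also have "(\<integral>x. \<phi> (x - real j *\<^sub>R a, y) * expi (s \<bullet> (x - real j *\<^sub>R a)) \<partial>?L) = F s y"
            unfolding F_def by (rule integral_lam_translate(1)[OF E _ ja, of "\<lambda>x. \<phi> (x, y) * expi (s \<bullet> x)"]) measurable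
          finally show ?thesis .
        qed
        have "(\<integral>x. \<Theta> k x y * expi (s \<bullet> x) \<partial>?L)
          = (\<integral>x. (\<Sum>j\<le>N. coeff (p k) j * (\<phi> (x - real j *\<^sub>R a, y) * expi (s \<bullet> x))) \<partial>?L)"
          by (simp add: \<Theta>_def sum_distrib_right mult.assoc)
        also have "\<dots> = (\<Sum>j\<le>N. coeff (p k) j * (expi (a \<bullet> s) ^ j * F s y))"
          using ij' by (subst Bochner_Integration.integral_sum) (auto simp: tr)
        also have "\<dots> = (\<Sum>j\<le>N. coeff (p k) j * expi (a \<bullet> s) ^ j) * F s y"
          by (simp add: sum_distrib_right mult.assoc)
        also have "(\<Sum>j\<le>N. coeff (p k) j * expi (a \<bullet> s) ^ j) = poly (p k) (expi (a \<bullet> s))"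
          unfolding poly_altdef using deg[OF that] that
          by (intro sum.mono_neutral_right) (auto simp: coeff_eq_0)
        finally show ?thesis .
      qed
      show ?thesis
        using i1 elim(1) by (auto simp: ft u_def mult.assoc elim!: eventually_mono)
    qed
    ultimately show ?case using B by blast
  qed
  \<comment> \<open>At a given (x, y), inversion writes the N values as pairings of the orthonormal
    \<open>u k\<close> with one and the same function, of squared norm \<open>B\<close>, and
    Bessel's inequality bounds them together. The window is not normalised, so \<open>B\<close>
    stands in place of 1.\<close>
  have pointwise: "AE y in ?L. AE x in ?L. (\<Sum>k<N. ennreal ((cmod (\<Theta> k x y))\<^sup>2)) \<le> B"
    using good
  proof eventually_elim
    case (elim y)
    have sb: "sqi ?L (\<lambda>s. \<beta> (y - s))" using elim by blast
    have inv: "AE x in ?L. \<Theta> k x y = (\<integral>s. u k s * (expi (- (s \<bullet> x)) * \<beta> (y - s)) \<partial>?L)" if "k < N" for k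
    proof -
      have i: "integrable ?L (\<lambda>x. \<Theta> k x y)"
        and ae: "AE s in ?L. (\<integral>x. \<Theta> k x y * expi (s \<bullet> x) \<partial>?L) = u k s * \<beta> (y - s)"
        using elim that by blast+
      have [measurable]: "(\<lambda>x. \<Theta> k x y) \<in> borel_measurable borel" using borel_measurable_integrable[OF i] by simp
      \<comment> \<open>Inversion asks for an integrable transform; here it is the product of two
        square-integrable functions.\<close>
      have "integrable ?L (\<lambda>s. \<integral>x. \<Theta> k x y * expi (s \<bullet> x) \<partial>?L)"
        by (subst integrable_cong_AE[OF _ _ ae]) (use sqi_mult_integrable[OF su sb] in auto)
      from fourier_inversion_lam[OF E i this]
      show ?thesis
      proof eventually_elim
        case (elim x)
        show ?case unfolding elim
          by (rule integral_cong_AE) (use ae in \<open>auto elim!: eventually_mono\<close>)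
      qed
    qed
    have "AE x in ?L. \<forall>k\<in>{..<N}. \<Theta> k x y = (\<integral>s. u k s * (expi (- (s \<bullet> x)) * \<beta> (y - s)) \<partial>?L)"
      by (rule AE_finite_allI) (use inv in auto)
    then show ?case
    proof eventually_elim
      case (elim x)
      have "(\<Sum>k<N. (cmod (\<Theta> k x y))\<^sup>2) = (\<Sum>k<N. (cmod (\<integral>s. u k s * (expi (- (s \<bullet> x)) * \<beta> (y - s)) \<partial>?L))\<^sup>2)"
        using elim by (intro sum.cong) auto
      also have "\<dots> \<le> (\<integral>s. (cmod (expi (- (s \<bullet> x)) * \<beta> (y - s)))\<^sup>2 \<partial>?L)"
        by (rule bessel_orthonormal[OF su sqi_bounded_mult[OF sb, where C=1] on]) auto
      also have "\<dots> = (\<integral>s. (cmod (\<beta> (y - s)))\<^sup>2 \<partial>?L)" by (simp add: norm_mult)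
      finally have "ennreal (\<Sum>k<N. (cmod (\<Theta> k x y))\<^sup>2) \<le> ennreal (\<integral>s. (cmod (\<beta> (y - s)))\<^sup>2 \<partial>?L)"
        by (rule ennreal_leI)
      also have "\<dots> = (\<integral>\<^sup>+s. ennreal ((cmod (\<beta> (y - s)))\<^sup>2) \<partial>?L)"
        using sb by (intro nn_integral_eq_integral[symmetric]) (auto simp: sqi_def)
      also have "\<dots> = B" using \<open>_ \<and> _\<close> by blast
      finally show ?case by (simp add: sum_ennreal)
    qed
  qed
  have supp: "\<Theta> k x y = 0" if "(x, y) \<notin> T'" for k x y
    unfolding \<Theta>_def
  proof (rule sum.neutral, rule ballI)
    fix j assume "j \<in> {..N}"
    then have "(x - real j *\<^sub>R a, y) \<notin> T" using that by (auto simp: T'_def)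
    then show "coeff (p k) j * \<phi> (x - real j *\<^sub>R a, y) = 0" by (simp add: T_def)
  qed
  \<comment> \<open>Counting in two ways: the total squared norm of the \<open>\<Theta> k\<close> is
    at least N B by the Fourier inequality for almost every y, and at most B times the measure of
    \<open>T'\<close> by the pointwise bound.\<close>
  have "ennreal (real N) * B = (\<Sum>k<N. (\<integral>\<^sup>+s. ennreal ((cmod (u k s))\<^sup>2) \<partial>?L) * B)"
    using norm_u by (simp add: ennreal_of_nat_eq_real_of_nat)
  also have "\<dots> = (\<Sum>k<N. \<integral>\<^sup>+y. \<integral>\<^sup>+s. ennreal ((cmod (u k s * \<beta> (y - s)))\<^sup>2) \<partial>?L \<partial>?L)"
    by (intro sum.cong HOL.refl conv[symmetric]) measurable
  also have "\<dots> \<le> (\<Sum>k<N. \<integral>\<^sup>+y. \<integral>\<^sup>+x. ennreal ((cmod (\<Theta> k x y))\<^sup>2) \<partial>?L \<partial>?L)"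
  proof (intro sum_mono nn_integral_mono_AE)
    fix k assume k: "k \<in> {..<N}"
    show "AE y in ?L. (\<integral>\<^sup>+s. ennreal ((cmod (u k s * \<beta> (y - s)))\<^sup>2) \<partial>?L) \<le> (\<integral>\<^sup>+x. ennreal ((cmod (\<Theta> k x y))\<^sup>2) \<partial>?L)"
      using good
    proof eventually_elim
      case (elim y)
      then have i: "integrable ?L (\<lambda>x. \<Theta> k x y)"
        and ae: "AE s in ?L. (\<integral>x. \<Theta> k x y * expi (s \<bullet> x) \<partial>?L) = u k s * \<beta> (y - s)"
        using k by auto
      have "(\<integral>\<^sup>+s. ennreal ((cmod (u k s * \<beta> (y - s)))\<^sup>2) \<partial>?L)
         = (\<integral>\<^sup>+s. ennreal ((cmod (\<integral>x. \<Theta> k x y * expi (s \<bullet> x) \<partial>?L))\<^sup>2) \<partial>?L)"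
        by (rule nn_integral_cong_AE) (use ae in eventually_elim, simp)
      also have "\<dots> \<le> (\<integral>\<^sup>+x. ennreal ((cmod (\<Theta> k x y))\<^sup>2) \<partial>?L)"
        by (rule fourier_bessel_lam[OF E i])
      finally show ?case .
    qed
  qed
  also have "\<dots> = (\<integral>\<^sup>+y. \<integral>\<^sup>+x. (\<Sum>k<N. ennreal ((cmod (\<Theta> k x y))\<^sup>2)) \<partial>?L \<partial>?L)"
  proof (subst nn_integral_sum[symmetric])
    show "(\<lambda>y. \<integral>\<^sup>+x. ennreal ((cmod (\<Theta> k x y))\<^sup>2) \<partial>?L) \<in> borel_measurable ?L" for k
      unfolding \<Theta>_def by measurable
    show "(\<integral>\<^sup>+y. (\<Sum>k<N. \<integral>\<^sup>+x. ennreal ((cmod (\<Theta> k x y))\<^sup>2) \<partial>?L) \<partial>?L)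
      = (\<integral>\<^sup>+y. \<integral>\<^sup>+x. (\<Sum>k<N. ennreal ((cmod (\<Theta> k x y))\<^sup>2)) \<partial>?L \<partial>?L)"
      unfolding \<Theta>_def by (intro nn_integral_cong nn_integral_sum[symmetric]) measurable
  qed
  also have "\<dots> \<le> (\<integral>\<^sup>+y. \<integral>\<^sup>+x. B * indicator T' (x, y) \<partial>?L \<partial>?L)"
  proof (rule nn_integral_mono_AE)
    show "AE y in ?L. (\<integral>\<^sup>+x. (\<Sum>k<N. ennreal ((cmod (\<Theta> k x y))\<^sup>2)) \<partial>?L) \<le> (\<integral>\<^sup>+x. B * indicator T' (x, y) \<partial>?L)"
      using pointwise
    proof eventually_elim
      case (elim y)
      show ?case
        by (rule nn_integral_mono_AE) (use elim in eventually_elim, auto simp: indicator_def supp)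
    qed
  qed
  also have "\<dots> = (\<integral>\<^sup>+q. B * indicator T' q \<partial>?M)"
    by (subst pE.nn_integral_snd[symmetric]) auto
  also have "\<dots> = B * emeasure ?M T'"
    by (rule nn_integral_cmult_indicator) measurable
  finally have "ennreal (real N) \<le> emeasure ?M T'"
    using B0 B1 by (simp add: mult.commute[of _ B] ennreal_mult_le_mult_iff)
  with T'N show False by simp
qed

end

corollary fourier_injective:
  fixes h :: "'a::euclidean_space \<Rightarrow> complex"
  assumes h: "integrable lborel h"
    and z: "AE s in lborel. (\<integral>x. h x * expi (s \<bullet> x) \<partial>lborel) = 0"
  shows "AE y in lborel. h y = 0"
proof -
  have [measurable]: "h \<in> borel_measurable borel" using borel_measurable_integrable[OF h] by simp
  have "integrable lborel (\<lambda>s. \<integral>x. h x * expi (s \<bullet> x) \<partial>lborel)"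
    by (subst integrable_cong_AE[where g="\<lambda>_. 0"]) (use z in auto)
  from fourier_inversion[OF h this]
  show ?thesis
  proof eventually_elim
    case (elim y)
    have "(\<integral>s. (\<integral>x. h x * expi (s \<bullet> x) \<partial>lborel) * expi (- (s \<bullet> y)) \<partial>lborel) = (\<integral>s. 0 \<partial>(lborel::'a measure))"
      by (rule integral_cong_AE) (use z in auto)
    with elim show ?case by simp
  qed
qed

section \<open>From one fibre to the whole space\<close>

lemma nn_integral_0I_AE:
  assumes "AE x in M. f x = 0" shows "(\<integral>\<^sup>+x. f x \<partial>M) = 0"
  using nn_integral_cong_AE[OF assms] by simp

text \<open>Almost-everywhere quantifiers are exchanged by turning them into the vanishing of an
  iterated integral of a nonnegative function, to which Tonelli applies.\<close>

lemma AE_rotate3: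
  assumes M: "sigma_finite_measure M1" "sigma_finite_measure M2" "sigma_finite_measure M3"
    and Q[measurable]: "Q \<in> borel_measurable (M1 \<Otimes>\<^sub>M (M2 \<Otimes>\<^sub>M M3))"
    and ae: "AE x in M1. AE y in M2. AE z in M3. Q (x, y, z) = (0::ennreal)"
  shows "AE z in M3. AE x in M1. AE y in M2. Q (x, y, z) = 0"
proof -
  interpret M1: sigma_finite_measure M1 by fact
  interpret M2: sigma_finite_measure M2 by fact
  interpret M3: sigma_finite_measure M3 by fact
  interpret M23: pair_sigma_finite M2 M3 ..
  interpret M13: pair_sigma_finite M1 M3 ..
  have "(\<integral>\<^sup>+x. \<integral>\<^sup>+y. \<integral>\<^sup>+z. Q (x, y, z) \<partial>M3 \<partial>M2 \<partial>M1) = 0"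
    by (rule nn_integral_0I_AE) (use ae in \<open>auto elim!: eventually_mono intro!: nn_integral_0I_AE\<close>)
  also have "(\<integral>\<^sup>+x. \<integral>\<^sup>+y. \<integral>\<^sup>+z. Q (x, y, z) \<partial>M3 \<partial>M2 \<partial>M1) = (\<integral>\<^sup>+x. \<integral>\<^sup>+z. \<integral>\<^sup>+y. Q (x, y, z) \<partial>M2 \<partial>M3 \<partial>M1)"
    by (intro nn_integral_cong M23.Fubini'[symmetric]) measurable
  also have "\<dots> = (\<integral>\<^sup>+z. \<integral>\<^sup>+x. \<integral>\<^sup>+y. Q (x, y, z) \<partial>M2 \<partial>M1 \<partial>M3)"
    by (intro M13.Fubini'[symmetric]) measurable
  finally have "AE z in M3. (\<integral>\<^sup>+x. \<integral>\<^sup>+y. Q (x, y, z) \<partial>M2 \<partial>M1) = 0"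
    by (subst (asm) nn_integral_0_iff_AE) measurable
  with AE_space show ?thesis
  proof eventually_elim
    case (elim z)
    note [measurable] = elim(1)
    have "AE x in M1. (\<integral>\<^sup>+y. Q (x, y, z) \<partial>M2) = 0"
      using elim(2) by (subst (asm) nn_integral_0_iff_AE) measurable
    with AE_space show ?case
    proof eventually_elim
      case (elim x)
      note [measurable] = elim(1)
      show ?case using elim(2) by (subst (asm) nn_integral_0_iff_AE) measurable
    qed
  qed
qed

context
  fixes E :: "'a::euclidean_space \<Rightarrow> 'a"
  assumes E: "orth_proj E"
  notes [measurable] = orth_projD(4)[OF E] cproj_measurable[OF E]
begin

interpretation sE: sigma_finite_measure "lam E" by (rule sigma_finite_lam[OF E])
interpretation sC: sigma_finite_measure "lam (cproj E)" by (rule sigma_finite_lam[OF orth_proj_cproj[OF E]])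
interpretation EE: pair_sigma_finite "lam E" "lam E" ..
interpretation CE: pair_sigma_finite "lam (cproj E)" "lam E" ..
interpretation EC: pair_sigma_finite "lam E" "lam (cproj E)" ..

lemma lborel_lam_split': "distr (lam (cproj E) \<Otimes>\<^sub>M lam E) borel (\<lambda>(v, u). u + v) = lborel"
  using lborel_lam_split[OF orth_proj_cproj[OF E]] by (simp add: cproj_simps[OF E] add.commute)

lemma nn_integral_lam_split':
  "f \<in> borel_measurable borel \<Longrightarrow> (\<integral>\<^sup>+v. \<integral>\<^sup>+u. f (u + v) \<partial>lam E \<partial>lam (cproj E)) = (\<integral>\<^sup>+x. f x \<partial>lborel)"
  using nn_integral_lam_split[OF orth_proj_cproj[OF E], of f] by (simp add: cproj_simps[OF E] add.commute)

lemma AE_lam_split: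
  assumes "AE x in lborel. P x"
  shows "AE u in lam E. AE v in lam (cproj E). P (u + v)"
proof -
  have "AE p in lam E \<Otimes>\<^sub>M lam (cproj E). P ((\<lambda>(u, v). u + v) p)"
    by (rule AE_distrD[where f="\<lambda>(u, v). u + v" and M'=borel and P=P])
       (measurable, use assms in \<open>simp only: lborel_lam_split[OF E]\<close>)
  from EC.AE_pair[OF this] show ?thesis by simp
qed

lemma AE_lam_split':
  assumes "AE x in lborel. P x"
  shows "AE v in lam (cproj E). AE u in lam E. P (u + v)"
proof -
  have "AE p in lam (cproj E) \<Otimes>\<^sub>M lam E. P ((\<lambda>(v, u). u + v) p)"
    by (rule AE_distrD[where f="\<lambda>(v, u). u + v" and M'=borel and P=P])
       (measurable, use assms in \<open>simp only: lborel_lam_split'\<close>)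
  from CE.AE_pair[OF this] show ?thesis by simp
qed

text \<open>Frequencies in the range of \<open>E\<close> are orthogonal to points of its kernel and
  conversely, so the cross terms of the phase vanish and the transform can be iterated.\<close>

lemma fourier_split:
  fixes h :: "'a \<Rightarrow> complex"
  assumes h: "integrable lborel h" and s: "E s1 = s1" "E s2 = 0"
  shows "(\<integral>x. h x * expi ((s1 + s2) \<bullet> x) \<partial>lborel)
       = (\<integral>v. (\<integral>u. h (u + v) * expi (s1 \<bullet> u) \<partial>lam E) * expi (s2 \<bullet> v) \<partial>lam (cproj E))"
    and "integrable (lam (cproj E)) (\<lambda>v. \<integral>u. h (u + v) * expi (s1 \<bullet> u) \<partial>lam E)"
proof -
  have [measurable]: "h \<in> borel_measurable borel" using h by auto
  let ?k = "\<lambda>x. h x * expi ((s1 + s2) \<bullet> x)"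
  have ki: "integrable lborel ?k" by (rule integrable_mult_bounded[OF h, where C=1]) auto
  then have "integrable (distr (lam (cproj E) \<Otimes>\<^sub>M lam E) borel (\<lambda>(v, u). u + v)) ?k"
    by (simp only: lborel_lam_split')
  then have pi: "integrable (lam (cproj E) \<Otimes>\<^sub>M lam E) (\<lambda>(v, u). ?k (u + v))"
    by (subst (asm) integrable_distr_eq) (auto simp: split_beta')
  have inner: "AE v in lam (cproj E). (\<integral>u. ?k (u + v) \<partial>lam E) = (\<integral>u. h (u + v) * expi (s1 \<bullet> u) \<partial>lam E) * expi (s2 \<bullet> v)"
    using AE_lam_fixed[OF orth_proj_cproj[OF E]]
  proof eventually_elim
    case (elim v)
    have "E v = 0" using elim cproj_simps(2)[OF E, of v] by simp
    have "(\<integral>u. ?k (u + v) \<partial>lam E) = (\<integral>u. (h (u + v) * expi (s1 \<bullet> u)) * expi (s2 \<bullet> v) \<partial>lam E)"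
    proof (rule integral_cong_AE)
      show "AE u in lam E. ?k (u + v) = h (u + v) * expi (s1 \<bullet> u) * expi (s2 \<bullet> v)"
        using AE_lam_fixed[OF E]
      proof eventually_elim
        case (elim u)
        have "s1 \<bullet> v = 0" using orth_projD(3)[OF E, of s1 v] s \<open>E v = 0\<close> by simp
        moreover have "s2 \<bullet> u = 0" using orth_projD(3)[OF E, of s2 u] s elim by simp
        ultimately show ?case by (simp add: inner_add_left inner_add_right mult.assoc flip: expi_add)
      qed
    qed measurable
    then show ?case by simp
  qed
  have "(\<integral>x. ?k x \<partial>lborel) = (\<integral>p. ?k (snd p + fst p) \<partial>(lam (cproj E) \<Otimes>\<^sub>M lam E))"
    by (subst lborel_lam_split'[symmetric], subst integral_distr) (auto simp: split_beta')
  also have "\<dots> = (\<integral>v. \<integral>u. ?k (u + v) \<partial>lam E \<partial>lam (cproj E))"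
    using CE.integral_fst'[OF pi] by (simp add: split_beta')
  also have "\<dots> = (\<integral>v. (\<integral>u. h (u + v) * expi (s1 \<bullet> u) \<partial>lam E) * expi (s2 \<bullet> v) \<partial>lam (cproj E))"
    by (rule integral_cong_AE[OF _ _ inner]) measurable
  finally show "(\<integral>x. ?k x \<partial>lborel) = (\<integral>v. (\<integral>u. h (u + v) * expi (s1 \<bullet> u) \<partial>lam E) * expi (s2 \<bullet> v) \<partial>lam (cproj E))" .
  have "integrable (lam (cproj E)) (\<lambda>v. (\<integral>u. h (u + v) * expi (s1 \<bullet> u) \<partial>lam E) * expi (s2 \<bullet> v))"
    by (subst integrable_cong_AE[OF _ _ inner, symmetric]) (use CE.integrable_fst'[OF pi] in auto)
  from integrable_mult_bounded[OF this, of "\<lambda>v. expi (- (s2 \<bullet> v))" 1]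
  show "integrable (lam (cproj E)) (\<lambda>v. \<integral>u. h (u + v) * expi (s1 \<bullet> u) \<partial>lam E)"
    by (simp add: mult.assoc)
qed

text \<open>The kernel components of both variables are placed outermost because they label the
  fibres on which the uncertainty argument runs.\<close>

lemma nn_integral_fibres:
  assumes [measurable]: "K \<in> borel_measurable (borel \<Otimes>\<^sub>M borel)"
  shows "(\<integral>\<^sup>+v2. \<integral>\<^sup>+v1. \<integral>\<^sup>+u2. \<integral>\<^sup>+u1. K (u1 + v1, u2 + v2) \<partial>lam E \<partial>lam E \<partial>lam (cproj E) \<partial>lam (cproj E))
    = (\<integral>\<^sup>+p. K p \<partial>(lborel \<Otimes>\<^sub>M lborel))"
proof -
  have "(\<integral>\<^sup>+p. K p \<partial>(lborel \<Otimes>\<^sub>M lborel)) = (\<integral>\<^sup>+y. \<integral>\<^sup>+x. K (x, y) \<partial>lborel \<partial>lborel)"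
    by (subst lborel_pair.nn_integral_snd[symmetric]) auto
  also have "\<dots> = (\<integral>\<^sup>+y. \<integral>\<^sup>+v1. \<integral>\<^sup>+u1. K (u1 + v1, y) \<partial>lam E \<partial>lam (cproj E) \<partial>lborel)"
    by (intro nn_integral_cong nn_integral_lam_split'[symmetric]) measurable
  also have "\<dots> = (\<integral>\<^sup>+v2. \<integral>\<^sup>+u2. \<integral>\<^sup>+v1. \<integral>\<^sup>+u1. K (u1 + v1, u2 + v2) \<partial>lam E \<partial>lam (cproj E) \<partial>lam E \<partial>lam (cproj E))"
    by (intro nn_integral_lam_split'[symmetric]) measurable
  also have "\<dots> = (\<integral>\<^sup>+v2. \<integral>\<^sup>+v1. \<integral>\<^sup>+u2. \<integral>\<^sup>+u1. K (u1 + v1, u2 + v2) \<partial>lam E \<partial>lam E \<partial>lam (cproj E) \<partial>lam (cproj E))"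
    by (intro nn_integral_cong CE.Fubini') measurable
  finally show ?thesis by simp
qed

lemma AE_fibres_finite:
  assumes [measurable]: "K \<in> borel_measurable (borel \<Otimes>\<^sub>M borel)"
    and "(\<integral>\<^sup>+p. K p \<partial>(lborel \<Otimes>\<^sub>M lborel)) < \<infinity>"
  shows "AE v2 in lam (cproj E). AE v1 in lam (cproj E). (\<integral>\<^sup>+u2. \<integral>\<^sup>+u1. K (u1 + v1, u2 + v2) \<partial>lam E \<partial>lam E) < \<infinity>"
proof -
  have "AE v2 in lam (cproj E). (\<integral>\<^sup>+v1. \<integral>\<^sup>+u2. \<integral>\<^sup>+u1. K (u1 + v1, u2 + v2) \<partial>lam E \<partial>lam E \<partial>lam (cproj E)) \<noteq> \<infinity>"
    by (rule nn_integral_PInf_AE) (use assms(2) nn_integral_fibres[of K] in auto)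
  then show ?thesis
  proof eventually_elim
    case (elim v2)
    have "AE v1 in lam (cproj E). (\<integral>\<^sup>+u2. \<integral>\<^sup>+u1. K (u1 + v1, u2 + v2) \<partial>lam E \<partial>lam E) \<noteq> \<infinity>"
      by (rule nn_integral_PInf_AE) (use elim in auto)
    then show ?case by eventually_elim (simp add: less_top)
  qed
qed

text \<open>Since \<open>E\<close> need not be injective, the relation is only a short-time Fourier transform on the fibres
  over the range of \<open>1 - E\<close>; almost every fibre of a set of finite measure has finite measure.\<close>

proposition partial_stft_finite_support:
  fixes \<Phi> :: "'a \<times> 'a \<Rightarrow> complex"
  assumes a0: "E a0 = a0" "a0 \<noteq> 0"
    and \<Phi>1: "integrable (lborel \<Otimes>\<^sub>M lborel) \<Phi>"
    and \<Phi>2: "(\<integral>\<^sup>+p. ennreal ((cmod (\<Phi> p))\<^sup>2) \<partial>(lborel \<Otimes>\<^sub>M lborel)) < \<infinity>"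
    and fin: "emeasure (lborel \<Otimes>\<^sub>M lborel) {p. \<Phi> p \<noteq> 0} < \<infinity>"
    and a: "integrable lborel a" and b: "integrable lborel b"
    and rel: "AE s in lborel. AE y in lborel.
      (\<integral>x. \<Phi> (x, y) * expi (s \<bullet> x) \<partial>lborel) = (\<integral>x. a x * expi (s \<bullet> x) \<partial>lborel) * b (y - E s)"
  shows "AE p in lborel \<Otimes>\<^sub>M lborel. \<Phi> p = 0"
proof -
  let ?C = "cproj E"
  have \<Phi>m: "\<Phi> \<in> borel_measurable (lborel \<Otimes>\<^sub>M lborel)" using \<Phi>1 by (rule borel_measurable_integrable)
  then have [measurable]: "\<Phi> \<in> borel_measurable (borel \<Otimes>\<^sub>M borel)"
    by (simp cong: measurable_cong_sets sets_pair_measure_cong)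
  have [measurable]: "a \<in> borel_measurable borel" "b \<in> borel_measurable borel" using a b by auto
  have Tm[measurable]: "{p. \<Phi> p \<noteq> 0} \<in> sets (borel \<Otimes>\<^sub>M borel)"
  proof -
    have "{p \<in> space (borel \<Otimes>\<^sub>M borel). \<Phi> p \<noteq> 0} \<in> sets (borel \<Otimes>\<^sub>M borel)" by measurable
    then show ?thesis by (simp add: space_pair_measure)
  qed
  \<comment> \<open>Transforms in the range variables only, on the fibre through
    \<open>v\<close>.\<close>
  define L where "L = (\<lambda>s v y. \<integral>u. \<Phi> (u + v, y) * expi (s \<bullet> u) \<partial>lam E)"
  define R where "R = (\<lambda>s v. \<integral>u. a (u + v) * expi (s \<bullet> u) \<partial>lam E)"
  have "AE y in lborel. AE s in lborel.
      (\<integral>x. \<Phi> (x, y) * expi (s \<bullet> x) \<partial>lborel) = (\<integral>x. a x * expi (s \<bullet> x) \<partial>lborel) * b (y - E s)"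
  proof (rule lborel_pair.AE_commute[THEN iffD1, OF _ rel])
    show "{p \<in> space (lborel \<Otimes>\<^sub>M lborel). (\<integral>x. \<Phi> (x, snd p) * expi (fst p \<bullet> x) \<partial>lborel)
      = (\<integral>x. a x * expi (fst p \<bullet> x) \<partial>lborel) * b (snd p - E (fst p))} \<in> sets (lborel \<Otimes>\<^sub>M lborel)"
      by measurable
  qed
  moreover have "AE y in lborel. integrable lborel (\<lambda>x. \<Phi> (x, y))"
    using lborel_pair.AE_integrable_snd[of "\<lambda>x y. \<Phi> (x, y)"] \<Phi>1 by simp
  ultimately have "AE y in lborel. integrable lborel (\<lambda>x. \<Phi> (x, y)) \<and> (AE s in lborel.
      (\<integral>x. \<Phi> (x, y) * expi (s \<bullet> x) \<partial>lborel) = (\<integral>x. a x * expi (s \<bullet> x) \<partial>lborel) * b (y - E s))"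
    by eventually_elim auto
  from AE_lam_split'[OF this]
  have "AE v2 in lam ?C. AE u2 in lam E. AE s1 in lam E. AE v1 in lam ?C.
      L s1 v1 (u2 + v2) = R s1 v1 * b (u2 + v2 - s1)"
  proof eventually_elim
    case (elim v2)
    then show ?case
    proof eventually_elim
      case (elim u2)
      let ?y = "u2 + v2"
      from elim have i: "integrable lborel (\<lambda>x. \<Phi> (x, ?y))"
        and "AE s in lborel. (\<integral>x. \<Phi> (x, ?y) * expi (s \<bullet> x) \<partial>lborel) = (\<integral>x. a x * expi (s \<bullet> x) \<partial>lborel) * b (?y - E s)"
        by auto
      from AE_lam_split[OF this(2)] AE_lam_fixed[OF E]
      show ?case
      proof eventually_elim
        case (elim s1)
        have iL: "integrable (lam ?C) (\<lambda>v. L s1 v ?y)" and iR: "integrable (lam ?C) (\<lambda>v. R s1 v)"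
          unfolding L_def R_def
          using fourier_split(2)[OF i elim(2) orth_projD(10)[OF E]] fourier_split(2)[OF a elim(2) orth_projD(10)[OF E]] by auto
        \<comment> \<open>The factor b(y - E s) sees only the component \<open>s1\<close> of the
          frequency. Hence, as functions of \<open>v\<close>, both sides have the same transform in
          the complementary frequency and agree by injectivity.\<close>
        have "AE v in lam ?C. L s1 v ?y - R s1 v * b (?y - s1) = 0"
        proof (rule fourier_injective_lam[OF orth_proj_cproj[OF E]])
          show "integrable (lam ?C) (\<lambda>v. L s1 v ?y - R s1 v * b (?y - s1))" using iL iR by auto
          show "AE s2 in lam ?C. (\<integral>v. (L s1 v ?y - R s1 v * b (?y - s1)) * expi (s2 \<bullet> v) \<partial>lam ?C) = 0"
            using elim(1) AE_lam_fixed[OF orth_proj_cproj[OF E]]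
          proof eventually_elim
            case (elim s2)
            have s2: "E s2 = 0" using elim(2) cproj_simps(2)[OF E, of s2] by simp
            have 1: "(\<integral>v. L s1 v ?y * expi (s2 \<bullet> v) \<partial>lam ?C) = (\<integral>v. R s1 v * expi (s2 \<bullet> v) \<partial>lam ?C) * b (?y - s1)"
              using elim(1) fourier_split(1)[OF i \<open>E s1 = s1\<close> s2] fourier_split(1)[OF a \<open>E s1 = s1\<close> s2]
              by (simp add: L_def R_def orth_projD[OF E] s2 \<open>E s1 = s1\<close>)
            have "integrable (lam ?C) (\<lambda>v. L s1 v ?y * expi (s2 \<bullet> v))" "integrable (lam ?C) (\<lambda>v. R s1 v * expi (s2 \<bullet> v))"
              by (rule integrable_mult_bounded[where C=1], use iL iR in auto)+
            then have "(\<integral>v. (L s1 v ?y - R s1 v * b (?y - s1)) * expi (s2 \<bullet> v) \<partial>lam ?C)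
               = (\<integral>v. L s1 v ?y * expi (s2 \<bullet> v) \<partial>lam ?C) - (\<integral>v. R s1 v * expi (s2 \<bullet> v) \<partial>lam ?C) * b (?y - s1)"
              by (simp add: left_diff_distrib mult.commute[of _ "b (?y - s1)"] mult.assoc)
            then show ?case using 1 by simp
          qed
        qed
        then show ?case by eventually_elim simp
      qed
    qed
  qed
  \<comment> \<open>The fibre labels move to the front, so that a fibre can be fixed before the
    short-time Fourier relation on it is read.\<close>
  then have main: "AE v2 in lam ?C. AE v1 in lam ?C. AE u2 in lam E. AE s1 in lam E.
      L s1 v1 (u2 + v2) = R s1 v1 * b (u2 + v2 - s1)"
  proof eventually_elim
    case (elim v2)
    have "AE v1 in lam ?C. AE u2 in lam E. AE s1 in lam E. ennreal (cmod (L s1 v1 (u2 + v2) - R s1 v1 * b (u2 + v2 - s1))) = 0"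
    proof (rule AE_rotate3[OF sE.sigma_finite_measure_axioms sE.sigma_finite_measure_axioms sC.sigma_finite_measure_axioms,
        where Q="\<lambda>(u2, s1, v1). ennreal (cmod (L s1 v1 (u2 + v2) - R s1 v1 * b (u2 + v2 - s1)))", simplified prod.case])
      show "(\<lambda>(u2, s1, v1). ennreal (cmod (L s1 v1 (u2 + v2) - R s1 v1 * b (u2 + v2 - s1))))
         \<in> borel_measurable (lam E \<Otimes>\<^sub>M lam E \<Otimes>\<^sub>M lam ?C)"
        unfolding L_def R_def by measurable
    qed (use elim in simp)
    then show ?case by (simp add: ennreal_eq_0_iff)
  qed
  have f1: "AE v2 in lam ?C. AE v1 in lam ?C. (\<integral>\<^sup>+u2. \<integral>\<^sup>+u1. ennreal (cmod (\<Phi> (u1 + v1, u2 + v2))) \<partial>lam E \<partial>lam E) < \<infinity>"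
    by (rule AE_fibres_finite[of "\<lambda>p. ennreal (cmod (\<Phi> p))"]) (use \<Phi>1 in \<open>auto simp: integrable_iff_bounded\<close>)
  have f2: "AE v2 in lam ?C. AE v1 in lam ?C. (\<integral>\<^sup>+u2. \<integral>\<^sup>+u1. ennreal ((cmod (\<Phi> (u1 + v1, u2 + v2)))\<^sup>2) \<partial>lam E \<partial>lam E) < \<infinity>"
    by (rule AE_fibres_finite[of "\<lambda>p. ennreal ((cmod (\<Phi> p))\<^sup>2)"]) (use \<Phi>2 in auto)
  have f3: "AE v2 in lam ?C. AE v1 in lam ?C. (\<integral>\<^sup>+u2. \<integral>\<^sup>+u1. indicator {p. \<Phi> p \<noteq> 0} (u1 + v1, u2 + v2) \<partial>lam E \<partial>lam E) < \<infinity>"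
    by (rule AE_fibres_finite[of "indicator {p. \<Phi> p \<noteq> 0}"]) (use fin in auto)
  have "AE v2 in lam ?C. AE v1 in lam ?C. (\<integral>\<^sup>+u2. \<integral>\<^sup>+u1. ennreal (cmod (\<Phi> (u1 + v1, u2 + v2))) \<partial>lam E \<partial>lam E) = 0"
    using main f1 f2 f3
  proof eventually_elim
    case (elim v2)
    from elim show ?case
    proof eventually_elim
      case (elim v1)
      define \<phi> where "\<phi> = (\<lambda>p. \<Phi> (fst p + v1, snd p + v2))"
      have [measurable]: "\<phi> \<in> borel_measurable (borel \<Otimes>\<^sub>M borel)" unfolding \<phi>_def by measurable
      have "AE p in lam E \<Otimes>\<^sub>M lam E. \<phi> p = 0"
      \<comment> \<open>On this fibre \<alpha> is the partial transform of \<open>a\<close> and the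
        window is \<open>b\<close> translated by \<open>v2\<close>.\<close>
      proof (rule stft_finite_support[OF E a0, where \<alpha>="\<lambda>s. R s v1" and \<beta>="\<lambda>y. b (y + v2)"])
        have "AE u2 in lam E. (\<integral>\<^sup>+u1. ennreal (cmod (\<Phi> (u1 + v1, u2 + v2))) \<partial>lam E) \<noteq> \<infinity>"
          by (rule nn_integral_PInf_AE) (use elim(2) in auto)
        then show "AE y in lam E. integrable (lam E) (\<lambda>x. \<phi> (x, y))"
          by eventually_elim (auto simp: \<phi>_def integrable_iff_bounded less_top)
        have "(\<integral>\<^sup>+p. ennreal ((cmod (\<phi> p))\<^sup>2) \<partial>(lam E \<Otimes>\<^sub>M lam E)) = (\<integral>\<^sup>+u2. \<integral>\<^sup>+u1. ennreal ((cmod (\<Phi> (u1 + v1, u2 + v2)))\<^sup>2) \<partial>lam E \<partial>lam E)"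
          by (subst EE.nn_integral_snd[symmetric]) (auto simp: \<phi>_def)
        then show "(\<integral>\<^sup>+p. ennreal ((cmod (\<phi> p))\<^sup>2) \<partial>(lam E \<Otimes>\<^sub>M lam E)) < \<infinity>" using elim(3) by simp
        have [measurable]: "{p. \<phi> p \<noteq> 0} \<in> sets (borel \<Otimes>\<^sub>M borel)"
        proof -
          have "{p \<in> space (borel \<Otimes>\<^sub>M borel). \<phi> p \<noteq> 0} \<in> sets (borel \<Otimes>\<^sub>M borel)" by measurable
          then show ?thesis by (simp add: space_pair_measure)
        qed
        have "emeasure (lam E \<Otimes>\<^sub>M lam E) {p. \<phi> p \<noteq> 0} = (\<integral>\<^sup>+p. indicator {p. \<phi> p \<noteq> 0} p \<partial>(lam E \<Otimes>\<^sub>M lam E))"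
          by (rule nn_integral_indicator[symmetric]) measurable
        also have "\<dots> = (\<integral>\<^sup>+u2. \<integral>\<^sup>+u1. indicator {p. \<phi> p \<noteq> 0} (u1, u2) \<partial>lam E \<partial>lam E)"
          by (rule EE.nn_integral_snd[symmetric]) measurable
        also have "\<dots> = (\<integral>\<^sup>+u2. \<integral>\<^sup>+u1. indicator {p. \<Phi> p \<noteq> 0} (u1 + v1, u2 + v2) \<partial>lam E \<partial>lam E)"
          by (intro nn_integral_cong) (simp add: \<phi>_def indicator_def)
        finally show "emeasure (lam E \<Otimes>\<^sub>M lam E) {p. \<phi> p \<noteq> 0} < \<infinity>" using elim(4) by simp
        show "(\<lambda>s. R s v1) \<in> borel_measurable borel" unfolding R_def by measurable
        show "AE y in lam E. AE s in lam E. (\<integral>x. \<phi> (x, y) * expi (s \<bullet> x) \<partial>lam E) = R s v1 * b (y - s + v2)"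
          using elim(1) by (simp add: \<phi>_def L_def algebra_simps)
      qed measurable
      then have "(\<integral>\<^sup>+p. ennreal (cmod (\<phi> p)) \<partial>(lam E \<Otimes>\<^sub>M lam E)) = 0"
        by (intro nn_integral_0I_AE) (auto elim!: eventually_mono)
      then show ?case
        by (subst (asm) EE.nn_integral_snd[symmetric]) (auto simp: \<phi>_def)
    qed
  qed
  then have "(\<integral>\<^sup>+v2. \<integral>\<^sup>+v1. \<integral>\<^sup>+u2. \<integral>\<^sup>+u1. ennreal (cmod (\<Phi> (u1 + v1, u2 + v2))) \<partial>lam E \<partial>lam E \<partial>lam ?C \<partial>lam ?C) = 0"
    by (intro nn_integral_0I_AE) (auto elim!: eventually_mono intro!: nn_integral_0I_AE)
  then have "(\<integral>\<^sup>+p. ennreal (cmod (\<Phi> p)) \<partial>(lborel \<Otimes>\<^sub>M lborel)) = 0"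
    using nn_integral_fibres[of "\<lambda>p. ennreal (cmod (\<Phi> p))"] by simp
  then show ?thesis
    by (subst (asm) nn_integral_0_iff_AE) (auto simp: ennreal_eq_0_iff)
qed

text \<open>Neither factor is given as the transform of an integrable function. Freezing
  \<open>s\<close> at a point where \<open>f\<close> is nonzero exhibits \<open>g\<close>, up to a
  modulation, as the transform of a partial transform of \<Phi>, and symmetrically for
  \<open>f\<close>. The chirp then acts on the other variable as the translation by
  \<open>E s\<close>.\<close>

theorem chirped_tensor_finite_support:
  fixes \<Phi> :: "'a \<times> 'a \<Rightarrow> complex"
  assumes a0: "E a0 = a0" "a0 \<noteq> 0"
    and \<Phi>1: "integrable (lborel \<Otimes>\<^sub>M lborel) \<Phi>"
    and \<Phi>2: "(\<integral>\<^sup>+p. ennreal ((cmod (\<Phi> p))\<^sup>2) \<partial>(lborel \<Otimes>\<^sub>M lborel)) < \<infinity>"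
    and fin: "emeasure (lborel \<Otimes>\<^sub>M lborel) {p. \<Phi> p \<noteq> 0} < \<infinity>"
    and rel: "AE p in lborel \<Otimes>\<^sub>M lborel. f (fst p) * g (snd p) * expi (E (fst p) \<bullet> snd p)
      = (\<integral>q. \<Phi> q * expi (fst p \<bullet> fst q + snd p \<bullet> snd q) \<partial>(lborel \<Otimes>\<^sub>M lborel))"
    and [measurable]: "f \<in> borel_measurable borel" "g \<in> borel_measurable borel"
  shows "(AE s in lborel. f s = 0) \<or> (AE t in lborel. g t = 0)"
proof (rule ccontr)
  assume "\<not> ?thesis"
  then have nf: "\<not> (AE s in lborel. f s = 0)" and ng: "\<not> (AE t in lborel. g t = 0)" by auto
  have \<Phi>m: "\<Phi> \<in> borel_measurable (lborel \<Otimes>\<^sub>M lborel)" using \<Phi>1 by (rule borel_measurable_integrable)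
  then have [measurable]: "\<Phi> \<in> borel_measurable (borel \<Otimes>\<^sub>M borel)"
    by (simp cong: measurable_cong_sets sets_pair_measure_cong)
  define \<psi> where "\<psi> = (\<lambda>s t. \<integral>q. \<Phi> q * expi (s \<bullet> fst q + t \<bullet> snd q) \<partial>(lborel \<Otimes>\<^sub>M lborel))"
  define W where "W = (\<lambda>s y. \<integral>x. \<Phi> (x, y) * expi (s \<bullet> x) \<partial>lborel)"
  define Z where "Z = (\<lambda>t x. \<integral>y. \<Phi> (x, y) * expi (t \<bullet> y) \<partial>lborel)"
  have pint: "integrable (lborel \<Otimes>\<^sub>M lborel) (\<lambda>q. \<Phi> q * expi (s \<bullet> fst q + t \<bullet> snd q))" for s t
    by (rule integrable_mult_bounded[OF \<Phi>1, where C=1]) auto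
  have Wint: "integrable lborel (W s)" for s
  proof -
    have "integrable (lborel \<Otimes>\<^sub>M lborel) (\<lambda>(x, y). \<Phi> (x, y) * expi (s \<bullet> x))"
      using pint[of s 0] by (simp add: split_beta')
    from lborel_pair.integrable_snd[OF this] show ?thesis by (simp add: W_def)
  qed
  have Zint: "integrable lborel (Z t)" for t
  proof -
    have "integrable (lborel \<Otimes>\<^sub>M lborel) (\<lambda>q. \<Phi> q * expi (t \<bullet> snd q))"
      using pint[of 0 t] by simp
    from lborel_pair.integrable_fst'[OF this] show ?thesis by (simp add: Z_def)
  qed
  have W\<psi>: "\<psi> s t = (\<integral>y. W s y * expi (t \<bullet> y) \<partial>lborel)" for s t
  proof -
    have "integrable (lborel \<Otimes>\<^sub>M lborel) (\<lambda>(x, y). \<Phi> (x, y) * expi (s \<bullet> x + t \<bullet> y))"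
      using pint[of s t] by (simp add: split_beta')
    from lborel_pair.integral_snd[OF this] show ?thesis
      by (simp add: \<psi>_def W_def split_beta' expi_add flip: mult.assoc)
  qed
  have Z\<psi>: "\<psi> s t = (\<integral>x. Z t x * expi (s \<bullet> x) \<partial>lborel)" for s t
    using lborel_pair.integral_fst'[OF pint[of s t]]
    by (simp add: \<psi>_def Z_def expi_add mult_ac flip: integral_mult_left_zero)
  have r1: "AE s in lborel. AE t in lborel. f s * g t * expi (E s \<bullet> t) = \<psi> s t"
    using lborel_pair.AE_pair[OF rel] by (simp add: \<psi>_def)
  have r2: "AE t in lborel. AE s in lborel. f s * g t * expi (E s \<bullet> t) = \<psi> s t"
  proof (rule lborel_pair.AE_commute[THEN iffD1, OF _ r1])
    show "{p \<in> space (lborel \<Otimes>\<^sub>M lborel). f (fst p) * g (snd p) * expi (E (fst p) \<bullet> snd p) = \<psi> (fst p) (snd p)} \<in> sets (lborel \<Otimes>\<^sub>M lborel)"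
      unfolding \<psi>_def by measurable
  qed
  \<comment> \<open>The set where \<open>f\<close> is nonzero is not null, so it contains a point at
    which the almost-everywhere relation also holds.\<close>
  obtain s0 where s0: "f s0 \<noteq> 0" "AE t in lborel. f s0 * g t * expi (E s0 \<bullet> t) = \<psi> s0 t"
  proof -
    have "\<not> (AE s in lborel. f s = 0 \<or> \<not> (AE t in lborel. f s * g t * expi (E s \<bullet> t) = \<psi> s t))"
    proof
      assume "AE s in lborel. f s = 0 \<or> \<not> (AE t in lborel. f s * g t * expi (E s \<bullet> t) = \<psi> s t)"
      with r1 have "AE s in lborel. f s = 0" by eventually_elim auto
      with nf show False by simp
    qed
    then have "\<exists>s. \<not> (f s = 0 \<or> \<not> (AE t in lborel. f s * g t * expi (E s \<bullet> t) = \<psi> s t))"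
      using AE_I2[of lborel] by blast
    with that show thesis by blast
  qed
  obtain t0 where t0: "g t0 \<noteq> 0" "AE s in lborel. f s * g t0 * expi (E s \<bullet> t0) = \<psi> s t0"
  proof -
    have "\<not> (AE t in lborel. g t = 0 \<or> \<not> (AE s in lborel. f s * g t * expi (E s \<bullet> t) = \<psi> s t))"
    proof
      assume "AE t in lborel. g t = 0 \<or> \<not> (AE s in lborel. f s * g t * expi (E s \<bullet> t) = \<psi> s t)"
      with r2 have "AE t in lborel. g t = 0" by eventually_elim auto
      with ng show False by simp
    qed
    then have "\<exists>t. \<not> (g t = 0 \<or> \<not> (AE s in lborel. f s * g t * expi (E s \<bullet> t) = \<psi> s t))"
      using AE_I2[of lborel] by blast
    with that show thesis by blast
  qed
  have shift: "integrable lborel (\<lambda>x. h (x + c))"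
    "(\<integral>x. h (x + c) * expi (t \<bullet> x) \<partial>lborel) = (\<integral>x. h x * expi (t \<bullet> x) \<partial>lborel) * expi (- (t \<bullet> c))"
    if "integrable lborel h" for h :: "'a \<Rightarrow> complex" and c t
  proof -
    have [measurable]: "h \<in> borel_measurable borel" using that by auto
    show "integrable lborel (\<lambda>x. h (x + c))"
      using integral_lborel_affine(2)[of h 1 c] that by (simp add: add.commute)
    have "(\<integral>x. h (x + c) * expi (t \<bullet> x) \<partial>lborel) = (\<integral>x. h (c + 1 *\<^sub>R x) * expi (t \<bullet> ((c + 1 *\<^sub>R x) - c)) \<partial>lborel)"
      by (simp add: add.commute)
    also have "\<dots> = (1 / \<bar>1\<bar> ^ DIM('a)) *\<^sub>R (\<integral>x. h x * expi (t \<bullet> (x - c)) \<partial>lborel)"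
      by (rule integral_lborel_affine(1)) auto
    also have "\<dots> = (\<integral>x. h x * expi (t \<bullet> x) \<partial>lborel) * expi (- (t \<bullet> c))"
      by (simp add: inner_diff_right expi_diff flip: mult.assoc)
    finally show "(\<integral>x. h (x + c) * expi (t \<bullet> x) \<partial>lborel) = (\<integral>x. h x * expi (t \<bullet> x) \<partial>lborel) * expi (- (t \<bullet> c))" .
  qed
  define b where "b = (\<lambda>y. W s0 (y + E s0) / f s0)"
  define a where "a = (\<lambda>x. Z t0 (x + E t0) / g t0)"
  have ai: "integrable lborel a" and bi: "integrable lborel b"
    using shift(1)[OF Zint[of t0]] shift(1)[OF Wint[of s0]] by (auto simp: a_def b_def)
  have bg: "AE t in lborel. (\<integral>y. b y * expi (t \<bullet> y) \<partial>lborel) = g t"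
    using s0(2)
  proof eventually_elim
    case (elim t)
    have "(\<integral>y. b y * expi (t \<bullet> y) \<partial>lborel) = (\<integral>y. W s0 (y + E s0) * expi (t \<bullet> y) \<partial>lborel) / f s0"
      by (simp add: b_def)
    also have "\<dots> = \<psi> s0 t * expi (- (t \<bullet> E s0)) / f s0"
      using shift(2)[OF Wint] by (simp add: W\<psi>)
    also have "\<dots> = g t"
      unfolding elim[symmetric] using s0(1) by (simp add: inner_commute mult.assoc)
    finally show ?case .
  qed
  have af: "AE s in lborel. (\<integral>x. a x * expi (s \<bullet> x) \<partial>lborel) = f s"
    using t0(2)
  proof eventually_elim
    case (elim s)
    have "(\<integral>x. a x * expi (s \<bullet> x) \<partial>lborel) = (\<integral>x. Z t0 (x + E t0) * expi (s \<bullet> x) \<partial>lborel) / g t0"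
      by (simp add: a_def)
    also have "\<dots> = \<psi> s t0 * expi (- (s \<bullet> E t0)) / g t0"
      using shift(2)[OF Zint] by (simp add: Z\<psi>)
    also have "\<dots> = f s"
      unfolding elim[symmetric] using t0(1) orth_projD(3)[OF E, of s t0] by (simp add: mult.assoc)
    finally show ?case .
  qed
  have [measurable]: "b \<in> borel_measurable borel" using bi by auto
  have "AE s in lborel. AE y in lborel. W s y = (\<integral>x. a x * expi (s \<bullet> x) \<partial>lborel) * b (y - E s)"
    using r1 af
  proof eventually_elim
    case (elim s)
    have ib: "integrable lborel (\<lambda>y. b (y - E s))" using shift(1)[OF bi, of "- E s"] by simp
    \<comment> \<open>Both terms have the transform f(s) g(t) \<open>expi (E s \<bullet> t)\<close>
      in \<open>y\<close>: for fixed \<open>s\<close> the chirp is a modulation in \<open>t\<close>,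
      dual to the translation by \<open>E s\<close>.\<close>
    have "AE y in lborel. W s y - f s * b (y - E s) = 0"
    proof (rule fourier_injective)
      show "integrable lborel (\<lambda>y. W s y - f s * b (y - E s))" using Wint ib by auto
      show "AE t in lborel. (\<integral>y. (W s y - f s * b (y - E s)) * expi (t \<bullet> y) \<partial>lborel) = 0"
        using elim(1) bg
      proof eventually_elim
        case (elim t)
        have "integrable lborel (\<lambda>y. W s y * expi (t \<bullet> y))" "integrable lborel (\<lambda>y. b (y - E s) * expi (t \<bullet> y))"
          by (rule integrable_mult_bounded[where C=1], use Wint ib in auto)+
        then have "(\<integral>y. (W s y - f s * b (y - E s)) * expi (t \<bullet> y) \<partial>lborel)
          = \<psi> s t - f s * (\<integral>y. b (y - E s) * expi (t \<bullet> y) \<partial>lborel)"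
          by (simp add: left_diff_distrib mult.assoc W\<psi>)
        also have "\<dots> = 0"
          using shift(2)[OF bi, of "- E s" t] elim by (simp add: inner_commute mult.assoc)
        finally show ?case .
      qed
    qed
    then show ?case unfolding elim(2) by eventually_elim simp
  qed
  then have z: "AE p in lborel \<Otimes>\<^sub>M lborel. \<Phi> p = 0"
    using partial_stft_finite_support[OF a0 \<Phi>1 \<Phi>2 fin ai bi] by (simp add: W_def)
  have "(\<integral>q. \<Phi> q * expi (s \<bullet> fst q + t \<bullet> snd q) \<partial>(lborel \<Otimes>\<^sub>M lborel)) = (\<integral>q. 0 \<partial>((lborel :: 'a measure) \<Otimes>\<^sub>M (lborel :: 'a measure)))" for s t :: 'a
    by (rule integral_cong_AE) (use z in \<open>auto elim!: eventually_mono\<close>)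
  then have "\<psi> s t = 0" for s t by (simp add: \<psi>_def)
  with s0 have "AE t in lborel. g t = 0" by simp
  with ng show False by simp
qed

end

section \<open>Linear changes of variables and representatives\<close>

text \<open>Uniqueness of Haar measure: by Fubini and translation invariance,
  \<open>|f\<^sup>-\<^sup>1 A| |Q| = |f\<^sup>-\<^sup>1 Q| |A|\<close> for the unit cube \<open>Q\<close>.\<close>

lemma lborel_linear_iso:
  fixes f :: "'a::euclidean_space \<Rightarrow> 'b::euclidean_space"
  assumes f: "linear f" and g: "linear g" and fg: "\<And>y. f (g y) = y" and gf: "\<And>x. g (f x) = x"
  shows "\<exists>\<kappa>>0. distr lborel borel f = density lborel (\<lambda>_. ennreal \<kappa>)"
proof -
  have [measurable]: "f \<in> borel_measurable borel" "g \<in> borel_measurable borel"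
    using f g by (auto intro!: borel_measurable_continuous_onI linear_continuous_on simp: linear_conv_bounded_linear)
  define Q where "Q = (box 0 One :: 'b set)"
  have [measurable]: "Q \<in> sets borel" by (simp add: Q_def)
  have Q1: "emeasure lborel Q = 1" by (simp add: Q_def emeasure_lborel_box_eq)
  define k where "k = emeasure lborel (f -` Q)"
  have fQ: "f -` Q = g ` Q" using fg gf by (auto simp: image_iff) metis
  have k1: "k < \<infinity>"
    unfolding k_def fQ
    by (rule emeasure_bounded_finite) (use g in \<open>auto intro!: bounded_linear_image simp: Q_def linear_conv_bounded_linear\<close>)
  have vim[measurable]: "f -` A \<in> sets borel" if "A \<in> sets borel" for A
    using measurable_sets[of f borel borel A] that by simp
  have main: "emeasure lborel (f -` A) = k * emeasure lborel A" if [measurable]: "A \<in> sets borel" for A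
  proof -
    have ind: "emeasure lborel (f -` S) = (\<integral>\<^sup>+x. indicator S (f x) \<partial>lborel)" if [measurable]: "S \<in> sets borel" for S
    proof -
      have "emeasure lborel (f -` S) = (\<integral>\<^sup>+x. indicator (f -` S) x \<partial>lborel)"
        using vim[OF that] by (simp add: nn_integral_indicator)
      then show ?thesis by (simp add: indicator_def)
    qed
    \<comment> \<open>The cube enters as the factor |Q| = 1, translated by \<open>f x\<close>; the
      substitution x to x - g y below then moves the translation from \<open>Q\<close> to
      \<open>A\<close>, after which the \<open>y\<close>-integral evaluates to |A|.\<close>
    have "emeasure lborel (f -` A) = (\<integral>\<^sup>+x. indicator A (f x) * (\<integral>\<^sup>+y. indicator Q y \<partial>lborel) \<partial>lborel)"
      using Q1 ind[of A] by simp
    also have "\<dots> = (\<integral>\<^sup>+x. indicator A (f x) * (\<integral>\<^sup>+y. indicator Q (f x + 1 *\<^sub>R y) \<partial>lborel) \<partial>lborel)"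
      by (subst nn_integral_lborel_affine) auto
    also have "\<dots> = (\<integral>\<^sup>+x. \<integral>\<^sup>+y. indicator A (f x) * indicator Q (f x + y) \<partial>lborel \<partial>lborel)"
      by (subst nn_integral_cmult[symmetric]) auto
    also have "\<dots> = (\<integral>\<^sup>+y. \<integral>\<^sup>+x. indicator A (f x) * indicator Q (f x + y) \<partial>lborel \<partial>lborel)"
      by (rule lborel_pair.Fubini'[symmetric]) measurable
    also have "\<dots> = (\<integral>\<^sup>+y. \<integral>\<^sup>+x. indicator A (f (- g y + 1 *\<^sub>R x)) * indicator Q (f (- g y + 1 *\<^sub>R x) + y) \<partial>lborel \<partial>lborel)"
    proof (rule nn_integral_cong)
      fix y
      show "(\<integral>\<^sup>+x. indicator A (f x) * indicator Q (f x + y) \<partial>lborel)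
        = (\<integral>\<^sup>+x. indicator A (f (- g y + 1 *\<^sub>R x)) * indicator Q (f (- g y + 1 *\<^sub>R x) + y) \<partial>lborel)"
        using nn_integral_lborel_affine[of "\<lambda>x. indicator A (f x) * indicator Q (f x + y)" 1 "- g y"] by simp
    qed
    also have "\<dots> = (\<integral>\<^sup>+y. \<integral>\<^sup>+x. indicator A (f x - y) * indicator Q (f x) \<partial>lborel \<partial>lborel)"
      using linear_add[OF f] linear_neg[OF f] linear_diff[OF f] by (simp add: fg)
    also have "\<dots> = (\<integral>\<^sup>+x. \<integral>\<^sup>+y. indicator A (f x - y) * indicator Q (f x) \<partial>lborel \<partial>lborel)"
      by (rule lborel_pair.Fubini') measurable
    also have "\<dots> = (\<integral>\<^sup>+x. (\<integral>\<^sup>+y. indicator A (f x + (-1) *\<^sub>R y) \<partial>lborel) * indicator Q (f x) \<partial>lborel)"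
      by (subst nn_integral_multc[symmetric]) auto
    also have "\<dots> = (\<integral>\<^sup>+x. emeasure lborel A * indicator Q (f x) \<partial>lborel)"
      by (subst nn_integral_lborel_affine) auto
    also have "\<dots> = emeasure lborel A * k"
      by (subst nn_integral_cmult) (auto simp: k_def ind)
    finally show ?thesis by (simp add: mult.commute)
  qed
  have "k \<noteq> 0"
  proof
    assume "k = 0"
    with main[of UNIV] have "emeasure (lborel :: 'a measure) UNIV = 0" by simp
    then show False by simp
  qed
  then obtain \<kappa> where \<kappa>: "k = ennreal \<kappa>" "\<kappa> > 0"
    using k1 by (cases k) (auto simp: less_le)
  have "distr lborel borel f = density lborel (\<lambda>_. ennreal \<kappa>)"
    by (rule measure_eqI) (auto simp: emeasure_distr main emeasure_density \<kappa> nn_integral_cmult_indicator)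
  with \<kappa> show ?thesis by blast
qed

text \<open>Domain and codomain may be different types, as for pairs and \<open>vjoin\<close>, so
  the Jacobian is an abstract constant; one and the same constant serves all the forms of the
  integral.\<close>

lemma lborel_linear_iso_obtain:
  fixes f :: "'a::euclidean_space \<Rightarrow> 'b::euclidean_space"
  assumes f: "linear f" and g: "linear g" and fg: "\<And>y. f (g y) = y" and gf: "\<And>x. g (f x) = x"
  obtains \<kappa> :: real where "\<kappa> > 0"
    "\<And>h. h \<in> borel_measurable borel \<Longrightarrow> (\<integral>\<^sup>+x. h (f x) \<partial>lborel) = ennreal \<kappa> * (\<integral>\<^sup>+x. h x \<partial>lborel)"
    "\<And>h :: 'b \<Rightarrow> complex. h \<in> borel_measurable borel \<Longrightarrow> (\<integral>x. h (f x) \<partial>lborel) = of_real \<kappa> * (\<integral>x. h x \<partial>lborel)"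
    "\<And>h :: 'b \<Rightarrow> complex. h \<in> borel_measurable borel \<Longrightarrow> integrable lborel (\<lambda>x. h (f x)) \<longleftrightarrow> integrable lborel h"
    "\<And>P. AE x in lborel. P x \<Longrightarrow> AE x in lborel. P (f x)"
proof -
  obtain \<kappa> where \<kappa>: "\<kappa> > 0" "distr lborel borel f = density lborel (\<lambda>_. ennreal \<kappa>)"
    using lborel_linear_iso[OF assms] by blast
  have [measurable]: "f \<in> borel_measurable borel"
    using f by (auto intro!: borel_measurable_continuous_onI linear_continuous_on simp: linear_conv_bounded_linear)
  show thesis
  proof (rule that[OF \<kappa>(1)])
    fix h :: "'b \<Rightarrow> ennreal" assume [measurable]: "h \<in> borel_measurable borel"
    have "(\<integral>\<^sup>+x. h (f x) \<partial>lborel) = (\<integral>\<^sup>+x. h x \<partial>distr lborel borel f)" by (subst nn_integral_distr) auto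
    then show "(\<integral>\<^sup>+x. h (f x) \<partial>lborel) = ennreal \<kappa> * (\<integral>\<^sup>+x. h x \<partial>lborel)"
      by (simp add: \<kappa>(2) nn_integral_density nn_integral_cmult)
  next
    fix h :: "'b \<Rightarrow> complex" assume [measurable]: "h \<in> borel_measurable borel"
    have "(\<integral>x. h (f x) \<partial>lborel) = (\<integral>x. h x \<partial>distr lborel borel f)" by (subst integral_distr) auto
    then show "(\<integral>x. h (f x) \<partial>lborel) = of_real \<kappa> * (\<integral>x. h x \<partial>lborel)"
      using \<kappa>(1) by (simp add: \<kappa>(2) integral_density scaleR_conv_of_real)
    have "integrable lborel (\<lambda>x. h (f x)) \<longleftrightarrow> integrable (distr lborel borel f) h" by (subst integrable_distr_eq) auto
    also have "\<dots> \<longleftrightarrow> integrable lborel (\<lambda>x. of_real \<kappa> * h x)"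
      using \<kappa>(1) by (simp add: \<kappa>(2) integrable_density scaleR_conv_of_real)
    also have "\<dots> \<longleftrightarrow> integrable lborel h"
      using \<kappa>(1) integrable_mult_right[of "of_real (1 / \<kappa>)" lborel "\<lambda>x. of_real \<kappa> * h x"] by auto
    finally show "integrable lborel (\<lambda>x. h (f x)) \<longleftrightarrow> integrable lborel h" .
  next
    fix P assume "AE x in lborel. P (x::'b)"
    then have "AE x in density lborel (\<lambda>_. ennreal \<kappa>). P x"
      by (subst AE_density) (auto elim!: eventually_mono)
    then show "AE x in lborel. P (f x)"
      unfolding \<kappa>(2)[symmetric] by (rule AE_distrD[rotated]) measurable
  qed
qed

lemma AE_lborel_affine:
  fixes t :: "'a::euclidean_space"
  assumes "AE x in lborel. P x" and "c \<noteq> 0"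
  shows "AE x in lborel. P (t + c *\<^sub>R x)"
proof -
  have "AE x in density lborel (\<lambda>_. ennreal (1 / \<bar>c\<bar> ^ DIM('a))). P x"
    using assms(1) by (subst AE_density) (auto elim!: eventually_mono)
  then have "AE x in distr lborel borel (\<lambda>x. t + c *\<^sub>R x). P x"
    by (simp only: lborel_distr_affine[OF assms(2)])
  then show ?thesis by (rule AE_distrD[rotated]) measurable
qed

text \<open>The exceptional set of \<open>t\<close> depends on \<open>w\<close>, so Fubini is used
  to find one \<open>t\<close> that is good for almost every \<open>w\<close>. Then s = t - w runs
  through almost all points, and Q(s) is determined by Q(t).\<close>

lemma const_if_quotients_const:
  fixes Q :: "'a::euclidean_space \<Rightarrow> complex"
  assumes [measurable]: "Q \<in> borel_measurable borel"
    and q: "\<And>w. AE t in lborel. Q t * cnj (Q (t - w)) = \<kappa>" and k: "\<kappa> \<noteq> 0"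
  shows "\<exists>c. AE t in lborel. Q t = c"
proof -
  have "AE w in lborel. AE t in lborel. Q t * cnj (Q (t - w)) = \<kappa>" using q by simp
  then have "AE t in lborel. AE w in lborel. Q t * cnj (Q (t - w)) = \<kappa>"
  proof (rule lborel_pair.AE_commute[THEN iffD1, rotated])
    show "{p \<in> space (lborel \<Otimes>\<^sub>M lborel). Q (snd p) * cnj (Q (snd p - fst p)) = \<kappa>} \<in> sets (lborel \<Otimes>\<^sub>M lborel)"
      by measurable
  qed
  moreover have "\<not> (AE t in lborel::'a measure. False)"
    by (simp add: eventually_False ae_filter_eq_bot_iff)
  ultimately obtain t where "AE w in lborel. Q t * cnj (Q (t - w)) = \<kappa>"
    using AE_mp AE_I2 by (metis (mono_tags, lifting) eventually_mono)
  from AE_lborel_affine[OF this, of "-1" t]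
  have "AE s in lborel. Q t * cnj (Q s) = \<kappa>" by simp
  then have "AE s in lborel. Q s = cnj (\<kappa> / Q t)"
  proof eventually_elim
    case (elim s)
    with k have "Q t \<noteq> 0" by auto
    with elim have "cnj (Q s) = \<kappa> / Q t" by (simp add: field_simps)
    then show ?case by (metis complex_cnj_cnj)
  qed
  then show ?thesis by blast
qed

section \<open>Borel representatives of square-integrable functions\<close>

lemma borel_representative:
  fixes f :: "'a::euclidean_space \<Rightarrow> complex"
  assumes f: "f \<in> borel_measurable lebesgue"
  obtains g where "g \<in> borel_measurable borel" "AE x in lborel. f x = g x"
proof -
  have "(\<lambda>x. Re (f x)) \<in> borel_measurable lebesgue" "(\<lambda>x. Im (f x)) \<in> borel_measurable lebesgue"
    using f by auto
  from this[THEN completion_ex_borel_measurable_real]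
  obtain a b where [measurable]: "a \<in> borel_measurable borel" "b \<in> borel_measurable borel"
    and ab: "AE x in lborel. Re (f x) = a x" "AE x in lborel. Im (f x) = b x" by auto
  show thesis
  proof
    show "(\<lambda>x. of_real (a x) + \<i> * of_real (b x)) \<in> borel_measurable borel" by measurable
    show "AE x in lborel. f x = of_real (a x) + \<i> * of_real (b x)"
      using ab by eventually_elim (simp add: complex_eq_iff)
  qed
qed

lemma aeq_lborel: "aeq f g \<longleftrightarrow> (AE x in lborel. f x = g x)"
  by (simp add: aeq_def AE_completion_iff)

lemma borel_measurable_lebesgueI: "f \<in> borel_measurable borel \<Longrightarrow> f \<in> borel_measurable lebesgue"
  by (simp add: measurable_completion)

lemma borel_in_L2_iff:
  assumes "f \<in> borel_measurable borel"
  shows "f \<in> L2 \<longleftrightarrow> sqi lborel f"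
proof -
  have [measurable]: "f \<in> borel_measurable borel" by fact
  have "(\<lambda>x. (cmod (f x))\<^sup>2) \<in> borel_measurable lborel" by measurable
  then show ?thesis
    using assms by (simp add: L2_def sqi_def borel_measurable_lebesgueI integrable_completion)
qed

lemma L2_aeq:
  assumes f: "f \<in> L2" and g[measurable]: "g \<in> borel_measurable lebesgue" and fg: "aeq f g"
  shows "g \<in> L2"
  unfolding L2_def
proof (rule CollectI, intro conjI g)
  have [measurable]: "f \<in> borel_measurable lebesgue" using f by (simp add: L2_def)
  have "AE x in lebesgue. (cmod (f x))\<^sup>2 = (cmod (g x))\<^sup>2"
    using fg unfolding aeq_def by eventually_elim simp
  from integrable_cong_AE[OF _ _ this] show "integrable lebesgue (\<lambda>x. (cmod (g x))\<^sup>2)"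
    using f by (auto simp: L2_def)
qed

lemma L2_representative:
  assumes f: "f \<in> L2"
  obtains g where "g \<in> borel_measurable borel" "aeq f g" "sqi lborel g" "g \<in> L2"
proof -
  have "f \<in> borel_measurable lebesgue" using f by (simp add: L2_def)
  then obtain g where g: "g \<in> borel_measurable borel" "AE x in lborel. f x = g x"
    by (rule borel_representative)
  then have "g \<in> L2" using L2_aeq[OF f] by (auto simp: aeq_lborel borel_measurable_lebesgueI)
  with g that show thesis by (auto simp: aeq_lborel borel_in_L2_iff)
qed

lemma L2_inner_cong_borel:
  assumes f: "f \<in> L2" "aeq f f'" and g: "g \<in> L2" "aeq g g'"
    and [measurable]: "f' \<in> borel_measurable borel" "g' \<in> borel_measurable borel"
  shows "L2_inner f g = (\<integral>x. f' x * cnj (g' x) \<partial>lborel)"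
proof -
  have [measurable]: "f \<in> borel_measurable lebesgue" "g \<in> borel_measurable lebesgue"
    using f g by (auto simp: L2_def)
  have m: "(\<lambda>x. f' x * cnj (g' x)) \<in> borel_measurable borel" by measurable
  have m': "(\<lambda>x. f x * cnj (g x)) \<in> borel_measurable lebesgue" by measurable
  have "AE x in lebesgue. f x * cnj (g x) = f' x * cnj (g' x)"
    using f(2) g(2) unfolding aeq_def by eventually_elim simp
  then have "L2_inner f g = (\<integral>x. f' x * cnj (g' x) \<partial>lebesgue)"
    unfolding L2_inner_def by (intro integral_cong_AE m' borel_measurable_lebesgueI[OF m])
  then show ?thesis using m by (simp add: integral_completion)
qed

section \<open>Time-frequency shifts in split coordinates\<close>

definition vjoin :: "real ^ 'n::finite \<Rightarrow> real ^ 'n \<Rightarrow> real ^ ('n + 'n)" where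
  "vjoin x y = (\<chi> i. case i of Inl k \<Rightarrow> x $ k | Inr k \<Rightarrow> y $ k)"

lemma vfst_vjoin[simp]: "vfst (vjoin x y) = x" and vsnd_vjoin[simp]: "vsnd (vjoin x y) = y"
  and vjoin_vfst_vsnd[simp]: "vjoin (vfst z) (vsnd z) = z"
  by (auto simp: vfst_def vsnd_def vjoin_def vec_eq_iff split: sum.split)

lemma block_mat_vjoin: "block_mat A B C D *v vjoin x y = vjoin (A *v x + B *v y) (C *v x + D *v y)"
  by (auto simp: vec_eq_iff block_mat_def vjoin_def matrix_vector_mult_def sum_UNIV_Plus split: sum.split)

lemma inner_vjoin: "vjoin x y \<bullet> vjoin x' y' = x \<bullet> x' + y \<bullet> y'"
  by (simp add: vjoin_def inner_vec_def sum_UNIV_Plus)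

lemma rho_vjoin: "rho (vjoin x w) f t = expi (w \<bullet> (t - x /\<^sub>R 2)) * f (t - x)"
proof -
  have "t - x /\<^sub>R 2 - x /\<^sub>R 2 = t - x"
    by (simp add: algebra_simps flip: scaleR_add_left)
  then show ?thesis
    by (simp add: rho_def translation_def modulation_def expi_def cis_conv_exp mult_ac)
qed

lemma rho_eq: "rho z f t = expi (vsnd z \<bullet> (t - vfst z /\<^sub>R 2)) * f (t - vfst z)"
  using rho_vjoin[of "vfst z" "vsnd z" f t] by simp

lemma rho_measurable:
  assumes [measurable]: "f \<in> borel_measurable borel"
  shows "rho z f \<in> borel_measurable borel"
proof -
  have "rho z f = (\<lambda>t. expi (vsnd z \<bullet> (t - vfst z /\<^sub>R 2)) * f (t - vfst z))"
    by (intro ext rho_eq)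
  then show ?thesis by simp
qed

lemma sqi_rho:
  assumes f: "sqi lborel f" shows "sqi lborel (rho z f)"
proof -
  have [measurable]: "f \<in> borel_measurable borel" using sqi_measurable[OF f] by simp
  have 1: "(cmod (rho z f t))\<^sup>2 = (cmod (f (- vfst z + 1 *\<^sub>R t)))\<^sup>2" for t
    by (simp add: rho_eq norm_mult)
  have "integrable lborel (\<lambda>t. (cmod (f (- vfst z + 1 *\<^sub>R t)))\<^sup>2)"
    by (subst integral_lborel_affine(2)[of "\<lambda>t. (cmod (f t))\<^sup>2"]) (use f in \<open>auto simp: sqi_def\<close>)
  then show ?thesis
    using rho_measurable[of f z] by (simp add: sqi_def 1)
qed

lemma aeq_rho:
  assumes "aeq f g" shows "aeq (rho z f) (rho z g)"
proof -
  from assms have "AE t in lborel. f (- vfst z + 1 *\<^sub>R t) = g (- vfst z + 1 *\<^sub>R t)"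
    unfolding aeq_lborel by (rule AE_lborel_affine) simp
  then have "AE t in lborel. rho z f t = rho z g t"
    by eventually_elim (simp add: rho_eq)
  then show ?thesis by (simp add: aeq_lborel)
qed

lemma aeq_trans: "aeq f g \<Longrightarrow> aeq g h \<Longrightarrow> aeq f h"
  unfolding aeq_def by (erule (1) eventually_elim2) simp

lemma aeq_sym: "aeq f g \<Longrightarrow> aeq g f"
  unfolding aeq_def by (erule eventually_mono) simp

text \<open>This is the ambiguity function of the Gaussian: up to a constant, exp(-\<pi> |x|^2 / 2 -
  \<pi> |w|^2 / 2) times the phase exp(-\<pi> i x . w), which is visibly symmetric. The exchange
  allows an inner product to be read as a Fourier integral in the other variable.\<close>

lemma gauss_correlation_symmetric:
  fixes x w :: "'a::euclidean_space"
  shows "(\<integral>y. of_real (gam (y - x) * gam y) * expi (- (w \<bullet> y)) \<partial>lborel)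
       = (\<integral>y. of_real (gam (y - w) * gam y) * expi (- (x \<bullet> y)) \<partial>lborel)"
proof -
  \<comment> \<open>Completing the square, |y - x|^2 + |y|^2 = 2 |y - x/2|^2 + |x|^2 / 2, so y = x/2
    + c u restores the standard Gaussian in \<open>u\<close>.\<close>
  define c where "c = 1 / sqrt 2"
  have c: "c > 0" "c\<^sup>2 = 1/2" by (auto simp: c_def power_divide)
  have closed: "(1 / c ^ DIM('a)) *\<^sub>R (\<integral>y. of_real (gam (y - x) * gam y) * expi (- (w \<bullet> y)) \<partial>lborel)
     = of_real (exp (- pi * (norm x)\<^sup>2 / 2) * exp (- pi * (norm w)\<^sup>2 / 2)) * expi (- (w \<bullet> x) / 2)" for x w :: 'a
  proof -
    let ?h = "\<lambda>y. complex_of_real (gam (y - x) * gam y) * expi (- (w \<bullet> y))"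
    have "(1 / c ^ DIM('a)) *\<^sub>R (\<integral>y. ?h y \<partial>lborel) = (\<integral>u. ?h (x /\<^sub>R 2 + c *\<^sub>R u) \<partial>lborel)"
      using c by (subst integral_lborel_affine(1)) auto
    also have "\<dots> = (\<integral>u. of_real (exp (- pi * (norm x)\<^sup>2 / 2)) * expi (- (w \<bullet> x) / 2) * (of_real (gam u) * expi ((- c *\<^sub>R w) \<bullet> u)) \<partial>lborel)"
    proof (rule Bochner_Integration.integral_cong[OF refl])
      fix u
      have "(norm (x /\<^sub>R 2 + c *\<^sub>R u - x))\<^sup>2 + (norm (x /\<^sub>R 2 + c *\<^sub>R u))\<^sup>2
         = 2 * (c\<^sup>2 * (norm u)\<^sup>2) + (norm x)\<^sup>2 / 2"
      proof -
        have "x /\<^sub>R 2 + c *\<^sub>R u - x = c *\<^sub>R u - x /\<^sub>R 2"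
        proof -
          have "x /\<^sub>R 2 + x /\<^sub>R 2 = x" by (simp flip: scaleR_add_left)
          then have "x - x /\<^sub>R 2 = x /\<^sub>R 2" by (metis add_diff_cancel_left')
          moreover have "x /\<^sub>R 2 + c *\<^sub>R u - x = c *\<^sub>R u - (x - x /\<^sub>R 2)" by (simp only: diff_diff_eq2 add.commute)
          ultimately show ?thesis by simp
        qed
        then show ?thesis
          unfolding power2_norm_eq_inner
          by (simp add: inner_add_left inner_add_right inner_diff_left inner_diff_right inner_commute power2_eq_square field_simps)
      qed
      also have "\<dots> = (norm u)\<^sup>2 + (norm x)\<^sup>2 / 2" by (simp add: c)
      finally have n: "(norm (x /\<^sub>R 2 + c *\<^sub>R u - x))\<^sup>2 + (norm (x /\<^sub>R 2 + c *\<^sub>R u))\<^sup>2 = (norm u)\<^sup>2 + (norm x)\<^sup>2 / 2" .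
      have "gam a * gam b = exp (- pi * ((norm a)\<^sup>2 + (norm b)\<^sup>2))" for a b :: 'a
        by (simp add: gam_def distrib_left flip: exp_add)
      then have "gam (x /\<^sub>R 2 + c *\<^sub>R u - x) * gam (x /\<^sub>R 2 + c *\<^sub>R u) = exp (- pi * ((norm u)\<^sup>2 + (norm x)\<^sup>2 / 2))"
        by (simp only: n)
      also have "\<dots> = gam u * exp (- pi * (norm x)\<^sup>2 / 2)"
        by (simp add: gam_def distrib_left flip: exp_add)
      finally have "gam (x /\<^sub>R 2 + c *\<^sub>R u - x) * gam (x /\<^sub>R 2 + c *\<^sub>R u) = gam u * exp (- pi * (norm x)\<^sup>2 / 2)" .
      moreover have "expi (- (w \<bullet> (x /\<^sub>R 2 + c *\<^sub>R u))) = expi (- (w \<bullet> x) / 2) * expi ((- c *\<^sub>R w) \<bullet> u)"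
        by (simp add: inner_add_right flip: expi_add)
      ultimately show "?h (x /\<^sub>R 2 + c *\<^sub>R u)
         = of_real (exp (- pi * (norm x)\<^sup>2 / 2)) * expi (- (w \<bullet> x) / 2) * (of_real (gam u) * expi ((- c *\<^sub>R w) \<bullet> u))"
        by simp
    qed
    also have "\<dots> = of_real (exp (- pi * (norm x)\<^sup>2 / 2)) * expi (- (w \<bullet> x) / 2) * of_real (gam (- c *\<^sub>R w))"
      using gauss_fourier(1)[where s="- c *\<^sub>R w"] by simp
    also have "gam (- c *\<^sub>R w) = exp (- pi * (norm w)\<^sup>2 / 2)"
      by (simp add: gam_def power_mult_distrib c)
    finally show ?thesis by simp
  qed
  have "(1 / c ^ DIM('a)) *\<^sub>R (\<integral>y. of_real (gam (y - x) * gam y) * expi (- (w \<bullet> y)) \<partial>lborel)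
     = (1 / c ^ DIM('a)) *\<^sub>R (\<integral>y. of_real (gam (y - w) * gam y) * expi (- (x \<bullet> y)) \<partial>lborel)"
    unfolding closed by (simp add: inner_commute mult.commute)
  then show ?thesis
    unfolding scaleR_cancel_left using c(1) by auto
qed

section \<open>The integral formula for metaplectic operators\<close>

lemma matrix_inv_mult:
  fixes B :: "real ^ 'n::finite ^ 'n"
  assumes "invertible B"
  shows "B ** matrix_inv B = mat 1" "matrix_inv B ** B = mat 1"
    "B *v (matrix_inv B *v x) = x" "matrix_inv B *v (B *v x) = x"
proof -
  show 1: "B ** matrix_inv B = mat 1" "matrix_inv B ** B = mat 1"
    using someI_ex[OF assms[unfolded invertible_def]] by (simp_all add: matrix_inv_def)
  show "B *v (matrix_inv B *v x) = x" "matrix_inv B *v (B *v x) = x"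
    using 1 by (simp_all add: matrix_vector_mul_assoc)
qed

lemma inner_matrix_transpose: "(transpose A *v x) \<bullet> y = x \<bullet> ((A :: real ^ 'n::finite ^ 'm::finite) *v y)"
  by (simp add: dot_lmul_matrix)

lemma inner_symmetric_matrix:
  "transpose A = A \<Longrightarrow> (A *v x) \<bullet> y = x \<bullet> ((A :: real ^ 'n::finite ^ 'n) *v y)"
  using inner_matrix_transpose[of A x y] by simp

lemma quadratic_diff:
  fixes A :: "real ^ 'n::finite ^ 'n"
  assumes "transpose A = A"
  shows "(y - x) \<bullet> (A *v (y - x)) = y \<bullet> (A *v y) - 2 * (x \<bullet> (A *v y)) + x \<bullet> (A *v x)"
  using inner_symmetric_matrix[OF assms, of x y]
  by (simp add: matrix_vector_mult_diff_distrib inner_diff_left inner_diff_right inner_commute)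

text \<open>Both facts are rearrangements of B^t D = D^t B and B^t C - D^t A = -1. The second
  computes the frequency component left over on the graph of -B^-1 A, where the position component
  cancels.\<close>

lemma symplectic_inv_B:
  fixes A B C D :: "real ^ 'n::finite ^ 'n"
  assumes S: "block_mat A B C D \<in> Sp" and B: "invertible B"
  defines "Bi \<equiv> matrix_inv B"
  shows "transpose (D ** Bi) = D ** Bi"
    and "C *v x - D *v ((Bi ** A) *v x) = - (transpose Bi *v x)"
proof -
  have neg: "X ** (- Y) = - (X ** Y)" "(- X) ** Y = - (X ** Y)" for X Y :: "real ^ 'n ^ 'n"
    by (auto simp: vec_eq_iff matrix_matrix_mult_def sum_negf)
  have "transpose (block_mat A B C D) ** sympl_J ** block_mat A B C D = sympl_J"
    using S by (simp add: Sp_def)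
  then have eqs: "transpose B ** C - transpose D ** A = - mat 1" "transpose B ** D - transpose D ** B = 0"
    by (simp_all add: sympl_J_def transpose_block_mat block_mat_mult block_mat_eq_iff neg)
  note Bi = matrix_inv_mult[OF B, folded Bi_def]
  have Bt: "transpose Bi ** transpose B = mat 1"
    by (metis Bi(1) matrix_transpose_mul transpose_mat)
  have "transpose D = transpose B ** D ** Bi"
  proof -
    have "transpose B ** D = transpose D ** B" using eqs(2) by simp
    then have "transpose B ** D ** Bi = transpose D ** (B ** Bi)" by (simp add: matrix_mul_assoc)
    then show ?thesis by (simp add: Bi)
  qed
  then have "transpose Bi ** transpose D = (transpose Bi ** transpose B) ** D ** Bi"
    by (simp add: matrix_mul_assoc)
  then show sym: "transpose (D ** Bi) = D ** Bi"
    by (simp add: matrix_transpose_mul Bt)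
  have "transpose B ** C = transpose D ** A - mat 1" using eqs(1) by (simp add: algebra_simps)
  then have "transpose Bi *v ((transpose B ** C) *v x) = transpose Bi *v ((transpose D ** A) *v x - x)"
    by (simp add: matrix_vector_mult_diff_rdistrib)
  moreover have "transpose Bi *v ((transpose B ** C) *v x) = C *v x"
    by (metis Bt matrix_mul_lid matrix_vector_mul_assoc matrix_mul_assoc)
  moreover have "transpose Bi *v ((transpose D ** A) *v x) = D *v ((Bi ** A) *v x)"
    by (metis sym matrix_transpose_mul matrix_vector_mul_assoc)
  ultimately have "C *v x = D *v ((Bi ** A) *v x) - transpose Bi *v x"
    by (simp only: matrix_vector_mult_diff_distrib)
  then show "C *v x - D *v ((Bi ** A) *v x) = - (transpose Bi *v x)" by simp
qed

lemma mv_measurable[measurable]: "(*v) (M :: real ^ 'm::finite ^ 'k::finite) \<in> borel_measurable borel"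
  by (intro borel_measurable_continuous_onI linear_continuous_on)
     (simp add: linear_conv_bounded_linear[symmetric])

lemma gam_square_integrable: "integrable lborel (\<lambda>y::'a::euclidean_space. (gam y)\<^sup>2)"
  by (rule Bochner_Integration.integrable_bound[OF gauss_fourier(2)])
     (auto simp: power2_eq_square mult_left_le)

locale metaplectic_B =
  fixes A B C D :: "real ^ 'n::finite ^ 'n" and U :: "(real ^ 'n \<Rightarrow> complex) \<Rightarrow> (real ^ 'n \<Rightarrow> complex)"
  assumes S: "block_mat A B C D \<in> Sp" and B: "invertible B" and U: "metaplectic (block_mat A B C D) U"
begin

definition "Bi = matrix_inv B"
text \<open>\<open>P\<close> and \<open>\<Lambda>\<close> are the quadratic forms in the generating
  function of a symplectic matrix with invertible upper right block. The classical kernel of the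
  operator is, up to a constant, the exponential of \<pi> i (t . \<Lambda> t - 2 (B^-1 t) . y + y .
  P y), and the inverse formula below contains its conjugate.\<close>

definition "P = Bi ** A"
definition "\<Lambda> = D ** Bi"

text \<open>The operator \<open>U\<close> is determined, up to a scalar, by its value on the chirped Gaussian \<open>K\<close>,
  which must be a multiple of \<open>Kc\<close>.\<close>

definition "K y = expi (- (y \<bullet> (P *v y)) / 2) * of_real (gam y)"
definition "Kc t = expi ((t \<bullet> (\<Lambda> *v t)) / 2) * of_real (gam (Bi *v t))"

lemma P_sym: "transpose P = P" and L_sym: "transpose \<Lambda> = \<Lambda>"
  using symmetric_inv_B_A[OF S B] symplectic_inv_B(1)[OF S B] by (simp_all add: P_def \<Lambda>_def Bi_def)

lemmas Bi_simps[simp] = matrix_inv_mult(3,4)[OF B, folded Bi_def]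

lemma mat_vertical: "block_mat A B C D *v vjoin 0 w = vjoin (B *v w) (D *v w)"
  by (simp add: block_mat_vjoin)

text \<open>The matrix -\<open>P\<close> is what makes the position component A x - B P x vanish:
  shifts along its graph become pure modulations.\<close>

lemma mat_graph: "block_mat A B C D *v vjoin x (- (P *v x)) = vjoin 0 (- (transpose Bi *v x))"
proof -
  have "A *v x = B *v (P *v x)" by (simp add: P_def flip: matrix_vector_mul_assoc)
  moreover have "C *v x - D *v (P *v x) = - (transpose Bi *v x)"
    using symplectic_inv_B(2)[OF S B, of x] by (simp add: P_def Bi_def)
  moreover have "M *v (- v) = - (M *v v)" for M :: "real ^ 'n ^ 'n" and v
    using matrix_vector_mult_diff_distrib[of M 0 v] by simp
  ultimately show ?thesis by (simp add: block_mat_vjoin)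
qed

lemma L_B: "\<Lambda> *v (B *v w) = D *v w"
  by (simp add: \<Lambda>_def flip: matrix_vector_mul_assoc)

lemma K_measurable[measurable]: "K \<in> borel_measurable borel" and Kc_measurable[measurable]: "Kc \<in> borel_measurable borel"
  unfolding K_def[abs_def] Kc_def[abs_def] by measurable

lemma Kc_nonzero: "Kc t \<noteq> 0" by (simp add: Kc_def)

text \<open>The phase of the shift and the change of the chirp cancel, so along the graph of
  -\<open>P\<close> only the Gaussian moves. This is why \<open>K\<close> carries this
  chirp.\<close>

lemma rho_graph_K: "rho (vjoin x (- (P *v x))) K y = expi (- (y \<bullet> (P *v y)) / 2) * of_real (gam (y - x))"
proof -
  have "- (P *v x) \<bullet> (y - x /\<^sub>R 2) + - ((y - x) \<bullet> (P *v (y - x))) / 2 = - (y \<bullet> (P *v y)) / 2"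
    unfolding quadratic_diff[OF P_sym] using inner_symmetric_matrix[OF P_sym, of x y]
    by (simp add: inner_diff_right inner_commute field_simps)
  then show ?thesis
    by (simp add: rho_vjoin K_def flip: expi_add mult.assoc)
qed

lemma rho_vertical: "rho (vjoin 0 w) f y = expi (w \<bullet> y) * f y"
  by (simp add: rho_vjoin)

text \<open>The counterpart on the image side: since \<Lambda> B = D, these shifts preserve the
  chirp of \<open>Kc\<close>. The factor \<open>q\<close> is general in order to serve both for the
  unknown quotient of \<open>U K\<close> by \<open>Kc\<close> and, later, for a constant.\<close>

lemma rho_BD: "rho (vjoin (B *v w) (D *v w)) (\<lambda>t. q t * Kc t) t
   = q (t - B *v w) * expi ((t \<bullet> (\<Lambda> *v t)) / 2) * of_real (gam (Bi *v t - w))"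
proof -
  have "(D *v w) \<bullet> (t - (B *v w) /\<^sub>R 2) + ((t - B *v w) \<bullet> (\<Lambda> *v (t - B *v w))) / 2 = (t \<bullet> (\<Lambda> *v t)) / 2"
    unfolding quadratic_diff[OF L_sym] using inner_symmetric_matrix[OF L_sym, of "B *v w" t]
    by (simp add: L_B inner_diff_right inner_commute field_simps)
  then have "expi ((D *v w) \<bullet> (t - (B *v w) /\<^sub>R 2)) * expi (((t - B *v w) \<bullet> (\<Lambda> *v (t - B *v w))) / 2) = expi ((t \<bullet> (\<Lambda> *v t)) / 2)"
    by (simp only: expi_add[symmetric])
  moreover have "Bi *v (t - B *v w) = Bi *v t - w" by (simp add: matrix_vector_mult_diff_distrib)
  ultimately show ?thesis
    by (simp add: rho_vjoin Kc_def mult_ac)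
qed

lemma sqi_K: "sqi lborel K"
  using gam_square_integrable by (simp add: sqi_def K_def norm_mult)

lemma K_L2: "K \<in> L2"
  using sqi_K borel_in_L2_iff[OF K_measurable] by simp

lemma rho_K_L2: "rho z K \<in> L2"
  using sqi_rho[OF sqi_K] borel_in_L2_iff[OF rho_measurable[OF K_measurable]] by simp

lemma U_L2: "f \<in> L2 \<Longrightarrow> U f \<in> L2"
  and U_inner: "f \<in> L2 \<Longrightarrow> g \<in> L2 \<Longrightarrow> L2_inner (U f) (U g) = L2_inner f g"
  and U_rho: "f \<in> L2 \<Longrightarrow> aeq (rho (block_mat A B C D *v z) (U f)) (U (rho z f))"
  using U by (auto simp: metaplectic_def unitary_L2_def)

lemma B_linear_iso:
  obtains \<kappa> :: real where "\<kappa> > 0"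
    "\<And>h :: real ^ 'n \<Rightarrow> complex. h \<in> borel_measurable borel \<Longrightarrow> (\<integral>x. h (Bi *v x) \<partial>lborel) = of_real \<kappa> * (\<integral>x. h x \<partial>lborel)"
    "\<And>h :: real ^ 'n \<Rightarrow> complex. h \<in> borel_measurable borel \<Longrightarrow> integrable lborel (\<lambda>x. h (Bi *v x)) \<longleftrightarrow> integrable lborel h"
  using lborel_linear_iso_obtain[of "(*v) Bi" "(*v) B"] by (metis Bi_simps matrix_vector_mul_linear)

text \<open>Write \<open>U K\<close> as \<open>Q\<close> times \<open>Kc\<close> and apply unitarity
  to the shifts of \<open>K\<close> by (x, -P x) and (0, w). On the image side the first is a
  modulation, so the inner product is a Fourier integral in x of Q(t) conj(Q(t - B w)) times the
  Gaussian product \<open>g2\<close>; on the source side it is a Fourier integral of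
  \<open>g2\<close> alone. Injectivity makes the product of values of \<open>Q\<close> a constant,
  and then \<open>Q\<close> itself is constant.\<close>

lemma U_K: "\<exists>c. aeq (U K) (\<lambda>t. c * Kc t)"
proof -
  obtain V where V[measurable]: "V \<in> borel_measurable borel" and UV: "aeq (U K) V" and sV: "sqi lborel V"
    using L2_representative[OF U_L2[OF K_L2]] by blast
  obtain \<kappa> where \<kappa>: "\<kappa> > 0"
    and \<kappa>i: "\<And>h :: real ^ 'n \<Rightarrow> complex. h \<in> borel_measurable borel \<Longrightarrow> (\<integral>x. h (Bi *v x) \<partial>lborel) = of_real \<kappa> * (\<integral>x. h x \<partial>lborel)"
    and \<kappa>int: "\<And>h :: real ^ 'n \<Rightarrow> complex. h \<in> borel_measurable borel \<Longrightarrow> integrable lborel (\<lambda>x. h (Bi *v x)) \<longleftrightarrow> integrable lborel h"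
    by (rule B_linear_iso) blast
  define Q where "Q = (\<lambda>t. V t / Kc t)"
  have [measurable]: "Q \<in> borel_measurable borel" unfolding Q_def by measurable
  have VQ: "V = (\<lambda>t. Q t * Kc t)" by (simp add: Q_def Kc_nonzero)
  have key: "AE t in lborel. Q t * cnj (Q (t - B *v w)) = of_real (1 / \<kappa>)" for w
  proof -
    define g2 where "g2 = (\<lambda>t. complex_of_real (gam (Bi *v t) * gam (Bi *v t - w)))"
    have [measurable]: "g2 \<in> borel_measurable borel" unfolding g2_def by measurable
    have VV: "V t * cnj (rho (vjoin (B *v w) (D *v w)) V t) = Q t * cnj (Q (t - B *v w)) * g2 t" for t
    proof -
      have "V t * cnj (rho (vjoin (B *v w) (D *v w)) V t)
        = Q t * cnj (Q (t - B *v w)) * g2 t * (expi ((t \<bullet> (\<Lambda> *v t)) / 2) * expi (- ((t \<bullet> (\<Lambda> *v t)) / 2)))"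
        unfolding VQ rho_BD by (simp add: Kc_def g2_def cnj_expi mult_ac)
      then show ?thesis by simp
    qed
    have ft: "(\<integral>t. Q t * cnj (Q (t - B *v w)) * g2 t * expi (- (x \<bullet> (Bi *v t))) \<partial>lborel)
       = of_real (1 / \<kappa>) * (\<integral>t. g2 t * expi (- (x \<bullet> (Bi *v t))) \<partial>lborel)" for x
    proof -
      let ?z1 = "vjoin x (- (P *v x))" and ?z2 = "vjoin 0 w"
      let ?M = "block_mat A B C D"
      have r1: "aeq (U (rho ?z1 K)) (rho (vjoin 0 (- (transpose Bi *v x))) V)"
        and r2: "aeq (U (rho ?z2 K)) (rho (vjoin (B *v w) (D *v w)) V)"
        using aeq_trans[OF aeq_sym[OF U_rho[OF K_L2, of ?z1]] aeq_rho[OF UV]]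
          aeq_trans[OF aeq_sym[OF U_rho[OF K_L2, of ?z2]] aeq_rho[OF UV]]
        by (simp_all add: mat_graph mat_vertical)
      have "L2_inner (U (rho ?z1 K)) (U (rho ?z2 K))
        = (\<integral>t. rho (vjoin 0 (- (transpose Bi *v x))) V t * cnj (rho (vjoin (B *v w) (D *v w)) V t) \<partial>lborel)"
        by (rule L2_inner_cong_borel[OF U_L2[OF rho_K_L2] r1 U_L2[OF rho_K_L2] r2]) (intro rho_measurable V)+
      also have "\<dots> = (\<integral>t. Q t * cnj (Q (t - B *v w)) * g2 t * expi (- (x \<bullet> (Bi *v t))) \<partial>lborel)"
      proof (rule Bochner_Integration.integral_cong[OF refl])
        fix t
        have "rho (vjoin 0 (- (transpose Bi *v x))) V t = expi (- (x \<bullet> (Bi *v t))) * V t"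
          by (simp add: rho_vertical dot_lmul_matrix)
        then show "rho (vjoin 0 (- (transpose Bi *v x))) V t * cnj (rho (vjoin (B *v w) (D *v w)) V t)
          = Q t * cnj (Q (t - B *v w)) * g2 t * expi (- (x \<bullet> (Bi *v t)))"
          by (simp only: VV[symmetric]) (simp only: mult_ac)
      qed
      finally have L: "L2_inner (U (rho ?z1 K)) (U (rho ?z2 K)) = \<dots>" .
      have "L2_inner (rho ?z1 K) (rho ?z2 K) = (\<integral>y. rho ?z1 K y * cnj (rho ?z2 K y) \<partial>lborel)"
        by (rule L2_inner_cong_borel) (auto intro!: rho_K_L2 rho_measurable simp: aeq_def)
      also have "\<dots> = (\<integral>y. of_real (gam (y - x) * gam y) * expi (- (w \<bullet> y)) \<partial>lborel)"
      proof (rule Bochner_Integration.integral_cong[OF refl])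
        fix y
        have "rho ?z1 K y * cnj (rho ?z2 K y) = of_real (gam (y - x) * gam y) * expi (- (w \<bullet> y))
           * (expi (- (y \<bullet> (P *v y)) / 2) * expi (- (- (y \<bullet> (P *v y)) / 2)))"
          unfolding rho_graph_K rho_vertical by (simp add: K_def cnj_expi mult_ac)
        then show "rho ?z1 K y * cnj (rho ?z2 K y) = of_real (gam (y - x) * gam y) * expi (- (w \<bullet> y))"
          unfolding expi_minus_mult by simp
      qed
      \<comment> \<open>After this exchange \<open>x\<close> is the frequency on both sides and
        \<open>w\<close> a parameter; the Jacobian of \<open>Bi\<close> supplies the
        constant.\<close>
      also have "\<dots> = (\<integral>y. of_real (gam (y - w) * gam y) * expi (- (x \<bullet> y)) \<partial>lborel)"
        by (rule gauss_correlation_symmetric)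
      also have "\<dots> = of_real (1 / \<kappa>) * (\<integral>t. g2 t * expi (- (x \<bullet> (Bi *v t))) \<partial>lborel)"
        using \<kappa>i[of "\<lambda>y. of_real (gam (y - w) * gam y) * expi (- (x \<bullet> y))"] \<kappa> by (simp add: g2_def mult_ac)
      finally show ?thesis using U_inner[OF rho_K_L2 rho_K_L2, of ?z1 ?z2] L by simp
    qed
    have i1: "integrable lborel (\<lambda>t. Q t * cnj (Q (t - B *v w)) * g2 t)"
      unfolding VV[symmetric] by (intro sqi_mult_integrable sqi_cnj sqi_rho sV)
    have "integrable lborel (\<lambda>y. complex_of_real (gam y * gam (y - w)))"
      using integrable_mult_bounded[of lborel "\<lambda>y. complex_of_real (gam y)" "\<lambda>y. of_real (gam (y - w))" 1]
        gauss_fourier(2)[where ?'a="real^'n"] by simp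
    then have i2: "integrable lborel g2"
      unfolding g2_def by (subst \<kappa>int[of "\<lambda>y. complex_of_real (gam y * gam (y - w))"]) auto
    have "AE t in lborel. Q t * cnj (Q (t - B *v w)) * g2 t - of_real (1 / \<kappa>) * g2 t = 0"
    proof (rule fourier_injective)
      show "integrable lborel (\<lambda>t. Q t * cnj (Q (t - B *v w)) * g2 t - of_real (1 / \<kappa>) * g2 t)"
        using i1 i2 by auto
      show "AE s in lborel. (\<integral>t. (Q t * cnj (Q (t - B *v w)) * g2 t - of_real (1 / \<kappa>) * g2 t) * expi (s \<bullet> t) \<partial>lborel) = 0"
      proof (rule AE_I2)
        fix s
        \<comment> \<open>Every frequency \<open>s\<close> occurs in \<open>ft\<close>, namely for x
          = -(B^t s).\<close>
        have s: "s \<bullet> t = - ((- (transpose B *v s)) \<bullet> (Bi *v t))" for t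
          by (simp add: dot_lmul_matrix)
        have e: "integrable lborel (\<lambda>t. Q t * cnj (Q (t - B *v w)) * g2 t * expi (s \<bullet> t))"
          "integrable lborel (\<lambda>t. g2 t * expi (s \<bullet> t))"
          by (rule integrable_mult_bounded[where C=1], use i1 i2 in auto)+
        have "(\<integral>t. (Q t * cnj (Q (t - B *v w)) * g2 t - of_real (1 / \<kappa>) * g2 t) * expi (s \<bullet> t) \<partial>lborel)
          = (\<integral>t. Q t * cnj (Q (t - B *v w)) * g2 t * expi (s \<bullet> t) \<partial>lborel) - of_real (1 / \<kappa>) * (\<integral>t. g2 t * expi (s \<bullet> t) \<partial>lborel)"
          using e by (simp only: left_diff_distrib mult.assoc[of "of_real (1 / \<kappa>)"] Bochner_Integration.integral_diff integrable_mult_right integral_mult_right_zero)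
        also have "\<dots> = 0" unfolding s ft by simp
        finally show "(\<integral>t. (Q t * cnj (Q (t - B *v w)) * g2 t - of_real (1 / \<kappa>) * g2 t) * expi (s \<bullet> t) \<partial>lborel) = 0" .
      qed
    qed
    then show ?thesis
    proof eventually_elim
      case (elim t)
      then have "(Q t * cnj (Q (t - B *v w)) - of_real (1 / \<kappa>)) * g2 t = 0"
        by (simp only: left_diff_distrib)
      moreover have "g2 t \<noteq> 0" by (simp add: g2_def)
      ultimately show ?case by (simp only: mult_eq_0_iff right_minus_eq) simp
    qed
  qed
  have "AE t in lborel. Q t * cnj (Q (t - w)) = of_real (1 / \<kappa>)" for w
    using key[of "Bi *v w"] by simp
  from const_if_quotients_const[OF _ this] obtain c where "AE t in lborel. Q t = c"
    using \<kappa> by auto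
  with UV have "AE t in lborel. U K t = c * Kc t"
    unfolding aeq_lborel by eventually_elim (simp add: VQ)
  then show ?thesis unfolding aeq_lborel by blast
qed

text \<open>Testing F against the shifts of \<open>K\<close> by (0, w) gives a Fourier integral in
  w. On the image side G is tested against translated Gaussians, and each of these is a Fourier
  integral by self-duality. After Fubini both sides are transforms in w, and injectivity identifies
  the functions. The constant comes from \<open>U K\<close> alone, hence is the same for all
  F.\<close>

theorem metaplectic_inverse:
  "\<exists>c. \<forall>F G. F \<in> L2 \<longrightarrow> aeq (U F) G \<longrightarrow> G \<in> borel_measurable borel \<longrightarrow> integrable lborel G \<longrightarrow>
    (AE y in lborel. F y = c * expi (- (y \<bullet> (P *v y)) / 2) *
       (\<integral>t. G t * expi (- (t \<bullet> (\<Lambda> *v t)) / 2) * expi ((Bi *v t) \<bullet> y) \<partial>lborel))"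
proof -
  obtain c where c: "aeq (U K) (\<lambda>t. c * Kc t)" using U_K by blast
  show ?thesis
  proof (intro exI[of _ "cnj c"] allI impI)
    fix F G assume F: "F \<in> L2" and UG: "aeq (U F) G" and G[measurable]: "G \<in> borel_measurable borel"
      and Gi: "integrable lborel G"
    obtain F' where F'[measurable]: "F' \<in> borel_measurable borel" and FF': "aeq F F'" and sF: "sqi lborel F'"
      using L2_representative[OF F] by blast
    define H where "H = (\<lambda>t. G t * expi (- (t \<bullet> (\<Lambda> *v t)) / 2))"
    have [measurable]: "H \<in> borel_measurable borel" unfolding H_def by measurable
    have Hi: "integrable lborel H"
      unfolding H_def by (rule integrable_mult_bounded[OF Gi, where C=1]) auto
    define \<Gamma> where "\<Gamma> = (\<lambda>y. \<integral>t. H t * expi ((Bi *v t) \<bullet> y) \<partial>lborel)"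
    have [measurable]: "\<Gamma> \<in> borel_measurable borel" unfolding \<Gamma>_def by measurable
    have gi: "integrable lborel (\<lambda>y::real^'n. complex_of_real (gam y))" using gauss_fourier(2) by auto
    have G\<Gamma>: "integrable lborel (\<lambda>y. of_real (gam y) * \<Gamma> y)"
      by (rule integrable_mult_bounded[OF gi]) (auto simp: \<Gamma>_def intro: norm_fourier_le[OF Hi])
    have eq: "(\<integral>y. F' y * cnj (K y) * expi (- (w \<bullet> y)) \<partial>lborel)
       = cnj c * (\<integral>y. of_real (gam y) * \<Gamma> y * expi (- (w \<bullet> y)) \<partial>lborel)" for w
    proof -
      let ?z = "vjoin 0 w"
      have r: "aeq (U (rho ?z K)) (rho (vjoin (B *v w) (D *v w)) (\<lambda>t. c * Kc t))"
        using aeq_trans[OF aeq_sym[OF U_rho[OF K_L2, of ?z]] aeq_rho[OF c]] by (simp add: mat_vertical)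
      have "(\<integral>y. F' y * cnj (K y) * expi (- (w \<bullet> y)) \<partial>lborel) = (\<integral>y. F' y * cnj (rho ?z K y) \<partial>lborel)"
        by (simp add: rho_vertical cnj_expi mult_ac)
      also have "\<dots> = L2_inner F (rho ?z K)"
        by (rule L2_inner_cong_borel[symmetric]) (auto intro!: F FF' rho_K_L2 rho_measurable simp: aeq_def[of "rho _ _"])
      also have "\<dots> = L2_inner (U F) (U (rho ?z K))"
        by (rule U_inner[OF F rho_K_L2, symmetric])
      also have "\<dots> = (\<integral>t. G t * cnj (rho (vjoin (B *v w) (D *v w)) (\<lambda>t. c * Kc t) t) \<partial>lborel)"
        by (rule L2_inner_cong_borel[OF U_L2[OF F] UG U_L2[OF rho_K_L2] r]) (auto intro!: rho_measurable)
      also have "\<dots> = (\<integral>t. cnj c * (H t * of_real (gam (Bi *v t - w))) \<partial>lborel)"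
        by (simp add: rho_BD H_def cnj_expi mult_ac)
      also have "\<dots> = cnj c * (\<integral>t. H t * of_real (gam (Bi *v t - w)) \<partial>lborel)" by simp
      also have "(\<integral>t. H t * of_real (gam (Bi *v t - w)) \<partial>lborel)
         = (\<integral>t. \<integral>y. H t * of_real (gam y) * expi ((Bi *v t - w) \<bullet> y) \<partial>lborel \<partial>lborel)"
        by (simp add: gauss_fourier(1) mult.assoc)
      also have "\<dots> = (\<integral>y. \<integral>t. H t * of_real (gam y) * expi ((Bi *v t - w) \<bullet> y) \<partial>lborel \<partial>lborel)"
      proof (rule lborel_pair.Fubini_integral[symmetric])
        have "integrable (lborel \<Otimes>\<^sub>M lborel) (\<lambda>p::(real^'n)\<times>(real^'n). H (fst p) * complex_of_real (gam (snd p)))"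
          by (rule lborel_pair.Fubini_integrable) (use Hi gi in \<open>auto simp: norm_mult\<close>)
        then have "integrable (lborel \<Otimes>\<^sub>M lborel) (\<lambda>p. H (fst p) * complex_of_real (gam (snd p)) * expi ((Bi *v fst p - w) \<bullet> snd p))"
          by (rule integrable_mult_bounded[where C=1]) auto
        then show "integrable (lborel \<Otimes>\<^sub>M lborel) (\<lambda>(t, y). H t * of_real (gam y) * expi ((Bi *v t - w) \<bullet> y))"
          by (simp add: split_beta')
      qed
      also have "\<dots> = (\<integral>y. of_real (gam y) * \<Gamma> y * expi (- (w \<bullet> y)) \<partial>lborel)"
        unfolding \<Gamma>_def
        by (simp add: inner_diff_left expi_diff mult_ac flip: integral_mult_right_zero integral_mult_left_zero)
      finally show ?thesis .
    qed
    have i1: "integrable lborel (\<lambda>y. F' y * cnj (K y))"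
      by (intro sqi_mult_integrable sqi_cnj sF sqi_K)
    have "AE y in lborel. F' y * cnj (K y) - cnj c * (of_real (gam y) * \<Gamma> y) = 0"
    proof (rule fourier_injective)
      show "integrable lborel (\<lambda>y. F' y * cnj (K y) - cnj c * (of_real (gam y) * \<Gamma> y))"
        using i1 G\<Gamma> by auto
      show "AE s in lborel. (\<integral>y. (F' y * cnj (K y) - cnj c * (of_real (gam y) * \<Gamma> y)) * expi (s \<bullet> y) \<partial>lborel) = 0"
      proof (rule AE_I2)
        fix s
        have "integrable lborel (\<lambda>y. F' y * cnj (K y) * expi (s \<bullet> y))"
          "integrable lborel (\<lambda>y. of_real (gam y) * \<Gamma> y * expi (s \<bullet> y))"
          by (rule integrable_mult_bounded[where C=1], use i1 G\<Gamma> in auto)+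
        then have "(\<integral>y. (F' y * cnj (K y) - cnj c * (of_real (gam y) * \<Gamma> y)) * expi (s \<bullet> y) \<partial>lborel)
          = (\<integral>y. F' y * cnj (K y) * expi (s \<bullet> y) \<partial>lborel) - cnj c * (\<integral>y. of_real (gam y) * \<Gamma> y * expi (s \<bullet> y) \<partial>lborel)"
          by (simp only: left_diff_distrib mult.assoc[of "cnj c"] Bochner_Integration.integral_diff integrable_mult_right integral_mult_right_zero)
        then show "(\<integral>y. (F' y * cnj (K y) - cnj c * (of_real (gam y) * \<Gamma> y)) * expi (s \<bullet> y) \<partial>lborel) = 0"
          using eq[of "- s"] by simp
      qed
    qed
    then show "AE y in lborel. F y = cnj c * expi (- (y \<bullet> (P *v y)) / 2) *
       (\<integral>t. G t * expi (- (t \<bullet> (\<Lambda> *v t)) / 2) * expi ((Bi *v t) \<bullet> y) \<partial>lborel)"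
      using FF' unfolding aeq_lborel H_def[symmetric] \<Gamma>_def[symmetric]
    proof eventually_elim
      case (elim y)
      let ?e = "expi (- (y \<bullet> (P *v y)) / 2)" and ?e' = "expi (- (- (y \<bullet> (P *v y)) / 2))"
      have "F y * (of_real (gam y) * ?e') = cnj c * (of_real (gam y) * \<Gamma> y)"
        using elim by (simp add: K_def cnj_expi mult_ac)
      then have "F y * ?e' = cnj c * \<Gamma> y" by simp
      then have "F y * ?e' * ?e = cnj c * \<Gamma> y * ?e" by (simp only:)
      then have "F y * (?e' * ?e) = cnj c * ?e * \<Gamma> y" by (simp only: mult_ac)
      then show ?case by (simp only: expi_minus_mult mult_1_right \<Gamma>_def H_def)
    qed
  qed
qed

end

section \<open>The normal form of the coupling matrix\<close>

lemma orth_proj_exists: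
  fixes R :: "'a::euclidean_space set"
  assumes R: "subspace R"
  shows "\<exists>E. orth_proj E \<and> (\<forall>x. E x \<in> R) \<and> (\<forall>x\<in>R. E x = x)"
proof -
  obtain Bs where B: "Bs \<subseteq> R" "pairwise orthogonal Bs" "\<And>x. x \<in> Bs \<Longrightarrow> norm x = 1"
    "independent Bs" "span Bs = R"
    using orthonormal_basis_subspace[OF R] by metis
  have fB: "finite Bs" using B(4) by (rule finiteI_independent)
  define E where "E = (\<lambda>x. \<Sum>b\<in>Bs. (x \<bullet> b) *\<^sub>R b)"
  have l: "linear E"
    unfolding E_def by (intro linearI) (auto simp: inner_add_left scaleR_add_left sum.distrib scaleR_sum_right)
  have inR: "E x \<in> R" for x
    unfolding E_def using B(1) by (intro subspace_sum R subspace_scale) auto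
  have Eb: "E b = b" if "b \<in> Bs" for b
  proof -
    have "E b = (\<Sum>b'\<in>Bs. if b' = b then b else 0)"
      unfolding E_def
    proof (rule sum.cong[OF refl])
      fix b' assume "b' \<in> Bs"
      show "(b \<bullet> b') *\<^sub>R b' = (if b' = b then b else 0)"
        using B(2,3) that \<open>b' \<in> Bs\<close> by (auto simp: pairwise_def orthogonal_def norm_eq_1)
    qed
    then show ?thesis using that fB by simp
  qed
  have fixed: "E x = x" if "x \<in> R" for x
  proof -
    have "x \<in> span Bs" using that B(5) by simp
    then show ?thesis
    proof (induction rule: span_induct_alt)
      case base
      then show ?case using linear_0[OF l] by simp
    next
      case (step c b y)
      then show ?case using Eb by (simp add: linear_add[OF l] linear_cmul[OF l])
    qed
  qed
  have "E x \<bullet> y = x \<bullet> E y" for x y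
    by (simp add: E_def inner_sum_left inner_sum_right inner_commute mult.commute)
  then show ?thesis using l inR fixed by (auto simp: orth_proj_def intro!: exI[of _ E])
qed

text \<open>\<open>X\<close> is built in two pieces: on the range of \<open>N\<close> a right
  inverse of \<open>N\<close>, on the orthogonal complement an isomorphism onto the kernel of
  \<open>N\<close>. Substituting it makes \<open>N\<close> the orthogonal projection onto its own
  range.\<close>

lemma matrix_factor_orth_proj:
  fixes N :: "real ^ 'n::finite ^ 'n"
  assumes N: "N \<noteq> 0"
  shows "\<exists>X Y E. linear X \<and> linear Y \<and> (\<forall>x. X (Y x) = x) \<and> (\<forall>x. Y (X x) = x) \<and> orth_proj E \<and>
     (\<forall>x. N *v (X x) = E x) \<and> (\<exists>a. E a = a \<and> a \<noteq> 0)"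
proof -
  let ?R = "range ((*v) N)" and ?R' = "range ((*v) (transpose N))"
  let ?perp = "\<lambda>S. {y. \<forall>x\<in>S. orthogonal x y} :: (real ^ 'n) set"
  have sR: "subspace ?R" "subspace ?R'"
    by (rule linear_subspace_image[OF matrix_vector_mul_linear subspace_UNIV])+
  have sp: "subspace (?perp S)" for S
    by (auto simp: subspace_def orthogonal_clauses)
  have d: "dim (?perp S) + dim S = DIM(real ^ 'n)" if "subspace S" for S
    using dim_subspace_orthogonal_to_vectors[OF that subspace_UNIV] by simp
  \<comment> \<open>Row rank equals column rank, so the complement of the range and the kernel of
    \<open>N\<close>, which is the complement of the row space, have equal dimension.\<close>
  have "dim ?R = dim ?R'"
    using rank_dim_range[of N] rank_dim_range[of "transpose N"] rank_transpose[of N] by simp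
  then have "dim (?perp ?R) = dim (?perp ?R')"
    using d[OF sR(1)] d[OF sR(2)] by simp
  from subspace_isomorphism[OF sp sp this]
  obtain J where J: "linear J" "J ` ?perp ?R = ?perp ?R'" "inj_on J (?perp ?R)"
    by blast
  obtain E where E: "orth_proj E" "\<And>x. E x \<in> ?R" "\<And>x. x \<in> ?R \<Longrightarrow> E x = x"
    using orth_proj_exists[OF sR(1)] by blast
  note Es = orth_projD[OF E(1)]
  obtain g where g: "linear g" "\<And>v. v \<in> ?R \<Longrightarrow> N *v (g v) = v"
    using linear_exists_right_inverse_on[OF matrix_vector_mul_linear subspace_UNIV, of N] by blast
  have perp: "cproj E x \<in> ?perp ?R" for x
  proof (rule CollectI, rule ballI)
    fix y assume "y \<in> ?R"
    then have "y \<bullet> cproj E x = E y \<bullet> cproj E x" using E(3) by simp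
    also have "\<dots> = 0" using Es(3)[of y "cproj E x"] cproj_simps(2)[OF E(1), of x] by simp
    finally show "orthogonal y (cproj E x)" by (simp add: orthogonal_def)
  qed
  have NJ: "N *v (J (cproj E x)) = 0" for x
  proof -
    have "J (cproj E x) \<in> ?perp ?R'" using J(2) perp[of x] by blast
    then have "\<forall>y. (transpose N *v y) \<bullet> J (cproj E x) = 0" by (auto simp: orthogonal_def)
    then have "\<forall>y. y \<bullet> (N *v J (cproj E x)) = 0" by (metis inner_matrix_transpose)
    then show ?thesis by (metis inner_eq_zero_iff)
  qed
  define X where "X = (\<lambda>x. g (E x) + J (cproj E x))"
  have lX: "linear X"
    unfolding X_def
    using linear_compose[OF Es(1) g(1)] linear_compose[OF orth_projD(1)[OF orth_proj_cproj[OF E(1)]] J(1)]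
    by (intro linear_compose_add) (simp_all add: o_def)
  have NX: "N *v (X x) = E x" for x
    using g(2)[OF E(2)] NJ by (simp add: X_def matrix_vector_right_distrib)
  have "inj X"
    unfolding linear_injective_0[OF lX]
  proof (intro allI impI)
    fix x assume x: "X x = 0"
    then have "E x = 0" using NX[of x] by simp
    then have "J (cproj E x) = 0" using x linear_0[OF g(1)] by (simp add: X_def)
    moreover have "J 0 = 0" by (rule linear_0[OF J(1)])
    moreover have "0 \<in> ?perp ?R" by (auto simp: orthogonal_def)
    ultimately have "cproj E x = 0" using inj_onD[OF J(3), of "cproj E x" 0] perp[of x] by simp
    with \<open>E x = 0\<close> show "x = 0" by (simp add: cproj_def)
  qed
  then obtain Y where Y: "linear Y" "\<And>x. Y (X x) = x" "\<And>x. X (Y x) = x"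
    using linear_injective_isomorphism[OF lX] by blast
  obtain v where "N *v v \<noteq> 0"
    using N matrix_eq[of N 0] by auto
  then have "\<exists>a. E a = a \<and> a \<noteq> 0" using E(3)[of "N *v v"] by blast
  with lX Y E(1) NX show ?thesis by blast
qed

section \<open>The two halves of a vector as a linear change of variables\<close>

lemma linear_vjoin: "linear (\<lambda>p. vjoin (fst p :: real ^ 'n::finite) (snd p))"
  by (intro linearI) (auto simp: vjoin_def vec_eq_iff split: sum.split)

lemma linear_vfst_vsnd: "linear (\<lambda>z. (vfst z, vsnd z))" "linear vfst" "linear vsnd"
  by (auto intro!: linearI simp: vfst_def vsnd_def vec_eq_iff)

lemma linear_borel_measurable: "linear f \<Longrightarrow> f \<in> borel_measurable borel"
  for f :: "'a::euclidean_space \<Rightarrow> 'b::euclidean_space"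
  by (intro borel_measurable_continuous_onI linear_continuous_on) (simp add: linear_conv_bounded_linear[symmetric])

lemmas [measurable] = linear_borel_measurable[OF linear_vfst_vsnd(2)] linear_borel_measurable[OF linear_vfst_vsnd(3)]

lemma vjoin_measurable[measurable (raw)]:
  assumes "f \<in> borel_measurable M" "g \<in> borel_measurable M"
  shows "(\<lambda>x. vjoin (f x) (g x)) \<in> borel_measurable M"
proof -
  have "(\<lambda>p. vjoin (fst p) (snd p)) \<circ> (\<lambda>x. (f x, g x)) \<in> borel_measurable M"
    using assms by (intro measurable_comp[OF _ linear_borel_measurable[OF linear_vjoin]]) (simp add: borel_prod[symmetric])
  then show ?thesis by (simp add: o_def)
qed

lemma AE_linear_iso:
  fixes f :: "'a::euclidean_space \<Rightarrow> 'b::euclidean_space"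
  assumes iso: "linear f" "linear g" "\<And>y. f (g y) = y" "\<And>x. g (f x) = x"
    and ae: "AE x in lborel. P x"
  shows "AE x in lborel. P (f x)"
  by (rule lborel_linear_iso_obtain[OF iso]) (use ae in blast)

lemma vjoin_iso:
  obtains \<kappa> :: real where "\<kappa> > 0"
    "\<And>h :: real ^ ('n::finite + 'n) \<Rightarrow> ennreal. h \<in> borel_measurable borel \<Longrightarrow> (\<integral>\<^sup>+p. h (vjoin (fst p) (snd p)) \<partial>(lborel \<Otimes>\<^sub>M lborel)) = ennreal \<kappa> * (\<integral>\<^sup>+x. h x \<partial>lborel)"
    "\<And>h :: real ^ ('n + 'n) \<Rightarrow> complex. h \<in> borel_measurable borel \<Longrightarrow> (\<integral>p. h (vjoin (fst p) (snd p)) \<partial>(lborel \<Otimes>\<^sub>M lborel)) = of_real \<kappa> * (\<integral>x. h x \<partial>lborel)"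
    "\<And>h :: real ^ ('n + 'n) \<Rightarrow> complex. h \<in> borel_measurable borel \<Longrightarrow> integrable (lborel \<Otimes>\<^sub>M lborel) (\<lambda>p. h (vjoin (fst p) (snd p))) \<longleftrightarrow> integrable lborel h"
proof (rule lborel_linear_iso_obtain[OF linear_vjoin[where ?'n='n] linear_vfst_vsnd(1)])
  show "vjoin (fst (vfst y, vsnd y)) (snd (vfst y, vsnd y)) = y" for y :: "real ^ ('n + 'n)" by simp
  show "(vfst (vjoin (fst x) (snd x)), vsnd (vjoin (fst x) (snd x))) = x" for x :: "(real ^ 'n) \<times> (real ^ 'n)" by simp
next
  fix \<kappa> :: real
  assume "\<kappa> > 0"
    "\<And>h :: real ^ ('n + 'n) \<Rightarrow> ennreal. h \<in> borel_measurable borel \<Longrightarrow> (\<integral>\<^sup>+p. h (vjoin (fst p) (snd p)) \<partial>lborel) = ennreal \<kappa> * (\<integral>\<^sup>+x. h x \<partial>lborel)"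
    "\<And>h :: real ^ ('n + 'n) \<Rightarrow> complex. h \<in> borel_measurable borel \<Longrightarrow> (\<integral>p. h (vjoin (fst p) (snd p)) \<partial>lborel) = of_real \<kappa> * (\<integral>x. h x \<partial>lborel)"
    "\<And>h :: real ^ ('n + 'n) \<Rightarrow> complex. h \<in> borel_measurable borel \<Longrightarrow> integrable lborel (\<lambda>p. h (vjoin (fst p) (snd p))) \<longleftrightarrow> integrable lborel h"
  then show thesis by (intro that[of \<kappa>]) (simp_all only: lborel_prod)
qed

lemma AE_vjoin:
  assumes "AE z in (lborel :: (real ^ ('n::finite + 'n)) measure). P z"
  shows "AE p in lborel \<Otimes>\<^sub>M lborel. P (vjoin (fst p) (snd p))"
  unfolding lborel_prod by (rule AE_linear_iso[OF linear_vjoin linear_vfst_vsnd(1) _ _ assms]) auto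

lemma AE_vfst_vsnd:
  assumes "AE p in lborel \<Otimes>\<^sub>M lborel. P p"
  shows "AE z in (lborel :: (real ^ ('n::finite + 'n)) measure). P (vfst z, vsnd z)"
  using assms unfolding lborel_prod
  by (intro AE_linear_iso[OF linear_vfst_vsnd(1) linear_vjoin]) auto

lemma AE_pair_fst_snd:
  fixes P :: "'a::euclidean_space \<Rightarrow> bool"
  assumes P: "AE x in lborel. P x"
  shows "AE p in lborel \<Otimes>\<^sub>M (lborel :: 'b::euclidean_space measure). P (fst p)"
    and "AE p in (lborel :: 'b::euclidean_space measure) \<Otimes>\<^sub>M lborel. P (snd p)"
proof -
  obtain N where N: "\<And>x. x \<in> space lborel - N \<Longrightarrow> P x" "N \<in> null_sets lborel"
    using AE_E3[OF P] by blast
  have "N \<times> (UNIV :: 'b set) \<in> null_sets (lborel \<Otimes>\<^sub>M lborel)"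
    using N(2) by (intro lborel.times_in_null_sets1) auto
  then show "AE p in lborel \<Otimes>\<^sub>M (lborel :: 'b measure). P (fst p)"
    by (rule AE_I') (use N(1) in fastforce)
  have "(UNIV :: 'b set) \<times> N \<in> null_sets (lborel \<Otimes>\<^sub>M lborel)"
    using N(2) by (intro lborel.times_in_null_sets2) auto
  then show "AE p in (lborel :: 'b measure) \<Otimes>\<^sub>M lborel. P (snd p)"
    by (rule AE_I') (use N(1) in fastforce)
qed

text \<open>Completeness of Lebesgue measure. It is applied to tensor products of representatives
  that are only Lebesgue measurable.\<close>

lemma measurable_lebesgue_AE:
  fixes f :: "'a::euclidean_space \<Rightarrow> complex"
  assumes g[measurable]: "g \<in> borel_measurable borel" and fg: "AE x in lborel. f x = g x"
  shows "f \<in> borel_measurable lebesgue"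
proof (rule measurableI)
  fix A :: "complex set" assume [measurable]: "A \<in> sets borel"
  have "g -` A \<inter> space lborel \<in> sets lborel" by measurable
  then have 1: "g -` A \<in> sets lebesgue" by simp
  have "AE x in lebesgue. f x = g x" using fg by (simp add: AE_completion_iff)
  then have "AE x in lebesgue. x \<in> g -` A \<longleftrightarrow> x \<in> f -` A" by eventually_elim auto
  from completion.in_sets_AE[OF this] 1 show "f -` A \<inter> space lebesgue \<in> sets lebesgue" by simp
qed simp

section \<open>Wigner distributions of finite and of compact support\<close>

lemma tensor_cnj_measurable:
  assumes [measurable]: "f \<in> borel_measurable borel" "g \<in> borel_measurable borel"
  shows "tensor_cnj f g \<in> borel_measurable borel"
  unfolding tensor_cnj_def by measurable

lemma sqi_tensor_cnj:
  fixes f g :: "real ^ 'n::finite \<Rightarrow> complex"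
  assumes f: "sqi lborel f" and g: "sqi lborel g"
  shows "sqi lborel (tensor_cnj f g)"
proof -
  have [measurable]: "f \<in> borel_measurable borel" "g \<in> borel_measurable borel"
    using sqi_measurable[OF f] sqi_measurable[OF g] by auto
  note [measurable] = tensor_cnj_measurable[of f g]
  obtain \<kappa> :: real where k: "\<kappa> > 0"
    and nn: "\<And>h :: real ^ ('n + 'n) \<Rightarrow> ennreal. h \<in> borel_measurable borel \<Longrightarrow>
      (\<integral>\<^sup>+p. h (vjoin (fst p) (snd p)) \<partial>(lborel \<Otimes>\<^sub>M lborel)) = ennreal \<kappa> * (\<integral>\<^sup>+x. h x \<partial>lborel)"
    by (rule vjoin_iso[where ?'n='n]) blast
  have "ennreal \<kappa> * (\<integral>\<^sup>+z. ennreal ((cmod (tensor_cnj f g z))\<^sup>2) \<partial>lborel)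
     = (\<integral>\<^sup>+p. ennreal ((cmod (f (fst p)))\<^sup>2) * ennreal ((cmod (g (snd p)))\<^sup>2) \<partial>(lborel \<Otimes>\<^sub>M lborel))"
    by (subst nn[symmetric]) (auto simp: tensor_cnj_def norm_mult power_mult_distrib ennreal_mult)
  also have "\<dots> = (\<integral>\<^sup>+x. ennreal ((cmod (f x))\<^sup>2) \<partial>lborel) * (\<integral>\<^sup>+y. ennreal ((cmod (g y))\<^sup>2) \<partial>lborel)"
    by (subst lborel.nn_integral_fst[symmetric]) (auto simp: nn_integral_cmult nn_integral_multc)
  also have "\<dots> < \<infinity>"
    using f g by (auto simp: sqi_def integrable_iff_bounded ennreal_mult_less_top)
  finally have "(\<integral>\<^sup>+z. ennreal ((cmod (tensor_cnj f g z))\<^sup>2) \<partial>lborel) < \<infinity>"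
    using k by (auto simp: ennreal_mult_less_top)
  then show ?thesis by (simp add: sqi_def integrable_iff_bounded tensor_cnj_measurable)
qed

lemma aeq_tensor_cnj:
  assumes "aeq f f'" "aeq g g'" shows "aeq (tensor_cnj f g) (tensor_cnj f' g')"
proof -
  have "AE p in lborel \<Otimes>\<^sub>M lborel. f (fst p) = f' (fst p)" "AE p in lborel \<Otimes>\<^sub>M lborel. g (snd p) = g' (snd p)"
    using AE_pair_fst_snd(1)[OF assms(1)[unfolded aeq_lborel]] AE_pair_fst_snd(2)[OF assms(2)[unfolded aeq_lborel]] by auto
  then have "AE p in lborel \<Otimes>\<^sub>M lborel. f (fst p) * cnj (g (snd p)) = f' (fst p) * cnj (g' (snd p))"
    by eventually_elim simp
  from AE_vfst_vsnd[OF this] show ?thesis by (simp add: aeq_lborel tensor_cnj_def)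
qed

lemma quadratic_block_mat:
  assumes "transpose (block_mat P11 P12 P21 P22) = block_mat P11 P12 P21 P22"
  shows "P21 = transpose P12"
    and "vjoin a b \<bullet> (block_mat P11 P12 P21 P22 *v vjoin a b)
      = a \<bullet> (P11 *v a) + 2 * ((transpose P12 *v a) \<bullet> b) + b \<bullet> (P22 *v b)"
proof -
  show 1: "P21 = transpose P12"
    using assms by (simp add: transpose_block_mat block_mat_eq_iff)
  have "b \<bullet> (P21 *v a) = (transpose P12 *v a) \<bullet> b" by (simp add: 1 inner_commute)
  moreover have "a \<bullet> (P12 *v b) = (transpose P12 *v a) \<bullet> b" by (simp only: inner_matrix_transpose)
  ultimately show "vjoin a b \<bullet> (block_mat P11 P12 P21 P22 *v vjoin a b)
      = a \<bullet> (P11 *v a) + 2 * ((transpose P12 *v a) \<bullet> b) + b \<bullet> (P22 *v b)"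
    by (simp add: block_mat_vjoin inner_vjoin inner_add_right)
qed

text \<open>On the support |f| is at most 1 + |f|^2. This makes a Wigner distribution of finite
  support integrable, as the inverse formula demands.\<close>

lemma sqi_finite_support_integrable:
  assumes f: "sqi M f" and fin: "emeasure M {x \<in> space M. f x \<noteq> 0} < \<infinity>"
  shows "integrable M f"
proof (rule Bochner_Integration.integrable_bound)
  have [measurable]: "f \<in> borel_measurable M" using f by (rule sqi_measurable)
  then show "f \<in> borel_measurable M" .
  let ?S = "{x \<in> space M. f x \<noteq> 0}"
  have "integrable M (indicator ?S :: _ \<Rightarrow> real)"
    using fin by (intro integrable_real_indicator) auto
  then show "integrable M (\<lambda>x. indicator ?S x + (cmod (f x))\<^sup>2)"
    using f by (auto simp: sqi_def)
  show "AE x in M. norm (f x) \<le> norm (indicator ?S x + (cmod (f x))\<^sup>2)"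
  proof (rule AE_I2)
    fix x assume x: "x \<in> space M"
    show "norm (f x) \<le> norm (indicator ?S x + (cmod (f x))\<^sup>2)"
    proof (cases "f x = 0")
      case False
      have "2 * cmod (f x) \<le> 1 + (cmod (f x))\<^sup>2"
        using sum_squares_bound[of 1 "cmod (f x)"] by simp
      moreover have "0 \<le> cmod (f x)" by simp
      ultimately have "cmod (f x) \<le> 1 + (cmod (f x))\<^sup>2" by linarith
      then show ?thesis using False x by simp
    qed simp
  qed
qed

text \<open>The inverse formula presents the tensor product, after removal of chirps, as a Fourier
  transform of a function of finite support. The substitution \<open>X\<close> in the first variable
  turns the cross term of the quadratic form into a projection, and its transposed inverse acts on
  the dual variable.\<close>

lemma wigner_uncertainty:
  fixes A B C D :: "real ^ ('d::finite + 'd) ^ ('d + 'd)"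
  assumes M: "metaplectic_B A B C D U"
    and P: "metaplectic_B.P A B = block_mat P11 P12 P21 P22" and nd: "\<not> (P12 = 0 \<and> P21 = 0)"
    and f: "f \<in> L2" and g: "g \<in> L2" and Sm: "S \<in> lmeasurable" and supp: "supported_on (Wigner U f g) S"
  shows "aeq f (\<lambda>x. 0) \<or> aeq g (\<lambda>x. 0)"
proof -
  interpret metaplectic_B A B C D U by fact
  have Psym: "transpose (block_mat P11 P12 P21 P22) = block_mat P11 P12 P21 P22"
    using P_sym P by simp
  have "transpose P12 \<noteq> 0"
  proof
    assume 0: "transpose P12 = 0"
    then have "P12 = transpose 0" by (metis transpose_transpose)
    then have "P12 = 0" by (simp add: transpose_def vec_eq_iff)
    with 0 nd quadratic_block_mat(1)[OF Psym] show False by simp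
  qed
  then obtain X Y E where X: "linear X" and Y: "linear Y" and XY: "\<And>x. X (Y x) = x" "\<And>x. Y (X x) = x"
    and E: "orth_proj E" and NX: "\<And>x. transpose P12 *v (X x) = E x" and "\<exists>a. E a = a \<and> a \<noteq> 0"
    using matrix_factor_orth_proj[of "transpose P12"] by blast
  then obtain a0 where a0: "E a0 = a0" "a0 \<noteq> 0" by blast
  have [measurable]: "X \<in> borel_measurable borel" using X by (rule linear_borel_measurable)
  obtain f0 where f0[measurable]: "f0 \<in> borel_measurable borel" and ff0: "aeq f f0" and sf: "sqi lborel f0"
    using L2_representative[OF f] by blast
  obtain g0 where g0[measurable]: "g0 \<in> borel_measurable borel" and gg0: "aeq g g0" and sg: "sqi lborel g0"
    using L2_representative[OF g] by blast
  let ?T = "tensor_cnj f0 g0"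
  have Tm: "?T \<in> borel_measurable borel" by (rule tensor_cnj_measurable[OF f0 g0])
  have TL2: "?T \<in> L2" using sqi_tensor_cnj[OF sf sg] borel_in_L2_iff[OF Tm] by simp
  have aT: "aeq (tensor_cnj f g) ?T" by (rule aeq_tensor_cnj[OF ff0 gg0])
  have "tensor_cnj f g \<in> borel_measurable lebesgue"
    using aT by (intro measurable_lebesgue_AE[OF Tm]) (simp add: aeq_lborel)
  then have "tensor_cnj f g \<in> L2" by (rule L2_aeq[OF TL2 _ aeq_sym[OF aT]])
  then have UT: "aeq (U (tensor_cnj f g)) (U ?T)"
    using U aT TL2 by (auto simp: metaplectic_def unitary_L2_def)
  obtain G where G[measurable]: "G \<in> borel_measurable borel" and UG: "aeq (U ?T) G" and sG: "sqi lborel G"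
    using L2_representative[OF U_L2[OF TL2]] by blast
  have finG: "emeasure lborel {x. G x \<noteq> 0} < \<infinity>"
  proof -
    have m: "{x. G x \<noteq> 0} \<in> sets borel"
      using G by (simp add: borel_measurable_iff_ge[symmetric]) measurable
    have "AE x in lebesgue. x \<notin> S \<longrightarrow> G x = 0"
      using supp UT UG unfolding supported_on_def Wigner_def aeq_def by eventually_elim auto
    then have "AE x in lebesgue. x \<in> {x. G x \<noteq> 0} \<longrightarrow> x \<in> S" by eventually_elim auto
    then have "emeasure lebesgue {x. G x \<noteq> 0} \<le> emeasure lebesgue S"
      using Sm by (intro emeasure_mono_AE) (auto simp: fmeasurable_def)
    also have "\<dots> < \<infinity>" using Sm unfolding fmeasurable_def by blast
    finally show ?thesis using m by simp
  qed
  have Gi: "integrable lborel G"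
    by (rule sqi_finite_support_integrable[OF sG]) (use finG in simp)
  define H where "H = (\<lambda>t. G t * expi (- (t \<bullet> (\<Lambda> *v t)) / 2))"
  have [measurable]: "H \<in> borel_measurable borel" unfolding H_def by measurable
  have Hi: "integrable lborel H"
    unfolding H_def by (rule integrable_mult_bounded[OF Gi, where C=1]) auto
  obtain c where c: "AE y in lborel. ?T y = c * expi (- (y \<bullet> (P *v y)) / 2) * (\<integral>t. H t * expi ((Bi *v t) \<bullet> y) \<partial>lborel)"
    using metaplectic_inverse TL2 UG G Gi unfolding H_def by blast
  \<comment> \<open>Chosen so that the phase of (B^-1 L(u, v)) against (X s, t) is s . u + t . v:
    the adjoint of \<open>Y\<close> undoes the \<open>X\<close> of the first variable.\<close>
  define L where "L = (\<lambda>q. B *v vjoin (adjoint Y (fst q)) (snd q))"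
  define L' where "L' = (\<lambda>z. (adjoint X (vfst (Bi *v z)), vsnd (Bi *v z)))"
  have adj: "adjoint Y (adjoint X v) = v" "adjoint X (adjoint Y v) = v" for v
  proof -
    have "w \<bullet> adjoint Y (adjoint X v) = w \<bullet> v" "w \<bullet> adjoint X (adjoint Y v) = w \<bullet> v" for w
      using adjoint_works[OF X] adjoint_works[OF Y] XY by simp_all
    then show "adjoint Y (adjoint X v) = v" "adjoint X (adjoint Y v) = v"
      using vector_eq_ldot by blast+
  qed
  have lin1: "linear (\<lambda>q. vjoin (adjoint Y (fst q)) (snd q))"
    using linear_compose[OF _ linear_vjoin, of "\<lambda>q. (adjoint Y (fst q), snd q)"] adjoint_linear[OF Y]
    by (simp add: o_def linear_iff)
  have linL: "linear L"
    unfolding L_def using linear_compose[OF lin1 matrix_vector_mul_linear[of B]] by (simp add: o_def)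
  have linL': "linear L'"
    unfolding L'_def
    using linear_compose[OF matrix_vector_mul_linear[of Bi] linear_compose[OF linear_vfst_vsnd(2) adjoint_linear[OF X]]]
      linear_compose[OF matrix_vector_mul_linear[of Bi] linear_vfst_vsnd(3)]
    by (simp add: o_def linear_iff)
  have LL': "L (L' z) = z" for z by (simp add: L_def L'_def adj)
  have L'L: "L' (L q) = q" for q by (simp add: L_def L'_def adj)
  have [measurable]: "L \<in> borel_measurable borel" by (rule linear_borel_measurable[OF linL])
  obtain \<kappa> :: real where k: "\<kappa> > 0"
    and knn: "\<And>h :: real ^ ('d + 'd) \<Rightarrow> ennreal. h \<in> borel_measurable borel \<Longrightarrow> (\<integral>\<^sup>+x. h (L x) \<partial>lborel) = ennreal \<kappa> * (\<integral>\<^sup>+x. h x \<partial>lborel)"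
    and ki: "\<And>h :: real ^ ('d + 'd) \<Rightarrow> complex. h \<in> borel_measurable borel \<Longrightarrow> (\<integral>x. h (L x) \<partial>lborel) = of_real \<kappa> * (\<integral>x. h x \<partial>lborel)"
    and kint: "\<And>h :: real ^ ('d + 'd) \<Rightarrow> complex. h \<in> borel_measurable borel \<Longrightarrow> integrable lborel (\<lambda>x. h (L x)) \<longleftrightarrow> integrable lborel h"
    by (rule lborel_linear_iso_obtain[OF linL linL' LL' L'L]) blast
  \<comment> \<open>The Jacobian of \<open>L\<close> is divided out and the constant of the inverse
    formula absorbed, so the transform of \<Phi> is \<open>c\<close> times the integral in that
    formula.\<close>
  define \<Phi> where "\<Phi> = (\<lambda>q. c / of_real \<kappa> * H (L q))"
  have [measurable]: "\<Phi> \<in> borel_measurable borel" unfolding \<Phi>_def by measurable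
  have \<Phi>1: "integrable (lborel \<Otimes>\<^sub>M lborel) \<Phi>"
    unfolding lborel_prod \<Phi>_def using kint[of H] Hi by auto
  have \<Phi>2: "(\<integral>\<^sup>+p. ennreal ((cmod (\<Phi> p))\<^sup>2) \<partial>(lborel \<Otimes>\<^sub>M lborel)) < \<infinity>"
  proof -
    let ?h = "\<lambda>t. ennreal ((cmod (c / of_real \<kappa>))\<^sup>2) * ennreal ((cmod (G t))\<^sup>2)"
    have "(\<integral>\<^sup>+p. ennreal ((cmod (\<Phi> p))\<^sup>2) \<partial>(lborel \<Otimes>\<^sub>M lborel)) = (\<integral>\<^sup>+p. ?h (L p) \<partial>lborel)"
      unfolding lborel_prod
    proof (rule nn_integral_cong)
      fix p
      have "cmod (\<Phi> p) = cmod (c / of_real \<kappa>) * cmod (G (L p))"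
        unfolding \<Phi>_def H_def norm_mult norm_expi by simp
      then show "ennreal ((cmod (\<Phi> p))\<^sup>2) = ?h (L p)"
        by (simp only: power_mult_distrib ennreal_mult zero_le_power2)
    qed
    also have "\<dots> = ennreal \<kappa> * (\<integral>\<^sup>+t. ?h t \<partial>lborel)"
      by (rule knn) measurable
    also have "\<dots> = ennreal \<kappa> * (ennreal ((cmod (c / of_real \<kappa>))\<^sup>2) * (\<integral>\<^sup>+t. ennreal ((cmod (G t))\<^sup>2) \<partial>lborel))"
      by (subst nn_integral_cmult) auto
    also have "\<dots> < \<infinity>"
      using sG by (auto simp: sqi_def integrable_iff_bounded ennreal_mult_less_top)
    finally show ?thesis .
  qed
  have fin: "emeasure (lborel \<Otimes>\<^sub>M lborel) {p. \<Phi> p \<noteq> 0} < \<infinity>"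
  proof -
    have m: "{x. G x \<noteq> 0} \<in> sets borel" "{p. \<Phi> p \<noteq> 0} \<in> sets borel" "{p. G (L p) \<noteq> 0} \<in> sets borel"
      by measurable
    have "emeasure lborel {p. \<Phi> p \<noteq> 0} \<le> emeasure lborel {p. G (L p) \<noteq> 0}"
      using m by (intro emeasure_mono) (auto simp: \<Phi>_def H_def)
    also have "\<dots> = (\<integral>\<^sup>+p. indicator {p. G (L p) \<noteq> 0} p \<partial>lborel)" using m by simp
    also have "\<dots> = (\<integral>\<^sup>+p. indicator {x. G x \<noteq> 0} (L p) \<partial>lborel)"
      by (intro nn_integral_cong) (simp add: indicator_def)
    also have "\<dots> = ennreal \<kappa> * emeasure lborel {x. G x \<noteq> 0}"
      using m by (subst knn) auto
    also have "\<dots> < \<infinity>" using finG by (simp add: ennreal_mult_less_top)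
    finally show ?thesis unfolding lborel_prod .
  qed
  \<comment> \<open>The diagonal blocks act on each factor separately, by unimodular chirps absorbed
    here. The off-diagonal term enters the quadratic form twice, so the factor 1/2 leaves the
    coupling E s . t.\<close>
  define f1 where "f1 = (\<lambda>s. f0 (X s) * expi ((X s \<bullet> (P11 *v X s)) / 2))"
  define g1 where "g1 = (\<lambda>t. cnj (g0 t) * expi ((t \<bullet> (P22 *v t)) / 2))"
  have [measurable]: "f1 \<in> borel_measurable borel" "g1 \<in> borel_measurable borel"
    unfolding f1_def g1_def by measurable
  have "AE p in lborel \<Otimes>\<^sub>M lborel. ?T (vjoin (X (fst p)) (snd p)) = c * expi (- (vjoin (X (fst p)) (snd p) \<bullet> (P *v vjoin (X (fst p)) (snd p))) / 2)
     * (\<integral>t. H t * expi ((Bi *v t) \<bullet> vjoin (X (fst p)) (snd p)) \<partial>lborel)"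
    unfolding lborel_prod
  proof (rule AE_linear_iso[where f="\<lambda>p. vjoin (X (fst p)) (snd p)" and g="\<lambda>z. (Y (vfst z), vsnd z)", OF _ _ _ _ c])
    show "linear (\<lambda>p. vjoin (X (fst p)) (snd p))"
      using linear_compose[OF _ linear_vjoin, of "\<lambda>q. (X (fst q), snd q)"] X by (simp add: o_def linear_iff)
    show "linear (\<lambda>z. (Y (vfst z), vsnd z))"
      using linear_compose[OF linear_vfst_vsnd(2) Y] linear_vfst_vsnd(3) by (simp add: o_def linear_iff)
  qed (simp_all add: XY)
  then have rel: "AE p in lborel \<Otimes>\<^sub>M lborel. f1 (fst p) * g1 (snd p) * expi (E (fst p) \<bullet> snd p)
      = (\<integral>q. \<Phi> q * expi (fst p \<bullet> fst q + snd p \<bullet> snd q) \<partial>(lborel \<Otimes>\<^sub>M lborel))"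
  proof eventually_elim
    case (elim p)
    obtain s t where p: "p = (s, t)" by (cases p)
    let ?y = "vjoin (X s) t"
    have "(Bi *v L q) \<bullet> ?y = s \<bullet> fst q + t \<bullet> snd q" for q
      using adjoint_works[OF Y, of "X s" "fst q"] by (simp add: L_def inner_vjoin XY inner_commute)
    then have J: "(\<integral>q. \<Phi> q * expi (s \<bullet> fst q + t \<bullet> snd q) \<partial>(lborel \<Otimes>\<^sub>M lborel))
       = c * (\<integral>t. H t * expi ((Bi *v t) \<bullet> ?y) \<partial>lborel)"
      using ki[of "\<lambda>t. H t * expi ((Bi *v t) \<bullet> ?y)"] k unfolding lborel_prod
      by (simp add: \<Phi>_def mult.assoc)
    let ?qa = "X s \<bullet> (P11 *v X s)" and ?qb = "t \<bullet> (P22 *v t)"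
    have "?y \<bullet> (P *v ?y) = ?qa + 2 * (E s \<bullet> t) + ?qb"
      unfolding P quadratic_block_mat(2)[OF Psym] NX ..
    then have e: "expi (- (?y \<bullet> (P *v ?y)) / 2) * expi (?qa / 2 + ?qb / 2 + E s \<bullet> t) = 1"
      by (simp flip: expi_add) (simp add: field_simps)
    have "f1 s * g1 t * expi (E s \<bullet> t) = ?T ?y * expi (?qa / 2 + ?qb / 2 + E s \<bullet> t)"
      by (simp add: f1_def g1_def tensor_cnj_def expi_add mult_ac)
    also have "?T ?y = c * expi (- (?y \<bullet> (P *v ?y)) / 2) * (\<integral>t. H t * expi ((Bi *v t) \<bullet> ?y) \<partial>lborel)"
      using elim unfolding p fst_conv snd_conv .
    also have "\<dots> * expi (?qa / 2 + ?qb / 2 + E s \<bullet> t) = c * (\<integral>t. H t * expi ((Bi *v t) \<bullet> ?y) \<partial>lborel)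
       * (expi (- (?y \<bullet> (P *v ?y)) / 2) * expi (?qa / 2 + ?qb / 2 + E s \<bullet> t))"
      by (simp only: mult_ac)
    also have "\<dots> = (\<integral>q. \<Phi> q * expi (s \<bullet> fst q + t \<bullet> snd q) \<partial>(lborel \<Otimes>\<^sub>M lborel))"
      unfolding e J by simp
    finally show ?case by (simp add: p)
  qed
  have "(AE s in lborel. f1 s = 0) \<or> (AE t in lborel. g1 t = 0)"
    by (rule chirped_tensor_finite_support[OF E a0 \<Phi>1 \<Phi>2 fin rel]) measurable
  then show ?thesis
  proof
    assume "AE s in lborel. f1 s = 0"
    then have "AE s in lborel. f0 (X s) = 0" by (simp add: f1_def)
    then have "AE x in lborel. f0 (X (Y x)) = 0" by (intro AE_linear_iso[OF Y X]) (simp_all add: XY)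
    then have "aeq f0 (\<lambda>x. 0)" by (simp add: XY aeq_lborel)
    then show ?thesis using aeq_trans[OF ff0] by blast
  next
    assume "AE t in lborel. g1 t = 0"
    then have "aeq g0 (\<lambda>x. 0)" by (simp add: g1_def aeq_lborel)
    then show ?thesis using aeq_trans[OF gg0] by blast
  qed
qed

text \<open>The functions are found from the image: a chirped indicator \<open>G\<close> is
  prescribed, surjectivity provides \<open>F\<close> with image \<open>G\<close>, and for
  block-diagonal \<open>P\<close> the inverse formula shows that \<open>F\<close> is a tensor
  product.\<close>

lemma wigner_compact_support:
  fixes A B C D :: "real ^ ('d::finite + 'd) ^ ('d + 'd)"
  assumes M: "metaplectic_B A B C D U"
    and P: "metaplectic_B.P A B = block_mat P11 0 0 P22"
  shows "\<exists>f\<in>L2. \<exists>g\<in>L2. \<not> aeq f (\<lambda>x. 0) \<and> \<not> aeq g (\<lambda>x. 0) \<and>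
           (\<exists>K. compact K \<and> supported_on (Wigner U f g) K)"
proof -
  interpret metaplectic_B A B C D U by fact
  let ?Q = "cbox 0 One :: (real ^ 'd) set"
  define i where "i = (\<lambda>x. complex_of_real (indicator ?Q x))"
  have [measurable]: "i \<in> borel_measurable borel" unfolding i_def by measurable
  have ii: "integrable lborel i"
    unfolding i_def by (intro integrable_of_real integrable_real_indicator) (auto simp: emeasure_lborel_cbox_eq)
  define I where "I = (\<lambda>u :: real ^ ('d + 'd). i (vfst u) * i (vsnd u))"
  have [measurable]: "I \<in> borel_measurable borel" unfolding I_def by measurable
  have pi: "integrable (lborel \<Otimes>\<^sub>M lborel) (\<lambda>p. i (fst p) * i (snd p))"
    by (rule lborel_pair.Fubini_integrable) (use ii in \<open>auto simp: norm_mult\<close>)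
  obtain \<kappa> :: real where k: "\<kappa> > 0"
    and ki: "\<And>h :: real ^ ('d + 'd) \<Rightarrow> complex. h \<in> borel_measurable borel \<Longrightarrow>
      (\<integral>p. h (vjoin (fst p) (snd p)) \<partial>(lborel \<Otimes>\<^sub>M lborel)) = of_real \<kappa> * (\<integral>x. h x \<partial>lborel)"
    and kint: "\<And>h :: real ^ ('d + 'd) \<Rightarrow> complex. h \<in> borel_measurable borel \<Longrightarrow>
      integrable (lborel \<Otimes>\<^sub>M lborel) (\<lambda>p. h (vjoin (fst p) (snd p))) \<longleftrightarrow> integrable lborel h"
    by (rule vjoin_iso) blast
  have Ii: "integrable lborel I" using kint[of I] pi by (simp add: I_def)
  obtain \<kappa>B :: real where kB: "\<kappa>B > 0"
    and kBi: "\<And>h :: real ^ ('d + 'd) \<Rightarrow> complex. h \<in> borel_measurable borel \<Longrightarrow> (\<integral>x. h (Bi *v x) \<partial>lborel) = of_real \<kappa>B * (\<integral>x. h x \<partial>lborel)"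
    and kBint: "\<And>h :: real ^ ('d + 'd) \<Rightarrow> complex. h \<in> borel_measurable borel \<Longrightarrow> integrable lborel (\<lambda>x. h (Bi *v x)) \<longleftrightarrow> integrable lborel h"
    by (rule B_linear_iso) blast
  \<comment> \<open>This chirp is inverse to the one in \<open>metaplectic_inverse\<close>, so the
    integral there becomes the plain transform of the indicator of a product of two cubes.\<close>
  define G where "G = (\<lambda>t. I (Bi *v t) * expi ((t \<bullet> (\<Lambda> *v t)) / 2))"
  have Gm[measurable]: "G \<in> borel_measurable borel" unfolding G_def by measurable
  have Gi: "integrable lborel G"
    unfolding G_def using kBint[of I] Ii by (intro integrable_mult_bounded[where C=1]) auto
  have "(cmod (G t))\<^sup>2 = cmod (G t)" for t
    by (simp add: G_def I_def i_def norm_mult indicator_def)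
  then have "sqi lborel G" using Gi by (simp add: sqi_def)
  then have GL2: "G \<in> L2" using borel_in_L2_iff[OF Gm] by simp
  obtain F where F: "F \<in> L2" and UF: "aeq (U F) G"
    using U GL2 by (auto simp: metaplectic_def unitary_L2_def)
  obtain c where c: "AE y in lborel. F y = c * expi (- (y \<bullet> (P *v y)) / 2) *
       (\<integral>t. G t * expi (- (t \<bullet> (\<Lambda> *v t)) / 2) * expi ((Bi *v t) \<bullet> y) \<partial>lborel)"
    using metaplectic_inverse F UF Gm Gi by blast
  define q where "q = (\<lambda>s. \<integral>x. i x * expi (s \<bullet> x) \<partial>lborel)"
  have [measurable]: "q \<in> borel_measurable borel" unfolding q_def by measurable
  have sq: "sqi lborel q"
  proof -
    have "(\<integral>\<^sup>+s. ennreal ((cmod (q s))\<^sup>2) \<partial>lborel) \<le> (\<integral>\<^sup>+x. ennreal ((cmod (i x))\<^sup>2) \<partial>lborel)"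
      unfolding q_def by (rule fourier_bessel[OF ii])
    also have "\<dots> = (\<integral>\<^sup>+x. ennreal (cmod (i x)) \<partial>lborel)"
      by (intro nn_integral_cong) (simp add: i_def indicator_def)
    also have "\<dots> < \<infinity>" using ii by (simp add: integrable_iff_bounded)
    finally show ?thesis by (simp add: sqi_def integrable_iff_bounded)
  qed
  \<comment> \<open>The two Jacobians are those of \<open>Bi\<close> and of the passage from pairs
    to vectors.\<close>
  define c' where "c' = c * of_real \<kappa>B / of_real \<kappa>"
  have Geq: "(\<integral>t. G t * expi (- (t \<bullet> (\<Lambda> *v t)) / 2) * expi ((Bi *v t) \<bullet> y) \<partial>lborel)
     = of_real \<kappa>B / of_real \<kappa> * (q (vfst y) * q (vsnd y))" for y
  proof -
    have "(\<integral>t. G t * expi (- (t \<bullet> (\<Lambda> *v t)) / 2) * expi ((Bi *v t) \<bullet> y) \<partial>lborel)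
       = (\<integral>t. I (Bi *v t) * expi ((Bi *v t) \<bullet> y) \<partial>lborel)"
    proof (rule Bochner_Integration.integral_cong[OF refl])
      fix t
      have "G t * expi (- (t \<bullet> (\<Lambda> *v t)) / 2) * expi ((Bi *v t) \<bullet> y)
         = I (Bi *v t) * expi ((Bi *v t) \<bullet> y) * (expi ((t \<bullet> (\<Lambda> *v t)) / 2) * expi (- ((t \<bullet> (\<Lambda> *v t)) / 2)))"
        by (simp add: G_def mult_ac)
      then show "G t * expi (- (t \<bullet> (\<Lambda> *v t)) / 2) * expi ((Bi *v t) \<bullet> y) = I (Bi *v t) * expi ((Bi *v t) \<bullet> y)"
        unfolding expi_minus_mult by simp
    qed
    also have "\<dots> = of_real \<kappa>B * (\<integral>u. I u * expi (u \<bullet> y) \<partial>lborel)"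
      by (rule kBi) measurable
    also have "(\<integral>u. I u * expi (u \<bullet> y) \<partial>lborel) = (\<integral>p. I (vjoin (fst p) (snd p)) * expi (vjoin (fst p) (snd p) \<bullet> y) \<partial>(lborel \<Otimes>\<^sub>M lborel)) / of_real \<kappa>"
      using k by (subst ki[of "\<lambda>u. I u * expi (u \<bullet> y)"]) auto
    also have "(\<integral>p. I (vjoin (fst p) (snd p)) * expi (vjoin (fst p) (snd p) \<bullet> y) \<partial>(lborel \<Otimes>\<^sub>M lborel))
       = (\<integral>p. i (fst p) * i (snd p) * expi (vfst y \<bullet> fst p + vsnd y \<bullet> snd p) \<partial>(lborel \<Otimes>\<^sub>M lborel))"
    proof (rule Bochner_Integration.integral_cong[OF refl])
      fix p :: "(real ^ 'd) \<times> (real ^ 'd)"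
      have "vjoin (fst p) (snd p) \<bullet> y = vfst y \<bullet> fst p + vsnd y \<bullet> snd p"
        using inner_vjoin[of "fst p" "snd p" "vfst y" "vsnd y"] by (simp add: inner_commute)
      then show "I (vjoin (fst p) (snd p)) * expi (vjoin (fst p) (snd p) \<bullet> y) = i (fst p) * i (snd p) * expi (vfst y \<bullet> fst p + vsnd y \<bullet> snd p)"
        by (simp add: I_def)
    qed
    also have "\<dots> = (\<integral>x. \<integral>z. i x * i z * expi (vfst y \<bullet> x + vsnd y \<bullet> z) \<partial>lborel \<partial>lborel)"
    proof -
      have "integrable (lborel \<Otimes>\<^sub>M lborel) (\<lambda>p. i (fst p) * i (snd p) * expi (vfst y \<bullet> fst p + vsnd y \<bullet> snd p))"
        by (rule integrable_mult_bounded[OF pi, where C=1]) auto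
      from lborel_pair.integral_fst'[OF this] show ?thesis by simp
    qed
    also have "\<dots> = (\<integral>x. \<integral>z. (i x * expi (vfst y \<bullet> x)) * (i z * expi (vsnd y \<bullet> z)) \<partial>lborel \<partial>lborel)"
      by (simp add: expi_add mult_ac)
    also have "\<dots> = q (vfst y) * q (vsnd y)" by (simp add: q_def)
    finally show ?thesis by simp
  qed
  \<comment> \<open>All constants go into \<open>f\<close>; \<open>g\<close> is conjugated because
    \<open>tensor_cnj\<close> conjugates it again.\<close>
  define f where "f = (\<lambda>s. c' * expi (- (s \<bullet> (P11 *v s)) / 2) * q s)"
  define g where "g = (\<lambda>t. cnj (expi (- (t \<bullet> (P22 *v t)) / 2) * q t))"
  have fm[measurable]: "f \<in> borel_measurable borel" and gm[measurable]: "g \<in> borel_measurable borel"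
    unfolding f_def g_def by measurable
  have sf: "sqi lborel f" unfolding f_def
    by (rule sqi_bounded_mult[OF sq, where C="cmod c'"]) (auto simp: norm_mult)
  have sg: "sqi lborel g" unfolding g_def
    by (rule sqi_cnj[OF sqi_bounded_mult[OF sq, where C=1]]) auto
  have fL2: "f \<in> L2" and gL2: "g \<in> L2"
    using sf sg borel_in_L2_iff[OF fm] borel_in_L2_iff[OF gm] by auto
  have tL2: "tensor_cnj f g \<in> L2"
    using sqi_tensor_cnj[OF sf sg] borel_in_L2_iff[OF tensor_cnj_measurable[OF fm gm]] by simp
  have Ft: "aeq F (tensor_cnj f g)"
    using c unfolding aeq_lborel
  proof eventually_elim
    case (elim y)
    have Psym: "transpose (block_mat P11 0 0 P22) = block_mat P11 0 0 P22" using P_sym P by simp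
    have "y \<bullet> (P *v y) = vfst y \<bullet> (P11 *v vfst y) + vsnd y \<bullet> (P22 *v vsnd y)"
      using quadratic_block_mat(2)[OF Psym, of "vfst y" "vsnd y"] by (simp add: P transpose_def zero_vec_def[symmetric] matrix_vector_mult_def)
    then have "expi (- (y \<bullet> (P *v y)) / 2) = expi (- (vfst y \<bullet> (P11 *v vfst y)) / 2) * expi (- (vsnd y \<bullet> (P22 *v vsnd y)) / 2)"
      by (simp flip: expi_add) (simp add: field_simps)
    then show ?case unfolding elim Geq by (simp add: tensor_cnj_def f_def g_def c'_def mult_ac)
  qed
  have Ucong: "aeq (U u) (U v)" if "u \<in> L2" "v \<in> L2" "aeq u v" for u v
    using U that by (auto simp: metaplectic_def unitary_L2_def)
  have UT: "aeq (U (tensor_cnj f g)) G"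
    by (rule aeq_trans[OF Ucong[OF tL2 F aeq_sym[OF Ft]] UF])
  \<comment> \<open>Nonvanishing is read off from the image: by linearity a null tensor product
    would have a null image, whereas \<open>G\<close> has modulus one on a set of positive measure.
    Both factors are then nonzero.\<close>
  have nz: "\<not> aeq (tensor_cnj f g) (\<lambda>x. 0)"
  proof
    assume z: "aeq (tensor_cnj f g) (\<lambda>x. 0)"
    have 0: "(\<lambda>x. 0) \<in> (L2 :: (real ^ ('d + 'd) \<Rightarrow> complex) set)" by (simp add: L2_def)
    have "aeq (U (\<lambda>x. 0 * (0::complex) + 0 * 0)) (\<lambda>x. 0 * U (\<lambda>x. 0) x + 0 * U (\<lambda>x. 0) x)"
    proof -
      have "\<forall>f\<in>L2. \<forall>g\<in>L2. \<forall>a b. aeq (U (\<lambda>x. a * f x + b * g x)) (\<lambda>x. a * U f x + b * U g x)"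
        using U by (simp add: metaplectic_def unitary_L2_def)
      from this[rule_format, OF 0 0, of 0 0] show ?thesis .
    qed
    then have "aeq (U (\<lambda>x. 0)) (\<lambda>x. 0)" by simp
    then have "aeq G (\<lambda>x. 0)"
      using aeq_trans[OF aeq_sym[OF UT] aeq_trans[OF Ucong[OF tL2 0 z]]] by blast
    then have "AE t in lborel. I (Bi *v t) = 0" by (simp add: aeq_lborel G_def)
    then have "AE t in lborel. I (Bi *v (B *v t)) = 0"
      by (intro AE_linear_iso[of "(*v) B" "(*v) Bi"]) auto
    then have "AE u in lborel. I u = 0" by simp
    from AE_vjoin[OF this] have "AE p in lborel \<Otimes>\<^sub>M lborel. i (fst p) * i (snd p) = 0" by (simp add: I_def)
    then have "AE x in lborel. AE y in lborel. i x * i y = 0" using lborel_pair.AE_pair by fastforce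
    then have "AE x in lborel. AE y in lborel. x \<notin> ?Q \<or> y \<notin> ?Q" by (simp add: i_def indicator_eq_0_iff)
    have nq: "\<not> (AE x in lborel. x \<notin> ?Q)"
      by (subst AE_iff_null_sets[symmetric]) (auto simp: null_sets_def emeasure_lborel_cbox_eq)
    from \<open>AE x in lborel. AE y in lborel. x \<notin> ?Q \<or> y \<notin> ?Q\<close> have "AE x in lborel. x \<notin> ?Q"
      by eventually_elim (use nq in auto)
    with nq show False by simp
  qed
  have nf: "\<not> aeq f (\<lambda>x. 0)"
  proof
    assume "aeq f (\<lambda>x. 0)"
    from aeq_tensor_cnj[OF this, of g g] nz show False by (simp add: aeq_def tensor_cnj_def)
  qed
  have ng: "\<not> aeq g (\<lambda>x. 0)"
  proof
    assume "aeq g (\<lambda>x. 0)"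
    from aeq_tensor_cnj[OF _ this, of f f] nz show False by (simp add: aeq_def tensor_cnj_def)
  qed
  \<comment> \<open>\<open>G\<close> is nonzero only where B^-1 t lies in the product of the two
    closed cubes, so \<open>B\<close> maps that product onto a compact support.\<close>
  define K where "K = (\<lambda>p. B *v vjoin (fst p) (snd p)) ` (?Q \<times> ?Q)"
  have "linear (\<lambda>p. B *v vjoin (fst p) (snd p))"
    using linear_compose[OF linear_vjoin matrix_vector_mul_linear[of B]] by (simp add: o_def)
  then have "compact K"
    unfolding K_def
    by (intro compact_continuous_image compact_Times compact_cbox linear_continuous_on)
       (simp add: linear_conv_bounded_linear[symmetric])
  moreover have "supported_on (Wigner U f g) K"
    using UT unfolding supported_on_def Wigner_def aeq_def
  proof eventually_elim
    case (elim t)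
    have "t \<in> K" if "G t \<noteq> 0"
    proof -
      have "vfst (Bi *v t) \<in> ?Q" "vsnd (Bi *v t) \<in> ?Q"
        using that by (auto simp: G_def I_def i_def indicator_def split: if_splits)
      then show ?thesis
        unfolding K_def by (intro image_eqI[where x="(vfst (Bi *v t), vsnd (Bi *v t))"]) auto
    qed
    with elim show ?case by auto
  qed
  ultimately show ?thesis using fL2 gL2 nf ng by blast
qed

theorem theorem1p1:
  fixes \<A> :: "real ^ (('d::finite + 'd) + ('d + 'd)) ^ (('d + 'd) + ('d + 'd))"
    and A B C D P :: "real ^ ('d + 'd) ^ ('d + 'd)"
    and P11 P12 P21 P22 :: "real ^ 'd ^ 'd"
    and \<mu> :: "(real ^ ('d + 'd) \<Rightarrow> complex) \<Rightarrow> (real ^ ('d + 'd) \<Rightarrow> complex)"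
  assumes "\<A> \<in> Sp"
    and "\<A> = block_mat A B C D"
    and "invertible B"
    and "P = matrix_inv B ** A"
    and "P = block_mat P11 P12 P21 P22"
    and "metaplectic \<A> \<mu>"
  shows
    "(\<not> (P12 = 0 \<and> P21 = 0) \<longrightarrow>
        (\<forall>f\<in>L2. \<forall>g\<in>L2.
           (\<exists>S\<in>lmeasurable. supported_on (Wigner \<mu> f g) S) \<longrightarrow>
           aeq f (\<lambda>x. 0) \<or> aeq g (\<lambda>x. 0)))
     \<and>
     (P12 = 0 \<and> P21 = 0 \<longrightarrow>
        (\<exists>f\<in>L2. \<exists>g\<in>L2. \<not> aeq f (\<lambda>x. 0) \<and> \<not> aeq g (\<lambda>x. 0) \<and>
           (\<exists>K. compact K \<and> supported_on (Wigner \<mu> f g) K)))"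
proof -
  have M: "metaplectic_B A B C D \<mu>"
    using assms by (simp add: metaplectic_B_def)
  have P: "metaplectic_B.P A B = block_mat P11 P12 P21 P22"
    using assms by (simp add: metaplectic_B.P_def[OF M] metaplectic_B.Bi_def[OF M])
  show ?thesis
    using wigner_uncertainty[OF M P] wigner_compact_support[OF M] P by blast
qed

end
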